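(* Let $\mathcal{C}$ be a cocomplete category and $\mathcal{I}$ a family of morphisms in $\mathcal{C}$ with finitely presentable domains such that $\mathrm{Cell}(\mathcal{I})\subseteq\mathrm{Mono}$. Consider the forgetful functor $V:\mathbb{I}\mathrm{nj}(\mathcal I)\to\mathcal{C}$ with left adjoint $F$. Then: 1. each unit component $\eta_X:X\to VFX$ is $\mathcal{I}$-cellular; 2. the forgetful functor $V:\mathbb{I}\mathrm{nj}(\mathcal I)\to\mathcal{C}$ sends $F\mathcal{I}$-cellular morphisms to $\mathcal{I}$-cellular morphisms; 3. the left adjoint $F$ is faithful.
   Context: A family $\mathcal{I}=(I,\alpha)$ of morphisms in a category $\mathcal{C}$ is a set $I$ with a function assigning to each $i\in I$ a morphism $\alpha_i:A_i\to B_i$; properties of "morphisms of $\mathcal I$" refer to the $\alpha_i$. A morphism is $\mathcal{I}$-cellular if it is a transfinite composite of pushouts of small coproducts of the maps $\alpha_i$; $\mathrm{Cell}(\mathcal I)$ is the class of $\mathcal I$-cellular morphisms. $\mathrm{Mono}$ is the class of monomorphisms of $\mathcal{C}$. $F\mathcal{I}$ is the family $(F\alpha_i)_{i\in I}$ in $\mathbb{I}\mathrm{nj}(\mathcal I)$. An algebraic $\mathcal I$-injective is an object $C$ of $\mathcal{C}$ with, for each $i\in I$ and $f:A_i\to C$, a chosen $c(i,f):B_i\to C$ with $c(i,f)\alpha_i=f$. Morphisms are morphisms of $\mathcal{C}$ commuting with the chosen extensions; this gives the category $\mathbb{I}\mathrm{nj}(\mathcal I)$ and its forgetful functor $V$ to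 $\mathcal{C}$. Under the stated hypotheses the left adjoint $F$ of $V$ exists. *)

theory Defs
  imports Main "HOL-Library.FuncSet"
begin

unbundle cardinal_syntax

section \<open>Categories, functors, colimits\<close>

text \<open>
  Hom-sets need not be disjoint, so a morphism is always considered together with its domain and
  codomain; in particular a functor acts on a morphism of a specified hom-set. This lets a
  morphism of structured objects be literally its underlying morphism. Composition
  is not told the objects involved; a category presented by a set of morphisms
  with domains and codomains is directly of this form.
\<close>

record ('o, 'm) cat =
  Ob :: "'o set"
  Hom :: "'o \<Rightarrow> 'o \<Rightarrow> 'm set"
  Id :: "'o \<Rightarrow> 'm"
  Comp :: "'m \<Rightarrow> 'm \<Rightarrow> 'm"  (infixl "\<cdot>\<index>" 70)

locale category =
  fixes C :: "('o, 'm) cat" (structure)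
  assumes Id_in: "X \<in> Ob C \<Longrightarrow> Id C X \<in> Hom C X X"
    and Comp_in: "\<lbrakk>X \<in> Ob C; Y \<in> Ob C; Z \<in> Ob C; f \<in> Hom C X Y; g \<in> Hom C Y Z\<rbrakk>
      \<Longrightarrow> g \<cdot> f \<in> Hom C X Z"
    and Comp_Id: "\<lbrakk>X \<in> Ob C; Y \<in> Ob C; f \<in> Hom C X Y\<rbrakk> \<Longrightarrow> f \<cdot> Id C X = f"
    and Id_Comp: "\<lbrakk>X \<in> Ob C; Y \<in> Ob C; f \<in> Hom C X Y\<rbrakk> \<Longrightarrow> Id C Y \<cdot> f = f"
    and Comp_assoc: "\<lbrakk>W \<in> Ob C; X \<in> Ob C; Y \<in> Ob C; Z \<in> Ob C;
        f \<in> Hom C W X; g \<in> Hom C X Y; h \<in> Hom C Y Z\<rbrakk>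
      \<Longrightarrow> h \<cdot> g \<cdot> f = h \<cdot> (g \<cdot> f)"

record ('j, 'n, 'o, 'm) fctr =
  Fo :: "'j \<Rightarrow> 'o"
  Fm :: "'j \<Rightarrow> 'j \<Rightarrow> 'n \<Rightarrow> 'm"

definition is_functor ::
  "('j, 'n) cat \<Rightarrow> ('o, 'm) cat \<Rightarrow> ('j, 'n, 'o, 'm) fctr \<Rightarrow> bool" where
  "is_functor J C D \<longleftrightarrow>
     (\<forall>j\<in>Ob J. Fo D j \<in> Ob C) \<and>
     (\<forall>j\<in>Ob J. \<forall>k\<in>Ob J. \<forall>u\<in>Hom J j k. Fm D j k u \<in> Hom C (Fo D j) (Fo D k)) \<and>
     (\<forall>j\<in>Ob J. Fm D j j (Id J j) = Id C (Fo D j)) \<and>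
     (\<forall>j\<in>Ob J. \<forall>k\<in>Ob J. \<forall>l\<in>Ob J. \<forall>u\<in>Hom J j k. \<forall>v\<in>Hom J k l.
        Fm D j l (v \<cdot>\<^bsub>J\<^esub> u) = Fm D k l v \<cdot>\<^bsub>C\<^esub> Fm D j k u)"

definition faithful :: "('j, 'n) cat \<Rightarrow> ('j, 'n, 'o, 'm) fctr \<Rightarrow> bool" where
  "faithful J D \<longleftrightarrow> (\<forall>X\<in>Ob J. \<forall>Y\<in>Ob J. inj_on (Fm D X Y) (Hom J X Y))"

definition is_mono :: "('o, 'm) cat \<Rightarrow> 'o \<Rightarrow> 'o \<Rightarrow> 'm \<Rightarrow> bool" where
  "is_mono C X Y f \<longleftrightarrow>
     X \<in> Ob C \<and> Y \<in> Ob C \<and> f \<in> Hom C X Y \<and>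
     (\<forall>W\<in>Ob C. \<forall>g\<in>Hom C W X. \<forall>h\<in>Hom C W X. f \<cdot>\<^bsub>C\<^esub> g = f \<cdot>\<^bsub>C\<^esub> h \<longrightarrow> g = h)"

definition is_cocone :: "('j, 'n) cat \<Rightarrow> ('o, 'm) cat \<Rightarrow> ('j, 'n, 'o, 'm) fctr \<Rightarrow>
    'o \<Rightarrow> ('j \<Rightarrow> 'm) \<Rightarrow> bool" where
  "is_cocone J C D L \<iota> \<longleftrightarrow>
     L \<in> Ob C \<and> (\<forall>j\<in>Ob J. \<iota> j \<in> Hom C (Fo D j) L) \<and>
     (\<forall>j\<in>Ob J. \<forall>k\<in>Ob J. \<forall>u\<in>Hom J j k. \<iota> k \<cdot>\<^bsub>C\<^esub> Fm D j k u = \<iota> j)"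

definition is_colimit :: "('j, 'n) cat \<Rightarrow> ('o, 'm) cat \<Rightarrow> ('j, 'n, 'o, 'm) fctr \<Rightarrow>
    'o \<Rightarrow> ('j \<Rightarrow> 'm) \<Rightarrow> bool" where
  "is_colimit J C D L \<iota> \<longleftrightarrow>
     is_cocone J C D L \<iota> \<and>
     (\<forall>T \<tau>. is_cocone J C D T \<tau> \<longrightarrow>
        (\<exists>!h. h \<in> Hom C L T \<and> (\<forall>j\<in>Ob J. h \<cdot>\<^bsub>C\<^esub> \<iota> j = \<tau> j)))"

definition is_coproduct ::
  "('o, 'm) cat \<Rightarrow> 's set \<Rightarrow> ('s \<Rightarrow> 'o) \<Rightarrow> 'o \<Rightarrow> ('s \<Rightarrow> 'm) \<Rightarrow> bool" where
  "is_coproduct C S X P \<iota> \<longleftrightarrow>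
     P \<in> Ob C \<and> (\<forall>s\<in>S. X s \<in> Ob C \<and> \<iota> s \<in> Hom C (X s) P) \<and>
     (\<forall>T\<in>Ob C. \<forall>\<tau>. (\<forall>s\<in>S. \<tau> s \<in> Hom C (X s) T) \<longrightarrow>
        (\<exists>!h. h \<in> Hom C P T \<and> (\<forall>s\<in>S. h \<cdot>\<^bsub>C\<^esub> \<iota> s = \<tau> s)))"

text \<open>\<open>is_pushout C P Q X Y g u f v\<close>: the square with sides \<open>g : P \<rightarrow> Q\<close>, \<open>u : P \<rightarrow> X\<close>,
  \<open>f : X \<rightarrow> Y\<close>, \<open>v : Q \<rightarrow> Y\<close> is a pushout, i.e. \<open>f\<close> is the pushout of \<open>g\<close> along \<open>u\<close>.\<close>

definition is_pushout :: "('o, 'm) cat \<Rightarrow> 'o \<Rightarrow> 'o \<Rightarrow> 'o \<Rightarrow> 'o \<Rightarrow>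
    'm \<Rightarrow> 'm \<Rightarrow> 'm \<Rightarrow> 'm \<Rightarrow> bool" where
  "is_pushout C P Q X Y g u f v \<longleftrightarrow>
     P \<in> Ob C \<and> Q \<in> Ob C \<and> X \<in> Ob C \<and> Y \<in> Ob C \<and>
     g \<in> Hom C P Q \<and> u \<in> Hom C P X \<and> f \<in> Hom C X Y \<and> v \<in> Hom C Q Y \<and>
     f \<cdot>\<^bsub>C\<^esub> u = v \<cdot>\<^bsub>C\<^esub> g \<and>
     (\<forall>T\<in>Ob C. \<forall>a\<in>Hom C X T. \<forall>b\<in>Hom C Q T. a \<cdot>\<^bsub>C\<^esub> u = b \<cdot>\<^bsub>C\<^esub> g \<longrightarrow>
        (\<exists>!h. h \<in> Hom C Y T \<and> h \<cdot>\<^bsub>C\<^esub> f = a \<and> h \<cdot>\<^bsub>C\<^esub> v = b))"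

section \<open>Size, cocompleteness, finite presentability\<close>

text \<open>
  Smallness is relative to a cardinal \<open>\<kappa> :: 'k rel\<close>: a set is small when its cardinality is less
  than \<open>\<kappa>\<close>. The usual notion is that of an inaccessible \<open>\<kappa>\<close>; the theory needs only that \<open>\<kappa>\<close> is
  regular and uncountable. Up to isomorphism every small category has its objects and morphisms
  in \<open>'k\<close>, and every small ordinal is a well-order on a subset of \<open>'k\<close>, so quantification over
  small shapes ranges over shapes in \<open>'k\<close>.
\<close>

definition small :: "'k rel \<Rightarrow> 'a set \<Rightarrow> bool" where
  "small \<kappa> S \<longleftrightarrow> |S| <o \<kappa>"

definition small_category :: "'k rel \<Rightarrow> ('j, 'n) cat \<Rightarrow> bool" where
  "small_category \<kappa> J \<longleftrightarrow>
     category J \<and> small \<kappa> {(j, k, u). j \<in> Ob J \<and> k \<in> Ob J \<and> u \<in> Hom J j k}"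

definition cocomplete :: "'k rel \<Rightarrow> ('o, 'm) cat \<Rightarrow> bool" where
  "cocomplete \<kappa> C \<longleftrightarrow>
     (\<forall>(J :: ('k, 'k) cat) D. small_category \<kappa> J \<and> is_functor J C D \<longrightarrow>
        (\<exists>L \<iota>. is_colimit J C D L \<iota>))"

definition filtered :: "('j, 'n) cat \<Rightarrow> bool" where
  "filtered J \<longleftrightarrow>
     Ob J \<noteq> {} \<and>
     (\<forall>j\<in>Ob J. \<forall>k\<in>Ob J. \<exists>l\<in>Ob J. Hom J j l \<noteq> {} \<and> Hom J k l \<noteq> {}) \<and>
     (\<forall>j\<in>Ob J. \<forall>k\<in>Ob J. \<forall>u\<in>Hom J j k. \<forall>v\<in>Hom J j k.
        \<exists>l\<in>Ob J. \<exists>w\<in>Hom J k l. w \<cdot>\<^bsub>J\<^esub> u = w \<cdot>\<^bsub>J\<^esub> v)"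

text \<open>
  The colimit in sets of the diagram \<open>j \<mapsto> Hom C A (D j)\<close>: the disjoint union of these sets
  modulo the equivalence relation generated by \<open>(j, g) \<sim> (k, D u \<cdot> g)\<close> for \<open>u : j \<rightarrow> k\<close>.
\<close>

definition hom_sum :: "('j, 'n) cat \<Rightarrow> ('o, 'm) cat \<Rightarrow> ('j, 'n, 'o, 'm) fctr \<Rightarrow> 'o \<Rightarrow>
    ('j \<times> 'm) set" where
  "hom_sum J C D A = (SIGMA j : Ob J. Hom C A (Fo D j))"

definition hom_step :: "('j, 'n) cat \<Rightarrow> ('o, 'm) cat \<Rightarrow> ('j, 'n, 'o, 'm) fctr \<Rightarrow> 'o \<Rightarrow>
    ('j \<times> 'm) rel" where
  "hom_step J C D A = {((j, g), (k, Fm D j k u \<cdot>\<^bsub>C\<^esub> g)) | j k u g.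
     j \<in> Ob J \<and> k \<in> Ob J \<and> u \<in> Hom J j k \<and> g \<in> Hom C A (Fo D j)}"

definition hom_colimit :: "('j, 'n) cat \<Rightarrow> ('o, 'm) cat \<Rightarrow> ('j, 'n, 'o, 'm) fctr \<Rightarrow> 'o \<Rightarrow>
    ('j \<times> 'm) set set" where
  "hom_colimit J C D A =
     hom_sum J C D A // (hom_step J C D A \<union> (hom_step J C D A)\<inverse>)\<^sup>*"

text \<open>The canonical map to \<open>Hom C A L\<close> induced by a cocone \<open>\<iota>\<close> with vertex \<open>L\<close>; it sends the class
  of \<open>(j, g)\<close> to \<open>\<iota> j \<cdot> g\<close>.\<close>

definition hom_comparison :: "('o, 'm) cat \<Rightarrow> ('j \<Rightarrow> 'm) \<Rightarrow> ('j \<times> 'm) set \<Rightarrow> 'm" where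
  "hom_comparison C \<iota> K = the_elem ((\<lambda>(j, g). \<iota> j \<cdot>\<^bsub>C\<^esub> g) ` K)"

text \<open>\<open>Hom C A (-)\<close> is a functor to small sets and preserves small filtered colimits. Smallness of
  \<open>Hom C A X\<close> is part of the definition; local smallness of \<open>C\<close> is not assumed elsewhere.\<close>

definition finitely_presentable :: "'k rel \<Rightarrow> ('o, 'm) cat \<Rightarrow> 'o \<Rightarrow> bool" where
  "finitely_presentable \<kappa> C A \<longleftrightarrow>
     A \<in> Ob C \<and> (\<forall>X\<in>Ob C. small \<kappa> (Hom C A X)) \<and>
     (\<forall>(J :: ('k, 'k) cat) D L \<iota>.
        small_category \<kappa> J \<and> filtered J \<and> is_functor J C D \<and> is_colimit J C D L \<iota> \<longrightarrow>
        bij_betw (hom_comparison C \<iota>) (hom_colimit J C D A) (Hom C A L))"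

section \<open>Cellular morphisms\<close>

record ('i, 'o, 'm) family =
  Index :: "'i set"
  Src :: "'i \<Rightarrow> 'o"
  Tgt :: "'i \<Rightarrow> 'o"
  Map :: "'i \<Rightarrow> 'm"

definition is_family :: "'k rel \<Rightarrow> ('o, 'm) cat \<Rightarrow> ('i, 'o, 'm) family \<Rightarrow> bool" where
  "is_family \<kappa> C I \<longleftrightarrow>
     small \<kappa> (Index I) \<and>
     (\<forall>i\<in>Index I. Src I i \<in> Ob C \<and> Tgt I i \<in> Ob C \<and> Map I i \<in> Hom C (Src I i) (Tgt I i))"

definition image_family ::
  "('o, 'm, 'p, 'q) fctr \<Rightarrow> ('i, 'o, 'm) family \<Rightarrow> ('i, 'p, 'q) family" where
  "image_family F I =
     \<lparr>Index = Index I, Src = (\<lambda>i. Fo F (Src I i)), Tgt = (\<lambda>i. Fo F (Tgt I i)),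
      Map = (\<lambda>i. Fm F (Src I i) (Tgt I i) (Map I i))\<rparr>"

text \<open>Small coproducts \<open>\<Coprod>\<^sub>s \<alpha>\<^bsub>a s\<^esub>\<close> of members of the family; members may be repeated or omitted.\<close>

definition coproduct_of_members ::
  "'k rel \<Rightarrow> ('o, 'm) cat \<Rightarrow> ('i, 'o, 'm) family \<Rightarrow> 'o \<Rightarrow> 'o \<Rightarrow> 'm \<Rightarrow> bool" where
  "coproduct_of_members \<kappa> C I P Q g \<longleftrightarrow>
     (\<exists>(S :: 'k set) a \<iota> \<iota>'. small \<kappa> S \<and> a ` S \<subseteq> Index I \<and>
        is_coproduct C S (\<lambda>s. Src I (a s)) P \<iota> \<and>
        is_coproduct C S (\<lambda>s. Tgt I (a s)) Q \<iota>' \<and>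
        g \<in> Hom C P Q \<and> (\<forall>s\<in>S. g \<cdot>\<^bsub>C\<^esub> \<iota> s = \<iota>' s \<cdot>\<^bsub>C\<^esub> Map I (a s)))"

definition pushout_of_coproduct ::
  "'k rel \<Rightarrow> ('o, 'm) cat \<Rightarrow> ('i, 'o, 'm) family \<Rightarrow> 'o \<Rightarrow> 'o \<Rightarrow> 'm \<Rightarrow> bool" where
  "pushout_of_coproduct \<kappa> C I X Y f \<longleftrightarrow>
     (\<exists>P Q g u v. coproduct_of_members \<kappa> C I P Q g \<and> is_pushout C P Q X Y g u f v)"

text \<open>The preorder \<open>r\<close> as a category on \<open>Field r\<close>.\<close>

definition order_cat :: "'k rel \<Rightarrow> ('k, unit) cat" where
  "order_cat r =
     \<lparr>Ob = Field r, Hom = (\<lambda>x y. {_. (x, y) \<in> r}), Id = (\<lambda>_. ()), Comp = (\<lambda>_ _. ())\<rparr>"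

definition is_bottom :: "'k rel \<Rightarrow> 'k \<Rightarrow> bool" where
  "is_bottom r m \<longleftrightarrow> m \<in> Field r \<and> (\<forall>x\<in>Field r. (m, x) \<in> r)"

definition is_successor :: "'k rel \<Rightarrow> 'k \<Rightarrow> 'k \<Rightarrow> bool" where
  "is_successor r x y \<longleftrightarrow>
     (x, y) \<in> r \<and> x \<noteq> y \<and> (\<forall>z. (x, z) \<in> r \<and> (z, y) \<in> r \<longrightarrow> z = x \<or> z = y)"

definition is_limit :: "'k rel \<Rightarrow> 'k \<Rightarrow> bool" where
  "is_limit r y \<longleftrightarrow> y \<in> Field r \<and> \<not> is_bottom r y \<and> (\<nexists>x. is_successor r x y)"

text \<open>
  \<open>f : X \<rightarrow> Y\<close> is the composite of a sequence \<open>D\<close> indexed by a small nonzero ordinal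
  (the well-order \<open>r\<close>), with successor steps in \<open>S\<close>, which is a colimit of the
  preceding stages at limit stages; that is, \<open>f\<close> is the leg of a colimit of \<open>D\<close> at the initial
  stage. Length one gives isomorphisms, including identities.
\<close>

definition transfinite_composite ::
  "'k rel \<Rightarrow> ('o, 'm) cat \<Rightarrow> ('o \<Rightarrow> 'o \<Rightarrow> 'm \<Rightarrow> bool) \<Rightarrow> 'o \<Rightarrow> 'o \<Rightarrow> 'm \<Rightarrow> bool" where
  "transfinite_composite \<kappa> C S X Y f \<longleftrightarrow>
     (\<exists>(r :: 'k rel) D m \<iota>.
        Well_order r \<and> small \<kappa> (Field r) \<and> is_bottom r m \<and>
        is_functor (order_cat r) C D \<and>
        (\<forall>x y. is_successor r x y \<longrightarrow> S (Fo D x) (Fo D y) (Fm D x y ())) \<and>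
        (\<forall>y. is_limit r y \<longrightarrow>
           is_colimit (order_cat (Restr r (underS r y))) C D (Fo D y) (\<lambda>x. Fm D x y ())) \<and>
        is_colimit (order_cat r) C D Y \<iota> \<and>
        X = Fo D m \<and> f = \<iota> m)"

definition cellular ::
  "'k rel \<Rightarrow> ('o, 'm) cat \<Rightarrow> ('i, 'o, 'm) family \<Rightarrow> 'o \<Rightarrow> 'o \<Rightarrow> 'm \<Rightarrow> bool" where
  "cellular \<kappa> C I = transfinite_composite \<kappa> C (pushout_of_coproduct \<kappa> C I)"

section \<open>Algebraic injectives\<close>

text \<open>Extension operations are extensional functions, so that an object is determined by
  its values \<open>c (i, f)\<close> for \<open>i\<close> in the index set and \<open>f : A\<^sub>i \<rightarrow> X\<close>.\<close>

definition Inj :: "('o, 'm) cat \<Rightarrow> ('i, 'o, 'm) family \<Rightarrow>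
    ('o \<times> ('i \<times> 'm \<Rightarrow> 'm), 'm) cat" where
  "Inj C I =
     \<lparr>Ob = {(X, c). X \<in> Ob C \<and>
         c \<in> (\<Pi>\<^sub>E (i, f) \<in> (SIGMA i : Index I. Hom C (Src I i) X). Hom C (Tgt I i) X) \<and>
         (\<forall>i\<in>Index I. \<forall>f\<in>Hom C (Src I i) X. c (i, f) \<cdot>\<^bsub>C\<^esub> Map I i = f)},
      Hom = (\<lambda>(X, c) (Y, d). {h \<in> Hom C X Y.
         \<forall>i\<in>Index I. \<forall>f\<in>Hom C (Src I i) X. h \<cdot>\<^bsub>C\<^esub> c (i, f) = d (i, h \<cdot>\<^bsub>C\<^esub> f)}),
      Id = (\<lambda>(X, c). Id C X),
      Comp = Comp C\<rparr>"

definition forget :: "('o \<times> ('i \<times> 'm \<Rightarrow> 'm), 'm, 'o, 'm) fctr" where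
  "forget = \<lparr>Fo = fst, Fm = (\<lambda>_ _ h. h)\<rparr>"

lemma category_Inj:
  assumes "category C" and "is_family \<kappa> C I"
  shows "category (Inj C I)"
proof -
  interpret category C by fact
  have fam: "Src I i \<in> Ob C" "Tgt I i \<in> Ob C" if "i \<in> Index I" for i
    using assms(2) that by (auto simp: is_family_def)
  have ext: "c (i, f) \<in> Hom C (Tgt I i) X"
    if "(X, c) \<in> Ob (Inj C I)" "i \<in> Index I" "f \<in> Hom C (Src I i) X" for X c i f
    using that by (auto simp: Inj_def PiE_iff)
  show ?thesis
  proof (unfold_locales, goal_cases)
    case (1 X)
    obtain X' c where eq: "X = (X', c)" by (cases X)
    have ob: "X' \<in> Ob C"
      using 1 by (simp add: eq Inj_def)
    have "Id C X' \<cdot>\<^bsub>C\<^esub> c (i, f) = c (i, Id C X' \<cdot>\<^bsub>C\<^esub> f)"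
      if i: "i \<in> Index I" and f: "f \<in> Hom C (Src I i) X'" for i f
      using Id_Comp[OF fam(2)[OF i] ob ext[OF 1[unfolded eq] i f]] Id_Comp[OF fam(1)[OF i] ob f]
      by simp
    then show ?case
      using Id_in[OF ob] by (simp add: eq Inj_def)
  next
    case (2 X Y Z f g)
    obtain X' c Y' d Z' e where eq: "X = (X', c)" "Y = (Y', d)" "Z = (Z', e)"
      by (cases X, cases Y, cases Z) auto
    have ob: "X' \<in> Ob C" "Y' \<in> Ob C" "Z' \<in> Ob C"
      using 2 by (auto simp: eq Inj_def)
    have f: "f \<in> Hom C X' Y'" "g \<in> Hom C Y' Z'"
      using 2 by (auto simp: eq Inj_def)
    have "g \<cdot>\<^bsub>C\<^esub> f \<cdot>\<^bsub>C\<^esub> c (i, k) = e (i, g \<cdot>\<^bsub>C\<^esub> f \<cdot>\<^bsub>C\<^esub> k)"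
      if i: "i \<in> Index I" and k: "k \<in> Hom C (Src I i) X'" for i k
    proof -
      have "g \<cdot>\<^bsub>C\<^esub> f \<cdot>\<^bsub>C\<^esub> c (i, k) = g \<cdot>\<^bsub>C\<^esub> (f \<cdot>\<^bsub>C\<^esub> c (i, k))"
        using Comp_assoc ob f fam[OF i] ext[OF 2(1)[unfolded eq] i k] by blast
      also have "\<dots> = e (i, g \<cdot>\<^bsub>C\<^esub> (f \<cdot>\<^bsub>C\<^esub> k))"
        using 2 i k Comp_in[OF fam(1)[OF i] ob(1,2) k f(1)] by (simp add: eq Inj_def)
      also have "g \<cdot>\<^bsub>C\<^esub> (f \<cdot>\<^bsub>C\<^esub> k) = g \<cdot>\<^bsub>C\<^esub> f \<cdot>\<^bsub>C\<^esub> k"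
        using Comp_assoc ob f fam[OF i] k by metis
      finally show ?thesis .
    qed
    then show ?case
      using Comp_in ob f by (auto simp: eq Inj_def)
  next
    case (3 X Y f)
    then show ?case by (auto simp: Inj_def Comp_Id)
  next
    case (4 X Y f)
    then show ?case by (auto simp: Inj_def Id_Comp)
  next
    case (5 W X Y Z f g h)
    then show ?case
      using Comp_assoc by (auto simp: Inj_def)
  qed
qed

lemma is_functor_forget: "is_functor (Inj C I) C forget"
  by (auto simp: is_functor_def Inj_def forget_def)

text \<open>\<open>F : C \<rightarrow> D\<close> is left adjoint to \<open>V : D \<rightarrow> C\<close> with unit \<open>\<eta>\<close>: the natural transformation \<open>\<eta>\<close>
  induces bijections \<open>Hom D (F X) Z \<cong> Hom C X (V Z)\<close>, \<open>g \<mapsto> V g \<cdot> \<eta> X\<close>, natural in \<open>X\<close> and \<open>Z\<close>.\<close>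

definition left_adjoint_with_unit :: "('o, 'm) cat \<Rightarrow> ('p, 'q) cat \<Rightarrow>
    ('p, 'q, 'o, 'm) fctr \<Rightarrow> ('o, 'm, 'p, 'q) fctr \<Rightarrow> ('o \<Rightarrow> 'm) \<Rightarrow> bool" where
  "left_adjoint_with_unit C D V F \<eta> \<longleftrightarrow>
     is_functor D C V \<and> is_functor C D F \<and>
     (\<forall>X\<in>Ob C. \<eta> X \<in> Hom C X (Fo V (Fo F X))) \<and>
     (\<forall>X\<in>Ob C. \<forall>Y\<in>Ob C. \<forall>f\<in>Hom C X Y.
        Fm V (Fo F X) (Fo F Y) (Fm F X Y f) \<cdot>\<^bsub>C\<^esub> \<eta> X = \<eta> Y \<cdot>\<^bsub>C\<^esub> f) \<and>
     (\<forall>X\<in>Ob C. \<forall>Z\<in>Ob D.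
        bij_betw (\<lambda>g. Fm V (Fo F X) Z g \<cdot>\<^bsub>C\<^esub> \<eta> X) (Hom D (Fo F X) Z) (Hom C X (Fo V Z)))"

end

theory Submission imports Defs begin

text \<open>
  Call a map \<open>f : A\<^sub>i \<rightarrow> X\<close> a probe of \<open>X\<close>, and let a partial algebra be an object with chosen extensions
  for some of its probes only. The free algebra on a partial algebra is the colimit of a sequence
  \<open>X = X\<^sub>0 \<rightarrow> X\<^sub>1 \<rightarrow> \<dots>\<close> in which \<open>X\<^sub>n\<^sub>+\<^sub>1\<close> arises from \<open>X\<^sub>n\<close> by attaching extensions of exactly those
  probes of \<open>X\<^sub>n\<close> that do not have one yet. The maps of the sequence are cellular, hence monic, so that
  the extensions chosen at earlier stages are inherited unambiguously; as the domains \<open>A\<^sub>i\<close> are finitely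
  presentable, every probe of the colimit lives on some stage.

  With no chosen extensions this shows that the unit is cellular, hence monic, hence that \<open>F\<close> is
  faithful. For a pushout \<open>M \<rightarrow> N\<close> of a coproduct of members of \<open>F\<I>\<close>, attach the corresponding cells to
  \<open>V M\<close> and keep the extensions that \<open>M\<close> has chosen: the free algebra on this partial algebra is \<open>N\<close>, so
  \<open>V M \<rightarrow> V N\<close> is the composite of a sequence of pushouts. Since \<open>V\<close> creates colimits of chains, \<open>V\<close> sends
  an \<open>F\<I>\<close>-cellular map to a transfinite composite of such composites, which refines to a transfinite
  composite of pushouts.
\<close>

text \<open>An extension chosen for a probe \<open>f\<close> at one stage has to remain the one
  chosen for its image \<open>j \<cdot> f\<close> at the next. Attaching a fresh cell for every
  probe at every stage would break this, and identifying the duplicates afterwards would introduce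
  maps that need not be cellular. Treating only the missing probes avoids quotients, but makes the
  inherited extension a function of \<open>j \<cdot> f\<close>, which is why \<open>j\<close> has to
  be monic. The hypothesis on Cell is applied to these single pushout steps and once more to the
  units.

  \<open>V\<close> need not preserve pushouts, so a pushout in \<open>Inj C I\<close> cannot be
  transferred as it stands. Instead, the morphisms out of it are described by data in
  \<open>C\<close>; any algebra with that description is isomorphic, under the partial algebra, to
  the constructed colimit, and its operations never have to be computed.

  The cost is that one step in \<open>Inj C I\<close> becomes omega many steps in \<open>C\<close>.
  Uncountability of \<open>\<kappa>\<close> makes omega a small length, and regularity keeps the
  product of a small order with omega small.\<close>

section \<open>Functors, cones and colimits over a preorder\<close>

lemma Ob_order_cat [simp]: "Ob (order_cat r) = Field r"
  by (simp add: order_cat_def)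

lemma is_cocone_order_iff:
  "is_cocone (order_cat r) C D L \<iota> \<longleftrightarrow>
     L \<in> Ob C \<and> (\<forall>x\<in>Field r. \<iota> x \<in> Hom C (Fo D x) L) \<and>
     (\<forall>x y. (x, y) \<in> r \<longrightarrow> \<iota> y \<cdot>\<^bsub>C\<^esub> Fm D x y () = \<iota> x)"
  by (auto simp: is_cocone_def order_cat_def intro: FieldI1 FieldI2)

lemma is_colimit_order_iff:
  "is_colimit (order_cat r) C D L \<iota> \<longleftrightarrow> is_cocone (order_cat r) C D L \<iota> \<and>
     (\<forall>T \<tau>. is_cocone (order_cat r) C D T \<tau> \<longrightarrow>
        (\<exists>!h. h \<in> Hom C L T \<and> (\<forall>x\<in>Field r. h \<cdot>\<^bsub>C\<^esub> \<iota> x = \<tau> x)))"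
  by (simp add: is_colimit_def)

lemma is_functor_order_iff:
  "is_functor (order_cat r) C D \<longleftrightarrow>
     (\<forall>x\<in>Field r. Fo D x \<in> Ob C) \<and>
     (\<forall>x y. (x, y) \<in> r \<longrightarrow> Fm D x y () \<in> Hom C (Fo D x) (Fo D y)) \<and>
     (\<forall>x\<in>Field r. Fm D x x () = Id C (Fo D x)) \<and>
     (\<forall>x y z. (x, y) \<in> r \<longrightarrow> (y, z) \<in> r \<longrightarrow> Fm D x z () = Fm D y z () \<cdot>\<^bsub>C\<^esub> Fm D x y ())"
  by (auto simp: is_functor_def order_cat_def intro: FieldI1 FieldI2)
    (meson FieldI1 FieldI2)+

section \<open>Small sets\<close>

lemma small_mono: "A \<subseteq> B \<Longrightarrow> small \<kappa> B \<Longrightarrow> small \<kappa> A"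
  unfolding small_def using card_of_mono1 ordLeq_ordLess_trans by blast

lemma small_image: "small \<kappa> A \<Longrightarrow> small \<kappa> (f ` A)"
  unfolding small_def using card_of_image ordLeq_ordLess_trans by blast

locale small_card =
  fixes \<kappa> :: "'k rel"
  assumes card: "Card_order \<kappa>" and regular: "regularCard \<kappa>" and uncountable: "natLeq <o \<kappa>"
begin

lemma infinite_Field: "\<not> finite (Field \<kappa>)"
proof
  assume "finite (Field \<kappa>)"
  then have "|Field \<kappa>| <o natLeq"
    by (simp add: finite_iff_ordLess_natLeq)
  then have "\<kappa> <o natLeq"
    using card card_of_Field_ordIso ordIso_ordLess_trans ordIso_symmetric by blast
  then show False
    using uncountable ordLess_transitive ordLess_irreflexive by blast
qed

text \<open>Strictness of \<open>natLeq <o \<kappa>\<close> matters: for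
  \<open>\<kappa> = natLeq\<close> a sequence of length omega would not be a small diagram, and free
  algebras are built by such sequences.\<close>

lemma small_nat: "small \<kappa> (UNIV :: nat set)"
  unfolding small_def using uncountable card_of_nat ordIso_ordLess_trans by blast

lemma small_finite: "finite A \<Longrightarrow> small \<kappa> A"
  unfolding small_def using uncountable finite_iff_ordLess_natLeq ordLess_transitive by blast

text \<open>Regularity enters here: for an infinite cardinal it amounts to stability, the closure of
  smallness under small disjoint unions.\<close>

lemma small_Sigma: "small \<kappa> A \<Longrightarrow> (\<And>a. a \<in> A \<Longrightarrow> small \<kappa> (B a)) \<Longrightarrow> small \<kappa> (Sigma A B)"
  unfolding small_def
  using stable_elim[OF regularCard_stable[OF card infinite_Field regular]] by blast

lemma small_embedding:
  fixes A :: "'a set"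
  assumes "small \<kappa> A"
  obtains e :: "'a \<Rightarrow> 'k" where "inj_on e A"
proof -
  have "|A| \<le>o |Field \<kappa>|"
    using assms card card_of_Field_ordIso ordIso_symmetric ordLess_imp_ordLeq
      ordLeq_ordIso_trans unfolding small_def by blast
  then show ?thesis
    using that by (auto simp: card_of_ordLeq[symmetric])
qed

section \<open>Small diagrams over preorders of any type\<close>

text \<open>Cocompleteness and finite presentability speak only of shapes in \<open>'k\<close>; this transfers them to
  preorders on any type.\<close>

lemma preorder_transport:
  fixes r :: "'a rel" and C :: "('o, 'm) cat"
  assumes "small \<kappa> (Field r)" and "refl_on (Field r) r" and "trans r"
    and "is_functor (order_cat r) C D"
  obtains J :: "('k, 'k) cat" and D' :: "('k, 'k, 'o, 'm) fctr" and e
  where "small_category \<kappa> J" and "is_functor J C D'" and "inj_on e (Field r)"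
    and "Ob J = e ` Field r"
    and "\<And>x y. x \<in> Field r \<Longrightarrow> y \<in> Field r \<Longrightarrow> Hom J (e x) (e y) \<noteq> {} \<longleftrightarrow> (x, y) \<in> r"
    and "\<And>x. x \<in> Field r \<Longrightarrow> Fo D' (e x) = Fo D x"
    and "\<And>x y u. (x, y) \<in> r \<Longrightarrow> Fm D' (e x) (e y) u = Fm D x y ()"
    and "\<And>j k u v. u \<in> Hom J j k \<Longrightarrow> v \<in> Hom J j k \<Longrightarrow> u = v"
    and "\<And>L \<iota>. is_colimit J C D' L \<iota> \<longleftrightarrow> is_colimit (order_cat r) C D L (\<iota> \<circ> e)"
proof -
  obtain e :: "'a \<Rightarrow> 'k" where e: "inj_on e (Field r)"
    using small_embedding assms(1) by blast
  define i where "i = inv_into (Field r) e"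
  have i [simp]: "i (e x) = x" if "x \<in> Field r" for x
    using e that by (simp add: i_def)
  have F: "x \<in> Field r \<and> y \<in> Field r" if "(x, y) \<in> r" for x y
    using that by (simp add: FieldI1 FieldI2)
  \<comment> \<open>Morphisms of the transported shape must have type \<open>'k\<close> as well;
    since the shape is thin, one arbitrary element can serve as every arrow.\<close>
  define z :: 'k where "z = undefined"
  define J :: "('k, 'k) cat" where
    "J = \<lparr>Ob = e ` Field r, Hom = (\<lambda>x y. {w. w = z \<and> (i x, i y) \<in> r}), Id = (\<lambda>_. z),
      Comp = (\<lambda>_ _. z)\<rparr>"
  define D' :: "('k, 'k, 'o, 'm) fctr" where "D' = \<lparr>Fo = (\<lambda>x. Fo D (i x)), Fm = (\<lambda>x y _. Fm D (i x) (i y) ())\<rparr>"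
  have "category J"
    by unfold_locales
      (use assms(2,3) in \<open>auto simp: J_def refl_on_def dest: transD\<close>)
  moreover have "small \<kappa> {(j, k, u). j \<in> Ob J \<and> k \<in> Ob J \<and> u \<in> Hom J j k}"
  proof (rule small_mono)
    show "{(j, k, u). j \<in> Ob J \<and> k \<in> Ob J \<and> u \<in> Hom J j k} \<subseteq>
        (e ` Field r) \<times> (e ` Field r) \<times> {z}"
      by (auto simp: J_def)
    show "small \<kappa> ((e ` Field r) \<times> (e ` Field r) \<times> {z})"
      by (intro small_Sigma small_image assms small_finite) auto
  qed
  ultimately have "small_category \<kappa> J"
    by (simp add: small_category_def)
  moreover have "is_functor J C D'"
    unfolding is_functor_def using assms(4)[unfolded is_functor_order_iff]
    by (auto simp add: J_def D'_def)
  moreover have cocone: "is_cocone J C D' T \<tau> \<longleftrightarrow> is_cocone (order_cat r) C D T (\<tau> \<circ> e)" for T \<tau>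
  proof
    assume *: "is_cocone J C D' T \<tau>"
    have "\<tau> (e y) \<cdot>\<^bsub>C\<^esub> Fm D x y () = \<tau> (e x)" if "(x, y) \<in> r" for x y
    proof -
      have "z \<in> Hom J (e x) (e y)" "e x \<in> Ob J" "e y \<in> Ob J"
        using that F[OF that] by (auto simp: J_def)
      then have "\<tau> (e y) \<cdot>\<^bsub>C\<^esub> Fm D' (e x) (e y) z = \<tau> (e x)"
        using * unfolding is_cocone_def by blast
      then show ?thesis
        using F[OF that] by (simp add: D'_def)
    qed
    then show "is_cocone (order_cat r) C D T (\<tau> \<circ> e)"
      using * by (simp add: is_cocone_order_iff) (simp add: is_cocone_def J_def D'_def)
  next
    assume "is_cocone (order_cat r) C D T (\<tau> \<circ> e)"
    then show "is_cocone J C D' T \<tau>"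
      unfolding is_cocone_order_iff by (auto simp: is_cocone_def J_def D'_def)
  qed
  moreover have "is_colimit J C D' L \<iota> \<longleftrightarrow> is_colimit (order_cat r) C D L (\<iota> \<circ> e)" for L \<iota>
  proof -
    have Ob_J: "Ob J = e ` Field r"
      by (simp add: J_def)
    show ?thesis
    proof
      assume L: "is_colimit J C D' L \<iota>"
      show "is_colimit (order_cat r) C D L (\<iota> \<circ> e)"
        unfolding is_colimit_order_iff
      proof (intro conjI allI impI)
        show "is_cocone (order_cat r) C D L (\<iota> \<circ> e)"
          using L by (simp add: is_colimit_def cocone)
        fix T \<tau> assume "is_cocone (order_cat r) C D T \<tau>"
        then have "is_cocone J C D' T (\<tau> \<circ> i)"
          by (simp add: cocone is_cocone_order_iff F)
        then have "\<exists>!h. h \<in> Hom C L T \<and> (\<forall>j\<in>Ob J. h \<cdot>\<^bsub>C\<^esub> \<iota> j = (\<tau> \<circ> i) j)"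
          using L unfolding is_colimit_def by blast
        then show "\<exists>!h. h \<in> Hom C L T \<and> (\<forall>x\<in>Field r. h \<cdot>\<^bsub>C\<^esub> (\<iota> \<circ> e) x = \<tau> x)"
          by (simp add: Ob_J)
      qed
    next
      assume L: "is_colimit (order_cat r) C D L (\<iota> \<circ> e)"
      have "\<exists>!h. h \<in> Hom C L T \<and> (\<forall>j\<in>Ob J. h \<cdot>\<^bsub>C\<^esub> \<iota> j = \<tau> j)"
        if "is_cocone (order_cat r) C D T (\<tau> \<circ> e)" for T \<tau>
      proof -
        have "\<exists>!h. h \<in> Hom C L T \<and> (\<forall>x\<in>Field r. h \<cdot>\<^bsub>C\<^esub> (\<iota> \<circ> e) x = (\<tau> \<circ> e) x)"
          using L that unfolding is_colimit_order_iff by blast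
        then show ?thesis
          by (simp add: Ob_J)
      qed
      then show "is_colimit J C D' L \<iota>"
        using L by (simp add: is_colimit_def cocone)
    qed
  qed
  moreover have "Fm D' (e x) (e y) u = Fm D x y ()" if "(x, y) \<in> r" for x y u
    using F[OF that] by (simp add: D'_def)
  ultimately show thesis
    using e by (intro that[of J D' e]) (simp_all add: J_def D'_def)
qed

lemma preorder_colimit:
  fixes r :: "'a rel" and C :: "('o, 'm) cat"
  assumes "cocomplete \<kappa> C"
    and "small \<kappa> (Field r)" and "refl_on (Field r) r" and "trans r"
    and "is_functor (order_cat r) C D"
  obtains L \<iota> where "is_colimit (order_cat r) C D L \<iota>"
proof -
  show thesis
  proof (rule preorder_transport[OF assms(2-5)])
    fix J :: "('k, 'k) cat" and D' :: "('k, 'k, 'o, 'm) fctr" and e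
    assume J: "small_category \<kappa> J" "is_functor J C D'"
      "\<And>L \<iota>. is_colimit J C D' L \<iota> \<longleftrightarrow> is_colimit (order_cat r) C D L (\<iota> \<circ> e)"
    then obtain L \<iota> where "is_colimit J C D' L \<iota>"
      using assms(1) unfolding cocomplete_def by blast
    then show thesis
      using that J(3) by blast
  qed
qed

text \<open>Surjectivity of the comparison map gives factorizations through a stage, injectivity
  gives equality at a later stage. The second needs an explicit form of the equivalence generated by
  \<open>hom_step\<close>, which directedness supplies.\<close>

lemma finitely_presentable_directed:
  fixes r :: "'a rel" and C :: "('o, 'm) cat"
  assumes "finitely_presentable \<kappa> C A"
    and "small \<kappa> (Field r)" and "refl_on (Field r) r" and "trans r"
    and ne: "Field r \<noteq> {}"
    and dir: "\<And>x y. x \<in> Field r \<Longrightarrow> y \<in> Field r \<Longrightarrow> \<exists>z. (x, z) \<in> r \<and> (y, z) \<in> r"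
    and D: "is_functor (order_cat r) C D" and L: "is_colimit (order_cat r) C D L \<iota>"
    and cat: "category C"
  shows finitely_presentable_factors: "f \<in> Hom C A L \<Longrightarrow> \<exists>x\<in>Field r. \<exists>g\<in>Hom C A (Fo D x). \<iota> x \<cdot>\<^bsub>C\<^esub> g = f"
    and finitely_presentable_equal: "\<lbrakk>x \<in> Field r; y \<in> Field r; g \<in> Hom C A (Fo D x);
        g' \<in> Hom C A (Fo D y); \<iota> x \<cdot>\<^bsub>C\<^esub> g = \<iota> y \<cdot>\<^bsub>C\<^esub> g'\<rbrakk> \<Longrightarrow>
      \<exists>z. (x, z) \<in> r \<and> (y, z) \<in> r \<and> Fm D x z () \<cdot>\<^bsub>C\<^esub> g = Fm D y z () \<cdot>\<^bsub>C\<^esub> g'"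
proof -
  interpret category C by fact
  obtain J :: "('k, 'k) cat" and D' :: "('k, 'k, 'o, 'm) fctr" and e
    where J: "small_category \<kappa> J" "is_functor J C D'" "inj_on e (Field r)"
      "Ob J = e ` Field r"
      "\<And>x y. x \<in> Field r \<Longrightarrow> y \<in> Field r \<Longrightarrow> Hom J (e x) (e y) \<noteq> {} \<longleftrightarrow> (x, y) \<in> r"
      "\<And>x. x \<in> Field r \<Longrightarrow> Fo D' (e x) = Fo D x"
      "\<And>x y u. (x, y) \<in> r \<Longrightarrow> Fm D' (e x) (e y) u = Fm D x y ()"
      "\<And>j k u v. u \<in> Hom J j k \<Longrightarrow> v \<in> Hom J j k \<Longrightarrow> u = v"
      "\<And>L \<iota>. is_colimit J C D' L \<iota> \<longleftrightarrow> is_colimit (order_cat r) C D L (\<iota> \<circ> e)"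
    by (rule preorder_transport[OF assms(2-4) D]) (rule that, assumption+)
  define \<iota>' where "\<iota>' = \<iota> \<circ> inv_into (Field r) e"
  have \<iota>' [simp]: "\<iota>' (e x) = \<iota> x" if "x \<in> Field r" for x
    using J(3) that by (simp add: \<iota>'_def)
  have F: "x \<in> Field r \<and> y \<in> Field r" if "(x, y) \<in> r" for x y
    using that by (simp add: FieldI1 FieldI2)
  have "is_cocone (order_cat r) C D L (\<iota>' \<circ> e) \<longleftrightarrow> is_cocone (order_cat r) C D L \<iota>"
    unfolding is_cocone_order_iff using F by auto
  then have "is_colimit (order_cat r) C D L (\<iota>' \<circ> e)"
    using L by (simp add: is_colimit_order_iff)
  then have colim: "is_colimit J C D' L \<iota>'"
    by (simp add: J(9))
  have "filtered J"
    unfolding filtered_def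
  proof (intro conjI ballI)
    show "Ob J \<noteq> {}"
      using ne J(4) by simp
    show "\<exists>l\<in>Ob J. Hom J j l \<noteq> {} \<and> Hom J k l \<noteq> {}" if jk: "j \<in> Ob J" "k \<in> Ob J" for j k
    proof -
      obtain x y where xy: "j = e x" "k = e y" "x \<in> Field r" "y \<in> Field r"
        using jk J(4) by auto
      then obtain z where "(x, z) \<in> r" "(y, z) \<in> r"
        using dir by blast
      then have "e z \<in> Ob J" "Hom J (e x) (e z) \<noteq> {}" "Hom J (e y) (e z) \<noteq> {}"
        using F J(4,5) xy by auto
      then show ?thesis
        using xy by blast
    qed
    show "\<exists>l\<in>Ob J. \<exists>w\<in>Hom J k l. w \<cdot>\<^bsub>J\<^esub> u = w \<cdot>\<^bsub>J\<^esub> v"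
      if "j \<in> Ob J" "k \<in> Ob J" "u \<in> Hom J j k" "v \<in> Hom J j k" for j k u v
    proof -
      \<comment> \<open>The shape is thin, so parallel arrows are already equal and an identity
        coequalizes them.\<close>
      have "u = v"
        by (rule J(8)[OF that(3,4)])
      moreover have "Id J k \<in> Hom J k k"
        using J(1) that(2) by (simp add: small_category_def category.Id_in)
      ultimately show ?thesis
        using that(2) by (intro bexI[of _ k] bexI[of _ "Id J k"]) simp_all
    qed
  qed
  then have bij: "bij_betw (hom_comparison C \<iota>') (hom_colimit J C D' A) (Hom C A L)"
    using assms(1) J(1,2) colim unfolding finitely_presentable_def by blast
  have A: "A \<in> Ob C"
    using assms(1) by (simp add: finitely_presentable_def)
  define R where "R = (hom_step J C D' A \<union> (hom_step J C D' A)\<inverse>)\<^sup>*"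
  text \<open>Since \<open>r\<close> is directed, being identified later is transitive.\<close>
  define E where "E = {((e x, g), (e y, g')) | x y g g' z. (x, z) \<in> r \<and> (y, z) \<in> r \<and>
      g \<in> Hom C A (Fo D x) \<and> g' \<in> Hom C A (Fo D y) \<and>
      Fm D x z () \<cdot>\<^bsub>C\<^esub> g = Fm D y z () \<cdot>\<^bsub>C\<^esub> g'}"
  have Fo: "Fo D x \<in> Ob C" if "x \<in> Field r" for x
    using D that by (simp add: is_functor_order_iff)
  have Fm: "Fm D x y () \<in> Hom C (Fo D x) (Fo D y)" if "(x, y) \<in> r" for x y
    using D that by (simp add: is_functor_order_iff)
  have later: "Fm D x w () \<cdot>\<^bsub>C\<^esub> g = Fm D z w () \<cdot>\<^bsub>C\<^esub> (Fm D x z () \<cdot>\<^bsub>C\<^esub> g)"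
    if "(x, z) \<in> r" "(z, w) \<in> r" "g \<in> Hom C A (Fo D x)" for x z w g
  proof -
    have "Fm D x w () = Fm D z w () \<cdot>\<^bsub>C\<^esub> Fm D x z ()"
      using D that by (simp add: is_functor_order_iff)
    then show ?thesis
      using Comp_assoc[OF A Fo Fo Fo that(3) Fm Fm] that by (auto simp: FieldI1 FieldI2)
  qed
  have E_trans: "trans E"
  proof (rule transI)
    fix p q s assume "(p, q) \<in> E" "(q, s) \<in> E"
    then obtain x y z g g' y' x' z' h h' where
      1: "p = (e x, g)" "q = (e y, g')" "(x, z) \<in> r" "(y, z) \<in> r"
        "g \<in> Hom C A (Fo D x)" "g' \<in> Hom C A (Fo D y)"
        "Fm D x z () \<cdot>\<^bsub>C\<^esub> g = Fm D y z () \<cdot>\<^bsub>C\<^esub> g'" and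
      2: "q = (e x', h)" "s = (e y', h')" "(x', z') \<in> r" "(y', z') \<in> r"
        "h \<in> Hom C A (Fo D x')" "h' \<in> Hom C A (Fo D y')"
        "Fm D x' z' () \<cdot>\<^bsub>C\<^esub> h = Fm D y' z' () \<cdot>\<^bsub>C\<^esub> h'"
      unfolding E_def by blast
    have eq: "x' = y" "h = g'"
      using 1 2 J(3) by (auto simp: inj_on_def FieldI1)
    obtain w where w: "(z, w) \<in> r" "(z', w) \<in> r"
      using dir 1 2 by (meson FieldI2)
    have "Fm D x w () \<cdot>\<^bsub>C\<^esub> g = Fm D y' w () \<cdot>\<^bsub>C\<^esub> h'"
      using later[OF 1(3) w(1) 1(5)] later[OF 1(4) w(1) 1(6)]
        later[OF 2(3) w(2) 2(5)] later[OF 2(4) w(2) 2(6)] 1(7) 2(7) unfolding eq by simp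
    moreover have "(x, w) \<in> r" "(y', w) \<in> r"
      using w 1 2 \<open>trans r\<close> by (meson transD)+
    ultimately show "(p, s) \<in> E"
      using 1 2 unfolding E_def by blast
  qed
  have E_sym: "sym E"
  proof (rule symI)
    fix p q assume "(p, q) \<in> E"
    then obtain x y z g g' where
      "p = (e x, g)" "q = (e y, g')" "(x, z) \<in> r" "(y, z) \<in> r"
        "g \<in> Hom C A (Fo D x)" "g' \<in> Hom C A (Fo D y)"
        "Fm D y z () \<cdot>\<^bsub>C\<^esub> g' = Fm D x z () \<cdot>\<^bsub>C\<^esub> g"
      unfolding E_def by auto
    then show "(q, p) \<in> E"
      unfolding E_def by blast
  qed
  have step: "hom_step J C D' A \<subseteq> E"
  proof
    fix p assume "p \<in> hom_step J C D' A"
    then obtain x y u g where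
      p: "p = ((e x, g), (e y, Fm D' (e x) (e y) u \<cdot>\<^bsub>C\<^esub> g))" "x \<in> Field r" "y \<in> Field r"
        "u \<in> Hom J (e x) (e y)" "g \<in> Hom C A (Fo D' (e x))"
      unfolding hom_step_def J(4) by blast
    then have xy: "(x, y) \<in> r" "g \<in> Hom C A (Fo D x)"
      using J(5)[of x y] J(6)[of x] by auto
    have yy: "(y, y) \<in> r"
      using assms(3) p by (simp add: refl_on_def)
    have "Fm D x y () \<cdot>\<^bsub>C\<^esub> g \<in> Hom C A (Fo D y)"
      using Comp_in[OF A Fo Fo xy(2) Fm[OF xy(1)]] p by simp
    then show "p \<in> E"
      using p xy yy later[OF xy(1) yy xy(2)] unfolding E_def J(7)[OF xy(1)] by blast
  qed
  \<comment> \<open>\<open>E\<close> relates only elements of the disjoint union, whereas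
    \<open>R\<close> is reflexive on all pairs; hence the reflexive closure.\<close>
  have sub: "R \<subseteq> E\<^sup>="
  proof -
    have "R \<subseteq> E\<^sup>*"
      unfolding R_def using step E_sym by (intro rtrancl_mono) (auto simp: sym_def)
    also have "\<dots> = E\<^sup>="
      using E_trans by (simp add: rtrancl_trancl_reflcl trancl_id)
    finally show ?thesis .
  qed
  have R_comp: "\<iota>' j \<cdot>\<^bsub>C\<^esub> g = \<iota>' k \<cdot>\<^bsub>C\<^esub> g'" if jk: "((j, g), (k, g')) \<in> R" for j k g g'
  proof -
    consider "j = k" "g = g'" | "((j, g), (k, g')) \<in> E"
      using sub jk by auto
    then show ?thesis
    proof cases
      case 2
      then obtain x y z where *: "j = e x" "k = e y" "(x, z) \<in> r" "(y, z) \<in> r"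
        "g \<in> Hom C A (Fo D x)" "g' \<in> Hom C A (Fo D y)"
        "Fm D x z () \<cdot>\<^bsub>C\<^esub> g = Fm D y z () \<cdot>\<^bsub>C\<^esub> g'"
        unfolding E_def by blast
      have cc: "L \<in> Ob C" "\<And>x. x \<in> Field r \<Longrightarrow> \<iota> x \<in> Hom C (Fo D x) L"
          "\<And>x y. (x, y) \<in> r \<Longrightarrow> \<iota> y \<cdot>\<^bsub>C\<^esub> Fm D x y () = \<iota> x"
        using L by (auto simp: is_colimit_order_iff is_cocone_order_iff)
      have F: "x \<in> Field r" "y \<in> Field r" "z \<in> Field r"
        using * by (auto intro: FieldI1 FieldI2)
      have "\<iota> x \<cdot>\<^bsub>C\<^esub> g = \<iota> z \<cdot>\<^bsub>C\<^esub> (Fm D x z () \<cdot>\<^bsub>C\<^esub> g)"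
        using Comp_assoc[OF A Fo Fo cc(1) *(5) Fm[OF *(3)] cc(2)] F cc(3)[OF *(3)] by simp
      moreover have "\<iota> y \<cdot>\<^bsub>C\<^esub> g' = \<iota> z \<cdot>\<^bsub>C\<^esub> (Fm D y z () \<cdot>\<^bsub>C\<^esub> g')"
        using Comp_assoc[OF A Fo Fo cc(1) *(6) Fm[OF *(4)] cc(2)] F cc(3)[OF *(4)] by simp
      ultimately show ?thesis
        using * F by simp
    qed simp
  qed
  have refl: "(p, p) \<in> R" for p
    by (simp add: R_def)
  \<comment> \<open>By \<open>R_comp\<close> the image of a class is a singleton, so
    \<open>the_elem\<close> returns the common value.\<close>
  have val: "hom_comparison C \<iota>' (R `` {(j, g)}) = \<iota>' j \<cdot>\<^bsub>C\<^esub> g" for j g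
  proof -
    have "(\<lambda>(j, g). \<iota>' j \<cdot>\<^bsub>C\<^esub> g) ` (R `` {(j, g)}) = {\<iota>' j \<cdot>\<^bsub>C\<^esub> g}"
    proof (intro equalityI subsetI)
      fix h assume "h \<in> (\<lambda>(j, g). \<iota>' j \<cdot>\<^bsub>C\<^esub> g) ` (R `` {(j, g)})"
      then obtain k g' where "((j, g), (k, g')) \<in> R" "h = \<iota>' k \<cdot>\<^bsub>C\<^esub> g'"
        by auto
      then show "h \<in> {\<iota>' j \<cdot>\<^bsub>C\<^esub> g}"
        using R_comp by simp
    next
      fix h assume "h \<in> {\<iota>' j \<cdot>\<^bsub>C\<^esub> g}"
      then show "h \<in> (\<lambda>(j, g). \<iota>' j \<cdot>\<^bsub>C\<^esub> g) ` (R `` {(j, g)})"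
        using refl[of "(j, g)"] by (intro image_eqI[of _ _ "(j, g)"]) auto
    qed
    then show ?thesis
      by (simp add: hom_comparison_def)
  qed
  have colim_eq: "hom_colimit J C D' A = {R `` {(j, g)} | j g. (j, g) \<in> hom_sum J C D' A}"
    by (auto simp: hom_colimit_def quotient_def R_def)
  have sum: "(e x, g) \<in> hom_sum J C D' A \<longleftrightarrow> g \<in> Hom C A (Fo D x)" if "x \<in> Field r" for x g
    using J(4,6) that by (auto simp: hom_sum_def)
  {
    assume "f \<in> Hom C A L"
    then obtain K where "K \<in> hom_colimit J C D' A" "hom_comparison C \<iota>' K = f"
      using bij by (metis bij_betw_iff_bijections)
    then obtain j g where "(j, g) \<in> hom_sum J C D' A" "\<iota>' j \<cdot>\<^bsub>C\<^esub> g = f"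
      using val colim_eq by auto
    then show "\<exists>x\<in>Field r. \<exists>g\<in>Hom C A (Fo D x). \<iota> x \<cdot>\<^bsub>C\<^esub> g = f"
      using J(4) sum by (auto simp: hom_sum_def intro!: bexI)
  }
  {
    assume *: "x \<in> Field r" "y \<in> Field r" "g \<in> Hom C A (Fo D x)"
        "g' \<in> Hom C A (Fo D y)" "\<iota> x \<cdot>\<^bsub>C\<^esub> g = \<iota> y \<cdot>\<^bsub>C\<^esub> g'"
    have "R `` {(e x, g)} = R `` {(e y, g')}"
    proof (rule inj_onD[OF bij_betw_imp_inj_on[OF bij]])
      show "hom_comparison C \<iota>' (R `` {(e x, g)}) = hom_comparison C \<iota>' (R `` {(e y, g')})"
        using * by (simp add: val)
    qed (use * sum in \<open>auto simp: colim_eq\<close>)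
    then have "((e x, g), (e y, g')) \<in> R"
      using refl by blast
    then consider "((e x, g), (e y, g')) \<in> E" | "e x = e y" "g = g'"
      using sub by auto
    then show "\<exists>z. (x, z) \<in> r \<and> (y, z) \<in> r \<and> Fm D x z () \<cdot>\<^bsub>C\<^esub> g = Fm D y z () \<cdot>\<^bsub>C\<^esub> g'"
    proof cases
      case 1
      show ?thesis
      proof -
        obtain x' y' z where z: "e x = e x'" "e y = e y'" "(x', z) \<in> r" "(y', z) \<in> r"
            "Fm D x' z () \<cdot>\<^bsub>C\<^esub> g = Fm D y' z () \<cdot>\<^bsub>C\<^esub> g'"
          using 1 unfolding E_def by blast
        then have "x' = x" "y' = y"
          using J(3) * by (auto simp: inj_on_def dest: FieldI1)
        then show ?thesis
          using z by blast
      qed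
    next
      case 2
      then show ?thesis
        using inj_onD[OF J(3)] * assms(3) unfolding refl_on_def by metis
    qed
  }
qed

end

section \<open>Arrows and sequences\<close>

context category
begin

text \<open>Hom-sets may overlap, so a morphism is typed by naming both ends. Including membership
  of the ends in \<open>Ob C\<close> lets identity and associativity laws be instantiated from arrow
  facts alone.\<close>

definition arr :: "'m \<Rightarrow> 'o \<Rightarrow> 'o \<Rightarrow> bool" where
  "arr f X Y \<longleftrightarrow> X \<in> Ob C \<and> Y \<in> Ob C \<and> f \<in> Hom C X Y"

lemma arrD: "arr f X Y \<Longrightarrow> X \<in> Ob C" "arr f X Y \<Longrightarrow> Y \<in> Ob C" "arr f X Y \<Longrightarrow> f \<in> Hom C X Y"
  by (simp_all add: arr_def)

lemma arr_Id [intro]: "X \<in> Ob C \<Longrightarrow> arr (Id C X) X X"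
  by (simp add: arr_def Id_in)

lemma arr_comp [intro]: "arr f X Y \<Longrightarrow> arr g Y Z \<Longrightarrow> arr (g \<cdot> f) X Z"
  unfolding arr_def using Comp_in by blast

lemma comp_Id: "arr f X Y \<Longrightarrow> f \<cdot> Id C X = f"
  unfolding arr_def using Comp_Id by blast

lemma Id_comp: "arr f X Y \<Longrightarrow> Id C Y \<cdot> f = f"
  unfolding arr_def using Id_Comp by blast

lemma assoc: "arr f W X \<Longrightarrow> arr g X Y \<Longrightarrow> arr h Y Z \<Longrightarrow> h \<cdot> g \<cdot> f = h \<cdot> (g \<cdot> f)"
  unfolding arr_def using Comp_assoc by blast

lemma is_functor_arr:
  assumes "is_functor J C D"
  shows "j \<in> Ob J \<Longrightarrow> k \<in> Ob J \<Longrightarrow> u \<in> Hom J j k \<Longrightarrow> arr (Fm D j k u) (Fo D j) (Fo D k)"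
  using assms by (auto simp: is_functor_def arr_def)

lemma is_cocone_arr:
  "is_functor J C D \<Longrightarrow> is_cocone J C D L \<iota> \<Longrightarrow> j \<in> Ob J \<Longrightarrow> arr (\<iota> j) (Fo D j) L"
  by (simp add: is_functor_def is_cocone_def arr_def)

lemma is_cocone_comp:
  assumes D: "is_functor J C D" and L: "is_cocone J C D L \<iota>" and h: "arr h L T"
  shows "is_cocone J C D T (\<lambda>j. h \<cdot> \<iota> j)"
  unfolding is_cocone_def
proof (intro conjI ballI)
  show "T \<in> Ob C"
    using h by (rule arrD)
  show "h \<cdot> \<iota> j \<in> Hom C (Fo D j) T" if "j \<in> Ob J" for j
    using arr_comp[OF is_cocone_arr[OF D L that] h] by (rule arrD)
  show "h \<cdot> \<iota> k \<cdot> Fm D j k u = h \<cdot> \<iota> j" if "j \<in> Ob J" "k \<in> Ob J" "u \<in> Hom J j k" for j k u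
    using assoc[OF is_functor_arr[OF D that] is_cocone_arr[OF D L that(2)] h] L that
    by (simp add: is_cocone_def)
qed

lemma is_colimit_ext:
  assumes D: "is_functor J C D" and L: "is_colimit J C D L \<iota>" and h: "arr h L T" and k: "arr k L T"
    and eq: "\<And>j. j \<in> Ob J \<Longrightarrow> h \<cdot> \<iota> j = k \<cdot> \<iota> j"
  shows "h = k"
proof -
  have "is_cocone J C D T (\<lambda>j. h \<cdot> \<iota> j)"
    using is_cocone_comp[OF D _ h] L by (simp add: is_colimit_def)
  then have ex1: "\<exists>!g. g \<in> Hom C L T \<and> (\<forall>j\<in>Ob J. g \<cdot> \<iota> j = h \<cdot> \<iota> j)"
    using L by (simp add: is_colimit_def)
  have "h \<in> Hom C L T \<and> (\<forall>j\<in>Ob J. h \<cdot> \<iota> j = h \<cdot> \<iota> j)"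
    "k \<in> Hom C L T \<and> (\<forall>j\<in>Ob J. k \<cdot> \<iota> j = h \<cdot> \<iota> j)"
    using h k eq by (simp_all add: arr_def)
  with ex1 show ?thesis
    by blast
qed

lemma is_colimit_factor:
  assumes "is_colimit J C D L \<iota>" and "is_cocone J C D T \<tau>"
  obtains h where "arr h L T" and "\<And>j. j \<in> Ob J \<Longrightarrow> h \<cdot> \<iota> j = \<tau> j"
proof -
  have "\<exists>!h. h \<in> Hom C L T \<and> (\<forall>j\<in>Ob J. h \<cdot> \<iota> j = \<tau> j)"
    using assms unfolding is_colimit_def by blast
  moreover have "L \<in> Ob C" "T \<in> Ob C"
    using assms by (auto simp: is_colimit_def is_cocone_def)
  ultimately show thesis
    using that unfolding arr_def by blast
qed

lemma is_colimitI:
  assumes "is_cocone J C D L \<iota>"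
    and "\<And>T \<tau>. is_cocone J C D T \<tau> \<Longrightarrow> \<exists>h. arr h L T \<and> (\<forall>j\<in>Ob J. h \<cdot> \<iota> j = \<tau> j)"
    and "\<And>T h k. arr h L T \<Longrightarrow> arr k L T \<Longrightarrow> (\<And>j. j \<in> Ob J \<Longrightarrow> h \<cdot> \<iota> j = k \<cdot> \<iota> j) \<Longrightarrow> h = k"
  shows "is_colimit J C D L \<iota>"
  unfolding is_colimit_def
proof (intro conjI allI impI)
  fix T \<tau> assume \<tau>: "is_cocone J C D T \<tau>"
  obtain h where h: "arr h L T" "\<forall>j\<in>Ob J. h \<cdot> \<iota> j = \<tau> j"
    using assms(2)[OF \<tau>] by blast
  show "\<exists>!h. h \<in> Hom C L T \<and> (\<forall>j\<in>Ob J. h \<cdot> \<iota> j = \<tau> j)"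
  proof (rule ex1I[of _ h])
    show "h \<in> Hom C L T \<and> (\<forall>j\<in>Ob J. h \<cdot> \<iota> j = \<tau> j)"
      using h by (simp add: arr_def)
    fix k assume "k \<in> Hom C L T \<and> (\<forall>j\<in>Ob J. k \<cdot> \<iota> j = \<tau> j)"
    then show "k = h"
      using h assms(3)[of k T h] by (simp add: arr_def)
  qed
qed (fact assms(1))

lemma is_colimit_iso:
  assumes D: "is_functor J C D" and L: "is_colimit J C D L \<iota>"
    and h: "arr h L L'" and k: "arr k L' L" and hk: "h \<cdot> k = Id C L'" and kh: "k \<cdot> h = Id C L"
  shows "is_colimit J C D L' (\<lambda>j. h \<cdot> \<iota> j)"
proof (rule is_colimitI)
  have coc: "is_cocone J C D L \<iota>"
    using L by (simp add: is_colimit_def)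
  note \<iota> = is_cocone_arr[OF D coc]
  show "is_cocone J C D L' (\<lambda>j. h \<cdot> \<iota> j)"
    using is_cocone_comp[OF D coc h] .
  have k\<iota>: "k \<cdot> (h \<cdot> \<iota> j) = \<iota> j" if "j \<in> Ob J" for j
    using assoc[OF \<iota>[OF that] h k] kh Id_comp[OF \<iota>[OF that]] by simp
  fix T
  show "\<exists>g. arr g L' T \<and> (\<forall>j\<in>Ob J. g \<cdot> (h \<cdot> \<iota> j) = \<tau> j)" if \<tau>: "is_cocone J C D T \<tau>" for \<tau>
  proof -
    obtain g where g: "arr g L T" "\<And>j. j \<in> Ob J \<Longrightarrow> g \<cdot> \<iota> j = \<tau> j"
      using is_colimit_factor[OF L \<tau>] by blast
    have "arr (g \<cdot> k) L' T"
      using k g(1) by blast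
    moreover have "g \<cdot> k \<cdot> (h \<cdot> \<iota> j) = \<tau> j" if "j \<in> Ob J" for j
      using assoc[OF arr_comp[OF \<iota>[OF that] h] k g(1)] g(2)[OF that] k\<iota>[OF that] by simp
    ultimately show ?thesis
      by blast
  qed
  fix g g' assume g: "arr g L' T" "arr g' L' T"
    and eq: "\<And>j. j \<in> Ob J \<Longrightarrow> g \<cdot> (h \<cdot> \<iota> j) = g' \<cdot> (h \<cdot> \<iota> j)"
  have "g \<cdot> h = g' \<cdot> h"
  proof (rule is_colimit_ext[OF D L])
    show "arr (g \<cdot> h) L T" "arr (g' \<cdot> h) L T"
      using g h by blast+
    show "g \<cdot> h \<cdot> \<iota> j = g' \<cdot> h \<cdot> \<iota> j" if "j \<in> Ob J" for j
      using eq[OF that] assoc[OF \<iota>[OF that] h g(1)] assoc[OF \<iota>[OF that] h g(2)] by simp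
  qed
  then show "g = g'"
    using assoc[OF k h g(1)] assoc[OF k h g(2)] hk comp_Id g by metis
qed

section \<open>Sequences of length omega and their colimits\<close>

text \<open>The composite of the steps from \<open>m\<close> up to \<open>n\<close>. The else branch
  gives the identity for \<open>m = Suc n\<close>, as it should; for \<open>m > Suc n\<close> it is
  only a default value.\<close>

primrec chain :: "(nat \<Rightarrow> 'o) \<Rightarrow> (nat \<Rightarrow> 'm) \<Rightarrow> nat \<Rightarrow> nat \<Rightarrow> 'm" where
  "chain X f m 0 = Id C (X m)"
| "chain X f m (Suc n) = (if m \<le> n then f n \<cdot> chain X f m n else Id C (X m))"

definition seq :: "(nat \<Rightarrow> 'o) \<Rightarrow> (nat \<Rightarrow> 'm) \<Rightarrow> bool" where
  "seq X f \<longleftrightarrow> (\<forall>n. arr (f n) (X n) (X (Suc n)))"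

definition seq_diagram :: "(nat \<Rightarrow> 'o) \<Rightarrow> (nat \<Rightarrow> 'm) \<Rightarrow> (nat, unit, 'o, 'm) fctr" where
  "seq_diagram X f = \<lparr>Fo = X, Fm = (\<lambda>m n _. chain X f m n)\<rparr>"

lemma seqD: "seq X f \<Longrightarrow> arr (f n) (X n) (X (Suc n))"
  by (simp add: seq_def)

lemma seq_Ob: "seq X f \<Longrightarrow> X n \<in> Ob C"
  using arrD(1)[OF seqD] .

lemma chain_self [simp]: "chain X f n n = Id C (X n)"
  by (cases n) auto

lemma chain_arr: "m \<le> n \<Longrightarrow> seq X f \<Longrightarrow> arr (chain X f m n) (X m) (X n)"
proof (induction n rule: nat_induct_at_least)
  case base
  then show ?case
    using arr_Id[OF seq_Ob[of X f m]] by simp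
next
  case (Suc n)
  then show ?case
    using arr_comp[OF _ seqD[of X f n]] by simp
qed

lemma chain_step: "seq X f \<Longrightarrow> chain X f n (Suc n) = f n"
  by (simp add: comp_Id[OF seqD[of X f n]])

lemma chain_trans:
  assumes "seq X f" and "m \<le> n" and "n \<le> k"
  shows "chain X f n k \<cdot> chain X f m n = chain X f m k"
  using assms(3)
proof (induction k rule: nat_induct_at_least)
  case base
  show ?case
    using Id_comp[OF chain_arr[OF assms(2,1)]] by simp
next
  case (Suc k)
  show ?case
    using Suc assms(2) assoc[OF chain_arr[OF assms(2,1)] chain_arr[OF Suc.hyps assms(1)] seqD[OF assms(1)]]
    by simp
qed

lemma is_functor_seq_diagram: "seq X f \<Longrightarrow> is_functor (order_cat natLeq) C (seq_diagram X f)"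
  unfolding is_functor_order_iff
  using seq_Ob[of X f] arrD(3)[OF chain_arr[of _ _ X f]] chain_trans[of X f]
  by (simp add: seq_diagram_def natLeq_def)

lemma seq_cocone_chain:
  assumes "is_cocone (order_cat natLeq) C (seq_diagram X f) L \<iota>" and "m \<le> n"
  shows "\<iota> n \<cdot> chain X f m n = \<iota> m"
  using assms by (auto simp: is_cocone_order_iff seq_diagram_def natLeq_def)

lemma is_cocone_seq_iff:
  assumes "seq X f"
  shows "is_cocone (order_cat natLeq) C (seq_diagram X f) L \<iota> \<longleftrightarrow>
    (\<forall>n. arr (\<iota> n) (X n) L) \<and> (\<forall>n. \<iota> (Suc n) \<cdot> f n = \<iota> n)"
proof (intro iffI conjI allI)
  assume L: "is_cocone (order_cat natLeq) C (seq_diagram X f) L \<iota>"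
  fix n
  show "arr (\<iota> n) (X n) L"
    using L seq_Ob[OF assms] by (simp add: is_cocone_order_iff seq_diagram_def Field_natLeq arr_def)
  have "\<iota> (Suc n) \<cdot> chain X f n (Suc n) = \<iota> n"
    by (rule seq_cocone_chain[OF L]) simp
  then show "\<iota> (Suc n) \<cdot> f n = \<iota> n"
    using chain_step[OF assms] by simp
next
  assume L: "(\<forall>n. arr (\<iota> n) (X n) L) \<and> (\<forall>n. \<iota> (Suc n) \<cdot> f n = \<iota> n)"
  have "\<iota> n \<cdot> chain X f m n = \<iota> m" if "m \<le> n" for m n
    using that
  proof (induction n rule: nat_induct_at_least)
    case base
    show ?case
      using comp_Id L by auto
  next
    case (Suc n)
    have "\<iota> (Suc n) \<cdot> (f n \<cdot> chain X f m n) = \<iota> n \<cdot> chain X f m n"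
      using L assoc[OF chain_arr[OF Suc.hyps assms] seqD[OF assms], of "\<iota> (Suc n)" L] by simp
    then show ?case
      using Suc by simp
  qed
  then show "is_cocone (order_cat natLeq) C (seq_diagram X f) L \<iota>"
    using L by (auto simp: is_cocone_order_iff seq_diagram_def natLeq_def arr_def)
qed

text \<open>The length is exactly omega rather than at most omega, so that blocks placed one after
  the other are indexed by a plain product with \<open>nat\<close>.\<close>

definition sequential_composite ::
  "('o \<Rightarrow> 'o \<Rightarrow> 'm \<Rightarrow> bool) \<Rightarrow> 'o \<Rightarrow> 'o \<Rightarrow> 'm \<Rightarrow> bool" where
  "sequential_composite S X Y g \<longleftrightarrow> (\<exists>Xs f \<iota>. Xs 0 = X \<and> seq Xs f \<and>
     (\<forall>n. S (Xs n) (Xs (Suc n)) (f n)) \<and>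
     is_colimit (order_cat natLeq) C (seq_diagram Xs f) Y \<iota> \<and> g = \<iota> 0)"

lemma sequential_composite_iso:
  assumes "sequential_composite S X Y g" and "arr h Y Y'" and "arr k Y' Y"
    and "h \<cdot> k = Id C Y'" and "k \<cdot> h = Id C Y"
  shows "sequential_composite S X Y' (h \<cdot> g)"
proof -
  obtain Xs f \<iota> where Xs: "Xs 0 = X" "seq Xs f" "\<forall>n. S (Xs n) (Xs (Suc n)) (f n)"
    and "is_colimit (order_cat natLeq) C (seq_diagram Xs f) Y \<iota>" and g: "g = \<iota> 0"
    using assms(1) unfolding sequential_composite_def by blast
  then have "is_colimit (order_cat natLeq) C (seq_diagram Xs f) Y' (\<lambda>n. h \<cdot> \<iota> n)"
    using is_colimit_iso[OF is_functor_seq_diagram _ assms(2-5)] by blast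
  then show ?thesis
    unfolding sequential_composite_def using Xs g
    by (intro exI[of _ Xs] exI[of _ f] exI[of _ "\<lambda>n. h \<cdot> \<iota> n"]) simp
qed

text \<open>Since 1 + omega = omega, a sequence with one more step in front still has length omega,
  and dropping its first stage does not change the colimit.\<close>

lemma sequential_composite_Cons:
  assumes f: "arr f X Y" "S X Y f" and g: "sequential_composite S Y Z g"
  shows "sequential_composite S X Z (g \<cdot> f)"
proof -
  obtain Xs fs \<iota> where Xs: "Xs 0 = Y" "seq Xs fs" "\<And>n. S (Xs n) (Xs (Suc n)) (fs n)"
    and colim: "is_colimit (order_cat natLeq) C (seq_diagram Xs fs) Z \<iota>" and g: "g = \<iota> 0"
    using g unfolding sequential_composite_def by blast
  define Xs' where "Xs' = case_nat X Xs"
  define fs' where "fs' = case_nat f fs"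
  define \<iota>' where "\<iota>' = case_nat (g \<cdot> f) \<iota>"
  have seq: "seq Xs' fs'"
    using f Xs by (auto simp: seq_def Xs'_def fs'_def split: nat.split)
  have "is_cocone (order_cat natLeq) C (seq_diagram Xs fs) Z \<iota>"
    using colim by (simp add: is_colimit_def)
  then have \<iota>: "arr (\<iota> n) (Xs n) Z" "\<iota> (Suc n) \<cdot> fs n = \<iota> n" for n
    by (auto simp: is_cocone_seq_iff[OF Xs(2)])
  have gf: "arr (g \<cdot> f) X Z"
    using f \<iota>(1)[of 0] Xs(1) g by auto
  have "is_colimit (order_cat natLeq) C (seq_diagram Xs' fs') Z \<iota>'"
  proof (rule is_colimitI)
    show "is_cocone (order_cat natLeq) C (seq_diagram Xs' fs') Z \<iota>'"
      unfolding is_cocone_seq_iff[OF seq] using \<iota> gf g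
      by (auto simp: Xs'_def fs'_def \<iota>'_def split: nat.split)
    show "\<exists>h. arr h Z T \<and> (\<forall>j\<in>Ob (order_cat natLeq). h \<cdot> \<iota>' j = \<tau> j)"
      if "is_cocone (order_cat natLeq) C (seq_diagram Xs' fs') T \<tau>" for T \<tau>
    proof -
      have \<tau>: "arr (\<tau> n) (Xs' n) T" "\<tau> (Suc n) \<cdot> fs' n = \<tau> n" for n
        using that by (auto simp: is_cocone_seq_iff[OF seq])
      have "is_cocone (order_cat natLeq) C (seq_diagram Xs fs) T (\<lambda>n. \<tau> (Suc n))"
        unfolding is_cocone_seq_iff[OF Xs(2)]
        using \<tau>(1)[of "Suc _"] \<tau>(2)[of "Suc _"] by (simp add: Xs'_def fs'_def)
      then obtain h where h: "arr h Z T" "\<And>n. h \<cdot> \<iota> n = \<tau> (Suc n)"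
        using is_colimit_factor[OF colim] by (metis Ob_order_cat Field_natLeq UNIV_I)
      have "h \<cdot> (g \<cdot> f) = \<tau> 0"
        using assoc[OF f(1) _ h(1), of g] \<iota>(1)[of 0] Xs(1) g h(2)[of 0] \<tau>(2)[of 0] by (simp add: fs'_def)
      then have "h \<cdot> \<iota>' n = \<tau> n" for n
        using h by (cases n) (simp_all add: \<iota>'_def)
      then show ?thesis
        using h(1) by blast
    qed
    show "h = k" if "arr h Z T" "arr k Z T"
      "\<And>j. j \<in> Ob (order_cat natLeq) \<Longrightarrow> h \<cdot> \<iota>' j = k \<cdot> \<iota>' j" for T h k
    proof (rule is_colimit_ext[OF is_functor_seq_diagram[OF Xs(2)] colim that(1,2)])
      show "h \<cdot> \<iota> n = k \<cdot> \<iota> n" for n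
        using that(3)[of "Suc n"] by (simp add: \<iota>'_def Field_natLeq)
    qed
  qed
  moreover have "Xs' 0 = X" "\<iota>' 0 = g \<cdot> f" "S (Xs' n) (Xs' (Suc n)) (fs' n)" for n
    using Xs f by (auto simp: Xs'_def \<iota>'_def fs'_def split: nat.split)
  ultimately show ?thesis
    using seq unfolding sequential_composite_def by metis
qed

end

section \<open>Transfinite composites\<close>

lemma is_cocone_cong: "(\<And>j. j \<in> Ob J \<Longrightarrow> \<iota> j = \<iota>' j) \<Longrightarrow> is_cocone J C D L \<iota> \<longleftrightarrow> is_cocone J C D L \<iota>'"
  unfolding is_cocone_def by simp

lemma is_colimit_cong:
  assumes "\<And>j. j \<in> Ob J \<Longrightarrow> \<iota> j = \<iota>' j"
  shows "is_colimit J C D L \<iota> \<longleftrightarrow> is_colimit J C D L \<iota>'"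
  unfolding is_colimit_def by (rule conj_cong[OF is_cocone_cong[OF assms]]) (simp_all add: assms)

lemma is_colimit_dir_image:
  assumes e: "inj_on e (Field r)"
    and Fo: "\<And>x. x \<in> Field r \<Longrightarrow> Fo D' (e x) = Fo D x"
    and Fm: "\<And>x y. (x, y) \<in> r \<Longrightarrow> Fm D' (e x) (e y) () = Fm D x y ()"
  shows "is_colimit (order_cat (dir_image r e)) C D' L \<iota> \<longleftrightarrow> is_colimit (order_cat r) C D L (\<iota> \<circ> e)"
proof -
  have cocone: "is_cocone (order_cat (dir_image r e)) C D' T \<tau> \<longleftrightarrow>
      is_cocone (order_cat r) C D T (\<tau> \<circ> e)" for T \<tau>
  proof -
    have "(\<forall>p q. (p, q) \<in> dir_image r e \<longrightarrow> \<tau> q \<cdot>\<^bsub>C\<^esub> Fm D' p q () = \<tau> p) \<longleftrightarrow>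
        (\<forall>x y. (x, y) \<in> r \<longrightarrow> \<tau> (e y) \<cdot>\<^bsub>C\<^esub> Fm D' (e x) (e y) () = \<tau> (e x))"
      unfolding dir_image_def by blast
    then show ?thesis
      unfolding is_cocone_order_iff dir_image_Field using Fo Fm by simp
  qed
  show ?thesis
    unfolding is_colimit_def cocone
  proof (intro conj_cong refl iffI allI impI, goal_cases)
    case (1 T \<tau>)
    have inv: "inv_into (Field r) e (e x) = x" if "x \<in> Field r" for x
      using e that by simp
    have "is_cocone (order_cat r) C D T (\<tau> \<circ> inv_into (Field r) e \<circ> e)"
      using 1(3) unfolding is_cocone_order_iff
      by (auto simp: inv) (metis FieldI1 FieldI2 inv)
    then have "\<exists>!h. h \<in> Hom C L T \<and> (\<forall>x\<in>Field (dir_image r e).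
        h \<cdot>\<^bsub>C\<^esub> \<iota> x = (\<tau> \<circ> inv_into (Field r) e) x)"
      using 1(2) by (simp del: o_apply)
    then show ?case
      by (simp add: dir_image_Field inv)
  next
    case (2 T \<tau>)
    then have "\<exists>!h. h \<in> Hom C L T \<and> (\<forall>x\<in>Field r. h \<cdot>\<^bsub>C\<^esub> (\<iota> \<circ> e) x = (\<tau> \<circ> e) x)"
      by (simp del: o_apply)
    then show ?case
      by (simp add: dir_image_Field)
  qed
qed

context small_card
begin

text \<open>The definition asks for a well-order on a subset of \<open>'k\<close>. Copying a small
  well-order of any type along an embedding makes other index types available, in particular pairs
  and natural numbers.\<close>

lemma transfinite_compositeI:
  fixes r :: "'a rel" and C :: "('o, 'm) cat"
  assumes r: "Well_order r" and small: "small \<kappa> (Field r)" and m: "is_bottom r m"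
    and D: "is_functor (order_cat r) C D"
    and succ: "\<And>x y. is_successor r x y \<Longrightarrow> S (Fo D x) (Fo D y) (Fm D x y ())"
    and lim: "\<And>y. is_limit r y \<Longrightarrow>
      is_colimit (order_cat (Restr r (underS r y))) C D (Fo D y) (\<lambda>x. Fm D x y ())"
    and colim: "is_colimit (order_cat r) C D Y \<iota>"
  shows "transfinite_composite \<kappa> C S (Fo D m) Y (\<iota> m)"
proof -
  obtain e :: "'a \<Rightarrow> 'k" where e: "inj_on e (Field r)"
    using small_embedding small by blast
  define i where "i = inv_into (Field r) e"
  have i [simp]: "i (e x) = x" if "x \<in> Field r" for x
    using e that by (simp add: i_def)
  have F: "x \<in> Field r \<and> y \<in> Field r" if "(x, y) \<in> r" for x y
    using that by (simp add: FieldI1 FieldI2)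
  have e_eq: "e x = e y \<longleftrightarrow> x = y" if "x \<in> Field r" "y \<in> Field r" for x y
    using e that by (auto simp: inj_on_def)
  have trans_r: "trans r"
    using r by (simp add: order_on_defs)
  define r' where "r' = dir_image r e"
  define D' :: "('k, unit, 'o, 'm) fctr" where
    "D' = \<lparr>Fo = (\<lambda>x. Fo D (i x)), Fm = (\<lambda>x y _. Fm D (i x) (i y) ())\<rparr>"
  have Fo': "Fo D' (e x) = Fo D x" if "x \<in> Field r" for x
    using that by (simp add: D'_def)
  have Fm': "Fm D' (e x) (e y) u = Fm D x y ()" if "(x, y) \<in> r" for x y u
    using F[OF that] by (simp add: D'_def)
  have Field: "Field r' = e ` Field r"
    by (simp add: r'_def dir_image_Field)
  have r'_iff: "(e x, e y) \<in> r' \<longleftrightarrow> (x, y) \<in> r" if "x \<in> Field r" "y \<in> Field r" for x y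
    using that F e_eq by (auto simp: r'_def dir_image_def)
  have r'E: "\<exists>x y. p = e x \<and> q = e y \<and> (x, y) \<in> r" if "(p, q) \<in> r'" for p q
    using that by (auto simp: r'_def dir_image_def)
  have wo: "Well_order r'"
    unfolding r'_def using Well_order_dir_image r e by blast
  have bot_iff: "is_bottom r' (e x) \<longleftrightarrow> is_bottom r x" if "x \<in> Field r" for x
    unfolding is_bottom_def Field using that r'_iff by auto
  have succ_iff: "is_successor r' (e x) (e y) \<longleftrightarrow> is_successor r x y"
    if "x \<in> Field r" "y \<in> Field r" for x y
  proof
    assume *: "is_successor r' (e x) (e y)"
    show "is_successor r x y"
      unfolding is_successor_def
    proof (intro conjI allI impI)
      show "(x, y) \<in> r" "x \<noteq> y"
        using * that r'_iff by (auto simp: is_successor_def)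
      fix z assume z: "(x, z) \<in> r \<and> (z, y) \<in> r"
      then have "(e x, e z) \<in> r' \<and> (e z, e y) \<in> r'"
        using r'_iff F that by blast
      then have "e z = e x \<or> e z = e y"
        using * unfolding is_successor_def by blast
      then show "z = x \<or> z = y"
        using e_eq F z that by blast
    qed
  next
    assume *: "is_successor r x y"
    show "is_successor r' (e x) (e y)"
      unfolding is_successor_def
    proof (intro conjI allI impI)
      show "(e x, e y) \<in> r'" "e x \<noteq> e y"
        using * that r'_iff e_eq by (auto simp: is_successor_def)
      fix p assume "(e x, p) \<in> r' \<and> (p, e y) \<in> r'"
      moreover from this obtain z where "p = e z" "z \<in> Field r"
        using r'E F by blast
      ultimately have "p = e z" "(x, z) \<in> r \<and> (z, y) \<in> r"
        using r'_iff that by auto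
      then show "p = e x \<or> p = e y"
        using * unfolding is_successor_def by blast
    qed
  qed
  have D'_functor: "is_functor (order_cat r') C D'"
    unfolding is_functor_order_iff
  proof (intro conjI ballI allI impI)
    note D' = D[unfolded is_functor_order_iff]
    show "Fo D' p \<in> Ob C" if "p \<in> Field r'" for p
      using that D' by (auto simp: Field Fo')
    show "Fm D' p q () \<in> Hom C (Fo D' p) (Fo D' q)" if "(p, q) \<in> r'" for p q
      using r'E[OF that] D' F by (auto simp: Fo' Fm')
    show "Fm D' p p () = Id C (Fo D' p)" if "p \<in> Field r'" for p
      using that D' by (auto simp: Field D'_def)
    fix p q s assume "(p, q) \<in> r'" "(q, s) \<in> r'"
    moreover from this obtain x y z where "p = e x" "q = e y" "s = e z"
        "x \<in> Field r" "y \<in> Field r" "z \<in> Field r"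
      using r'E F by metis
    ultimately have "(x, y) \<in> r" "(y, z) \<in> r" "p = e x" "q = e y" "s = e z"
      using r'_iff by auto
    moreover from this have "(x, z) \<in> r"
      using transD[OF trans_r] by blast
    ultimately show "Fm D' p s () = Fm D' q s () \<cdot>\<^bsub>C\<^esub> Fm D' p q ()"
      using D' by (simp add: Fm')
  qed
  have limit: "is_colimit (order_cat (Restr r' (underS r' q))) C D' (Fo D' q) (\<lambda>p. Fm D' p q ())"
    if q_lim: "is_limit r' q" for q
  proof -
    obtain y where q: "q = e y" "y \<in> Field r"
      using q_lim by (auto simp: is_limit_def Field)
    have "is_limit r y"
    proof -
      have "\<not> is_successor r x y" for x
      proof
        assume *: "is_successor r x y"
        then have "x \<in> Field r"
          using F by (auto simp: is_successor_def)
        then have "is_successor r' (e x) q"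
          using * succ_iff q by simp
        then show False
          using q_lim by (auto simp: is_limit_def)
      qed
      then show ?thesis
        using q_lim q bot_iff by (simp add: is_limit_def)
    qed
    then have L: "is_colimit (order_cat (Restr r (underS r y))) C D (Fo D y) (\<lambda>x. Fm D x y ())"
      by (rule lim)
    let ?s = "Restr r (underS r y)"
    have under: "underS r' q = e ` underS r y"
    proof (intro equalityI subsetI)
      fix p assume "p \<in> underS r' q"
      then have p: "p \<noteq> q" "(p, q) \<in> r'"
        by (auto simp: underS_def)
      then obtain x z where "p = e x" "q = e z" "(x, z) \<in> r"
        using r'E by blast
      then have "p = e x" "x \<noteq> y" "(x, y) \<in> r"
        using p q e_eq F by auto
      then show "p \<in> e ` underS r y"
        by (auto simp: underS_def)
    next
      fix p assume "p \<in> e ` underS r y"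
      then obtain x where "p = e x" "x \<noteq> y" "(x, y) \<in> r"
        by (auto simp: underS_def)
      then show "p \<in> underS r' q"
        using q r'_iff e_eq F by (auto simp: underS_def)
    qed
    have Fs: "Field ?s \<subseteq> underS r y" "Field ?s \<subseteq> Field r"
      using F by (auto simp: Field_def)
    have res: "Restr r' (underS r' q) = dir_image ?s e"
    proof -
      have U: "underS r y \<subseteq> Field r"
        using F by (auto simp: underS_def)
      show ?thesis
        unfolding under
      proof (intro equalityI subrelI)
        fix p p' assume "(p, p') \<in> Restr r' (e ` underS r y)"
        then obtain x x' where "p = e x" "p' = e x'" "x \<in> underS r y" "x' \<in> underS r y"
            "(e x, e x') \<in> r'"
          by blast
        then show "(p, p') \<in> dir_image ?s e"
          using r'_iff[of x x'] U by (auto simp: dir_image_def)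
      next
        fix p p' assume "(p, p') \<in> dir_image ?s e"
        then show "(p, p') \<in> Restr r' (e ` underS r y)"
          using r'_iff U by (auto simp: dir_image_def)
      qed
    qed
    have "Fm D x y () = ((\<lambda>p. Fm D' p q ()) \<circ> e) x" if "x \<in> Ob (order_cat ?s)" for x
      using that Fs q Fm'[of x y] by (auto simp: underS_def)
    then have "is_colimit (order_cat ?s) C D (Fo D y) ((\<lambda>p. Fm D' p q ()) \<circ> e)"
      using L is_colimit_cong[of "order_cat ?s" "\<lambda>x. Fm D x y ()" "(\<lambda>p. Fm D' p q ()) \<circ> e" C D "Fo D y"]
      by blast
    moreover have "Fm D' (e x) (e z) () = Fm D x z ()" if "(x, z) \<in> ?s" for x z
      using that Fm' by simp
    moreover have "Fo D' (e x) = Fo D x" if "x \<in> Field ?s" for x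
      using that Fo' Fs by blast
    moreover have "inj_on e (Field ?s)"
      using e Fs inj_on_subset by blast
    ultimately show ?thesis
      unfolding res using is_colimit_dir_image[of e ?s D' D C "Fo D y"] q Fo' by simp
  qed
  have "is_colimit (order_cat r) C D Y (\<iota> \<circ> i \<circ> e)"
    using colim is_colimit_cong[of "order_cat r" "\<iota> \<circ> i \<circ> e" \<iota> C D Y] by simp
  then have colim': "is_colimit (order_cat r') C D' Y (\<iota> \<circ> i)"
    unfolding r'_def using is_colimit_dir_image[of e r D' D C Y "\<iota> \<circ> i"] Fo' Fm' e by simp
  have m': "m \<in> Field r"
    using m by (simp add: is_bottom_def)
  have succ': "S (Fo D' p) (Fo D' q) (Fm D' p q ())" if pq: "is_successor r' p q" for p q
  proof -
    obtain x y where xy: "p = e x" "q = e y" "(x, y) \<in> r"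
      using r'E pq unfolding is_successor_def by blast
    then have "is_successor r x y"
      using pq succ_iff F by blast
    then show ?thesis
      using succ xy F by (simp add: Fo' Fm')
  qed
  show ?thesis
    unfolding transfinite_composite_def
  proof (rule exI[of _ r'], rule exI[of _ D'], rule exI[of _ "e m"], rule exI[of _ "\<iota> \<circ> i"],
      intro conjI allI impI)
    show "small \<kappa> (Field r')"
      unfolding Field by (rule small_image[OF small])
    show "is_bottom r' (e m)"
      using bot_iff[OF m'] m by simp
    show "Fo D m = Fo D' (e m)" "\<iota> m = (\<iota> \<circ> i) (e m)"
      using m' by (simp_all add: Fo')
    show "S (Fo D' p) (Fo D' q) (Fm D' p q ())" if "is_successor r' p q" for p q
      by (rule succ'[OF that])
    show "is_colimit (order_cat (Restr r' (underS r' q))) C D' (Fo D' q) (\<lambda>p. Fm D' p q ())"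
      if "is_limit r' q" for q
      by (rule limit[OF that])
    show "is_colimit (order_cat r') C D' Y (\<iota> \<circ> i)"
      by (rule colim')
    show "Well_order r'"
      by (rule wo)
    show "is_functor (order_cat r') C D'"
      by (rule D'_functor)
  qed
qed

end

section \<open>Concatenating sequences of length omega along a well-order\<close>

text \<open>
  If every step \<open>x \<rightarrow> e x\<close> of a transfinite sequence is itself the composite of a sequence of length
  \<open>\<omega>\<close>, then all these sequences, put one after the other, form a transfinite sequence indexed by
  \<open>r \<times> \<omega>\<close> with the lexicographic order. Here \<open>e x\<close> is the successor of \<open>x\<close>, except that \<open>e x = x\<close> for a
  maximal \<open>x\<close>, where the sequence is stationary.
\<close>

locale lexicographic_refinement = category C for C :: "('o, 'm) cat" (structure) +
  fixes r :: "'a rel" and D :: "('a, unit, 'o, 'm) fctr" and e :: "'a \<Rightarrow> 'a"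
    and Xs :: "'a \<Rightarrow> nat \<Rightarrow> 'o" and fs :: "'a \<Rightarrow> nat \<Rightarrow> 'm" and lg :: "'a \<Rightarrow> nat \<Rightarrow> 'm"
  assumes r: "Well_order r" and D: "is_functor (order_cat r) C D"
    and e_le: "x \<in> Field r \<Longrightarrow> (x, e x) \<in> r"
    and e_least: "(x, y) \<in> r \<Longrightarrow> x \<noteq> y \<Longrightarrow> (e x, y) \<in> r"
    and e_ne: "(x, y) \<in> r \<Longrightarrow> x \<noteq> y \<Longrightarrow> e x \<noteq> x"
    and seq: "x \<in> Field r \<Longrightarrow> seq (Xs x) (fs x)"
    and Xs_0: "x \<in> Field r \<Longrightarrow> Xs x 0 = Fo D x"
    and colim: "x \<in> Field r \<Longrightarrow>
      is_colimit (order_cat natLeq) C (seq_diagram (Xs x) (fs x)) (Fo D (e x)) (lg x)"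
    and lg_0: "x \<in> Field r \<Longrightarrow> lg x 0 = Fm D x (e x) ()"
    and stationary: "x \<in> Field r \<Longrightarrow> e x = x \<Longrightarrow>
      Xs x n = Fo D x \<and> chain (Xs x) (fs x) 0 n = Id C (Fo D x) \<and> lg x n = Id C (Fo D x)"
begin

lemma refl_r: "x \<in> Field r \<Longrightarrow> (x, x) \<in> r"
  using r by (simp add: order_on_defs refl_on_def)

lemma trans_r: "(x, y) \<in> r \<Longrightarrow> (y, z) \<in> r \<Longrightarrow> (x, z) \<in> r"
  using r unfolding order_on_defs by (meson transD)

lemma antisym_r: "(x, y) \<in> r \<Longrightarrow> (y, x) \<in> r \<Longrightarrow> x = y"
  using r unfolding order_on_defs by (meson antisymD)

lemma total_r: "x \<in> Field r \<Longrightarrow> y \<in> Field r \<Longrightarrow> (x, y) \<in> r \<or> (y, x) \<in> r"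
  using r refl_r unfolding order_on_defs total_on_def by metis

lemma Field_r: "(x, y) \<in> r \<Longrightarrow> x \<in> Field r" "(x, y) \<in> r \<Longrightarrow> y \<in> Field r"
  by (auto intro: FieldI1 FieldI2)

lemma is_successor_e: "x \<in> Field r \<Longrightarrow> e x \<noteq> x \<Longrightarrow> is_successor r x (e x)"
  unfolding is_successor_def using e_le e_least antisym_r by metis

lemma is_successor_eq: "is_successor r x y \<Longrightarrow> e x = y"
  unfolding is_successor_def using e_le e_least e_ne Field_r by metis

definition lex :: "('a \<times> nat) rel" where
  "lex = {((x, n), (y, m)). (x, y) \<in> r \<and> (x = y \<longrightarrow> n \<le> m)}"

lemma lex_iff: "((x, n), (y, m)) \<in> lex \<longleftrightarrow> (x, y) \<in> r \<and> (x = y \<longrightarrow> n \<le> m)"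
  by (simp add: lex_def)

lemma Field_lex: "Field lex = Field r \<times> UNIV"
proof (intro equalityI subsetI)
  fix p assume "p \<in> Field lex"
  then obtain q where "(p, q) \<in> lex \<or> (q, p) \<in> lex"
    by (auto simp: Field_def)
  then show "p \<in> Field r \<times> UNIV"
    by (cases p, cases q) (auto simp: lex_iff dest: Field_r)
next
  fix p assume "p \<in> Field r \<times> (UNIV :: nat set)"
  then have "(p, p) \<in> lex"
    using refl_r by (cases p) (simp add: lex_iff)
  then show "p \<in> Field lex"
    by (rule FieldI1)
qed

lemma Well_order_lex: "Well_order lex"
proof -
  have "refl_on (Field lex) lex"
    unfolding Field_lex using refl_r by (auto simp: refl_on_def lex_iff)
  moreover have "lex \<subseteq> Field lex \<times> Field lex"
    by (auto intro: FieldI1 FieldI2)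
  moreover have "trans lex"
  proof (rule transI)
    fix p q s assume "(p, q) \<in> lex" "(q, s) \<in> lex"
    then show "(p, s) \<in> lex"
      using trans_r antisym_r by (cases p, cases q, cases s) (auto simp: lex_iff)
  qed
  moreover have "antisym lex"
    unfolding antisym_def using antisym_r by (auto simp: lex_iff)
  moreover have "total_on (Field lex) lex"
    unfolding Field_lex total_on_def
  proof (intro ballI impI)
    fix p q assume pq: "p \<in> Field r \<times> (UNIV :: nat set)" "q \<in> Field r \<times> (UNIV :: nat set)" "p \<noteq> q"
    obtain x n y m where eq: "p = (x, n)" "q = (y, m)"
      by (cases p, cases q) blast
    have "(x, y) \<in> r \<or> (y, x) \<in> r"
      using pq eq total_r by blast
    then show "(p, q) \<in> lex \<or> (q, p) \<in> lex"
      using eq by (cases "x = y") (auto simp: lex_iff)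
  qed
  moreover have "wf (lex - Relation.Id)"
  proof (rule wf_subset)
    show "wf ((r - Relation.Id) <*lex*> less_than)"
      using r by (intro wf_lex_prod) (auto simp: order_on_defs)
    show "lex - Relation.Id \<subseteq> (r - Relation.Id) <*lex*> less_than"
      by (auto simp: lex_def)
  qed
  ultimately show ?thesis
    by (simp add: order_on_defs)
qed

text \<open>The element \<open>(x, Suc n)\<close> comes directly after \<open>(x, n)\<close>, so a
  successor never leaves its block. Every successor step of the concatenation is thus one of the
  given steps \<open>fs x n\<close>.\<close>

lemma is_successor_lex:
  assumes "is_successor lex (x, n) (y, m)"
  shows "y = x \<and> m = Suc n"
proof -
  have between: "p = (x, n) \<or> p = (y, m)" if "((x, n), p) \<in> lex" "(p, (y, m)) \<in> lex" for p
    using assms that unfolding is_successor_def by blast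
  have *: "(x, y) \<in> r" "x = y \<longrightarrow> n \<le> m" "(x, n) \<noteq> (y, m)"
    using assms by (simp_all add: is_successor_def lex_iff)
  have "((x, n), (x, Suc n)) \<in> lex"
    using refl_r[OF Field_r(1)[OF *(1)]] by (simp add: lex_iff)
  moreover have "((x, Suc n), (y, m)) \<in> lex"
    using * by (auto simp: lex_iff)
  ultimately show ?thesis
    using between[of "(x, Suc n)"] by auto
qed

text \<open>The way from stage \<open>n\<close> of block \<open>x\<close> to the start of a strictly
  later block \<open>y\<close>: run to the end of the block, which is the value of \<open>D\<close>
  at \<open>e x\<close>, and continue inside \<open>D\<close>.\<close>

definition jump :: "'a \<Rightarrow> nat \<Rightarrow> 'a \<Rightarrow> 'm" where
  "jump x n y = Fm D (e x) y () \<cdot> lg x n"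

lemma D_arr: "(x, y) \<in> r \<Longrightarrow> arr (Fm D x y ()) (Fo D x) (Fo D y)"
  using D Field_r[of x y] by (simp add: is_functor_order_iff arr_def)

lemma D_comp: "(x, y) \<in> r \<Longrightarrow> (y, z) \<in> r \<Longrightarrow> Fm D y z () \<cdot> Fm D x y () = Fm D x z ()"
  using D by (simp add: is_functor_order_iff)

lemma D_Id: "x \<in> Field r \<Longrightarrow> Fm D x x () = Id C (Fo D x)"
  using D by (simp add: is_functor_order_iff)

lemma lg_cocone:
  "x \<in> Field r \<Longrightarrow> is_cocone (order_cat natLeq) C (seq_diagram (Xs x) (fs x)) (Fo D (e x)) (lg x)"
  using colim by (simp add: is_colimit_def)

lemma lg_arr: "x \<in> Field r \<Longrightarrow> arr (lg x n) (Xs x n) (Fo D (e x))"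
  using lg_cocone[of x] is_cocone_seq_iff[OF seq, of x] by blast

lemma chain_0_arr: "y \<in> Field r \<Longrightarrow> arr (chain (Xs y) (fs y) 0 m) (Fo D y) (Xs y m)"
  using chain_arr[OF _ seq, of 0 m y] Xs_0 by simp

lemma jump_arr: "(x, y) \<in> r \<Longrightarrow> x \<noteq> y \<Longrightarrow> arr (jump x n y) (Xs x n) (Fo D y)"
  unfolding jump_def using arr_comp[OF lg_arr D_arr[OF e_least]] Field_r by blast

lemma jump_chain:
  assumes "(x, y) \<in> r" and "x \<noteq> y" and "n \<le> k"
  shows "jump x k y \<cdot> chain (Xs x) (fs x) n k = jump x n y"
  unfolding jump_def
  using assoc[OF chain_arr[OF assms(3) seq] lg_arr D_arr[OF e_least[OF assms(1,2)]]]
    seq_cocone_chain[OF lg_cocone assms(3)] Field_r[OF assms(1)] by simp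

lemma jump_0: "(x, y) \<in> r \<Longrightarrow> x \<noteq> y \<Longrightarrow> jump x 0 y = Fm D x y ()"
  unfolding jump_def using lg_0 D_comp[OF e_le e_least] Field_r by simp

lemma D_jump:
  assumes "(x, y) \<in> r" and "x \<noteq> y" and "(y, z) \<in> r"
  shows "Fm D y z () \<cdot> jump x n y = jump x n z"
  unfolding jump_def
  using assoc[OF lg_arr D_arr[OF e_least[OF assms(1,2)]] D_arr[OF assms(3)]]
    D_comp[OF e_least[OF assms(1,2)] assms(3)] Field_r[OF assms(1)] by simp

lemma jump_e: "x \<in> Field r \<Longrightarrow> jump x n (e x) = lg x n"
  unfolding jump_def using D_Id[of "e x"] Id_comp[OF lg_arr] Field_r(2)[OF e_le] by simp

text \<open>Blocks are glued where the colimit of block \<open>x\<close> meets the initial stage of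
  block \<open>e x\<close>; both are \<open>Fo D (e x)\<close>. A morphism between different blocks
  therefore enters the later one through its initial stage.\<close>

definition E :: "('a \<times> nat, unit, 'o, 'm) fctr" where
  "E = \<lparr>Fo = (\<lambda>(x, n). Xs x n),
        Fm = (\<lambda>(x, n) (y, m) _. if x = y then chain (Xs x) (fs x) n m
               else chain (Xs y) (fs y) 0 m \<cdot> jump x n y)\<rparr>"

lemma Fo_E [simp]: "Fo E (x, n) = Xs x n"
  by (simp add: E_def)

lemma Fm_E_same: "Fm E (x, n) (x, m) u = chain (Xs x) (fs x) n m"
  by (simp add: E_def)

lemma Fm_E_jump: "x \<noteq> y \<Longrightarrow> Fm E (x, n) (y, m) u = chain (Xs y) (fs y) 0 m \<cdot> jump x n y"
  by (simp add: E_def)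

lemma Fm_E_0: "(x, y) \<in> r \<Longrightarrow> x \<noteq> y \<Longrightarrow> Fm E (x, n) (y, 0) u = jump x n y"
  using Id_comp[OF jump_arr] Xs_0[of y] Field_r[of x y] by (simp add: Fm_E_jump)

lemma E_arr:
  assumes "((x, n), (y, m)) \<in> lex"
  shows "arr (Fm E (x, n) (y, m) ()) (Xs x n) (Xs y m)"
proof (cases "x = y")
  case True
  then show ?thesis
    using assms chain_arr[OF _ seq[of x]] Field_r[of x y] by (simp add: lex_iff Fm_E_same)
next
  case False
  then show ?thesis
    using assms arr_comp[OF jump_arr[of x y] chain_0_arr[of y]] Field_r[of x y]
    by (simp add: lex_iff Fm_E_jump)
qed

lemma E_comp:
  assumes "((x, n), (y, m)) \<in> lex" and "((y, m), (z, k)) \<in> lex"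
  shows "Fm E (y, m) (z, k) () \<cdot> Fm E (x, n) (y, m) () = Fm E (x, n) (z, k) ()"
proof -
  have xy: "(x, y) \<in> r" "x = y \<Longrightarrow> n \<le> m" and yz: "(y, z) \<in> r" "y = z \<Longrightarrow> m \<le> k"
    using assms by (auto simp: lex_iff)
  have F: "x \<in> Field r" "y \<in> Field r" "z \<in> Field r"
    using Field_r xy(1) yz(1) by blast+
  consider "x = y" "y = z" | "x = y" "y \<noteq> z" | "x \<noteq> y" "y = z" | "x \<noteq> y" "y \<noteq> z"
    by blast
  then show ?thesis
  proof cases
    case 1
    then show ?thesis
      using chain_trans[OF seq[OF F(1)] xy(2) yz(2)] by (simp add: Fm_E_same)
  next
    case 2
    have "chain (Xs z) (fs z) 0 k \<cdot> jump y m z \<cdot> chain (Xs y) (fs y) n m =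
        chain (Xs z) (fs z) 0 k \<cdot> (jump y m z \<cdot> chain (Xs y) (fs y) n m)"
      by (rule assoc[OF chain_arr[OF xy(2)[OF 2(1)] seq[OF F(2)]] jump_arr[OF yz(1) 2(2)] chain_0_arr[OF F(3)]])
    then show ?thesis
      using 2 jump_chain[OF yz(1) 2(2) xy(2)[OF 2(1)]] by (simp add: Fm_E_same Fm_E_jump)
  next
    case 3
    have "chain (Xs y) (fs y) m k \<cdot> chain (Xs y) (fs y) 0 m \<cdot> jump x n y =
        chain (Xs y) (fs y) m k \<cdot> (chain (Xs y) (fs y) 0 m \<cdot> jump x n y)"
      by (rule assoc[OF jump_arr[OF xy(1) 3(1)] chain_0_arr[OF F(2)] chain_arr[OF yz(2)[OF 3(2)] seq[OF F(2)]]])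
    then show ?thesis
      using 3 chain_trans[OF seq[OF F(2)] le0 yz(2)[OF 3(2)]] by (simp add: Fm_E_same Fm_E_jump)
  next
    case 4
    let ?cy = "chain (Xs y) (fs y) 0 m" and ?cz = "chain (Xs z) (fs z) 0 k"
    have xz: "x \<noteq> z" "(x, z) \<in> r"
      using 4 xy yz antisym_r trans_r by blast+
    note a = jump_arr[OF xy(1) 4(1), of n] chain_0_arr[OF F(2), of m] jump_arr[OF yz(1) 4(2), of m]
      chain_0_arr[OF F(3), of k]
    have "?cz \<cdot> jump y m z \<cdot> (?cy \<cdot> jump x n y) = ?cz \<cdot> (jump y m z \<cdot> (?cy \<cdot> jump x n y))"
      by (rule assoc[OF arr_comp[OF a(1,2)] a(3,4)])
    also have "jump y m z \<cdot> (?cy \<cdot> jump x n y) = jump y m z \<cdot> ?cy \<cdot> jump x n y"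
      by (rule assoc[OF a(1,2,3), symmetric])
    \<comment> \<open>Crossing block \<open>y\<close> from its start to its end and going on to
      \<open>z\<close> is just the transition of \<open>D\<close>, so the intermediate block drops
      out.\<close>
    also have "jump y m z \<cdot> ?cy = Fm D y z ()"
      using jump_chain[OF yz(1) 4(2) le0] jump_0[OF yz(1) 4(2)] by simp
    also have "Fm D y z () \<cdot> jump x n y = jump x n z"
      by (rule D_jump[OF xy(1) 4(1) yz(1)])
    finally show ?thesis
      using 4 xz by (simp add: Fm_E_jump)
  qed
qed

lemma is_functor_E: "is_functor (order_cat lex) C E"
  unfolding is_functor_order_iff
proof (intro conjI ballI allI impI)
  show "Fo E p \<in> Ob C" if "p \<in> Field lex" for p
    using that seq_Ob[OF seq] by (auto simp: Field_lex)
  show "Fm E p q () \<in> Hom C (Fo E p) (Fo E q)" if "(p, q) \<in> lex" for p q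
    using that E_arr by (cases p, cases q) (simp add: arr_def)
  show "Fm E p p () = Id C (Fo E p)" for p
    by (cases p) (simp add: Fm_E_same)
  show "Fm E p s () = Fm E q s () \<cdot> Fm E p q ()" if "(p, q) \<in> lex" "(q, s) \<in> lex" for p q s
    using that E_comp by (cases p, cases q, cases s) simp
qed

lemma Field_Restr:
  assumes "refl_on (Field s) s" and "U \<subseteq> Field s"
  shows "Field (Restr s U) = U"
proof (intro equalityI subsetI)
  fix x assume "x \<in> U"
  then have "(x, x) \<in> Restr s U"
    using assms by (auto simp: refl_on_def)
  then show "x \<in> Field (Restr s U)"
    by (rule FieldI1)
qed (auto simp: Field_def)

lemma refl_on_r: "refl_on (Field r) r"
  using r by (simp add: order_on_defs)

lemma refl_on_lex: "refl_on (Field lex) lex"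
  using Well_order_lex by (simp add: order_on_defs)

lemma Field_Restr_r: "U \<subseteq> Field r \<Longrightarrow> Field (Restr r U) = U"
  using Field_Restr refl_on_r by blast

lemma Field_Restr_lex: "U \<subseteq> Field r \<Longrightarrow> Field (Restr lex (U \<times> UNIV)) = U \<times> UNIV"
  by (rule Field_Restr[OF refl_on_lex]) (auto simp: Field_lex)

lemma is_functor_Restr:
  assumes "is_functor (order_cat s) C G" and "U \<subseteq> Field s" and "refl_on (Field s) s"
  shows "is_functor (order_cat (Restr s U)) C G"
proof -
  have "Field (Restr s U) \<subseteq> Field s"
    by (auto simp: Field_def)
  then show ?thesis
    using assms(1) unfolding is_functor_order_iff by blast
qed

text \<open>If \<open>U\<close> is closed under \<open>e\<close>, the initial stages
  \<open>(x, 0)\<close> form a copy of \<open>D\<close> through which every cone is determined: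
  stage \<open>(x, n)\<close> maps to \<open>(e x, 0)\<close>. This serves both the segments below
  limits of \<open>r\<close> and the whole order.\<close>

lemma is_colimit_lex:
  assumes U: "U \<subseteq> Field r" and eU: "\<And>x. x \<in> U \<Longrightarrow> e x \<in> U"
    and L: "is_colimit (order_cat (Restr r U)) C D L \<iota>"
  shows "is_colimit (order_cat (Restr lex (U \<times> UNIV))) C E L (\<lambda>(x, n). \<iota> (e x) \<cdot> lg x n)"
proof (rule is_colimitI)
  have \<iota>: "arr (\<iota> x) (Fo D x) L" if "x \<in> U" for x
    using is_cocone_arr[OF is_functor_Restr[OF D U refl_on_r], of L \<iota> x] L that U
    by (simp add: is_colimit_def Field_Restr_r)
  have \<iota>_comp: "\<iota> y \<cdot> Fm D x y () = \<iota> x" if "x \<in> U" "y \<in> U" "(x, y) \<in> r" for x y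
    using L that by (simp add: is_colimit_order_iff is_cocone_order_iff)
  have F: "x \<in> Field r" if "x \<in> U" for x
    using U that by blast
  have leg: "arr (\<iota> (e x) \<cdot> lg x n) (Xs x n) L" if "x \<in> U" for x n
    using arr_comp[OF lg_arr[OF F[OF that]] \<iota>[OF eU[OF that]]] .
  have leg_0: "\<iota> (e x) \<cdot> lg x 0 = \<iota> x" if "x \<in> U" for x
    using \<iota>_comp[OF that eU[OF that] e_le[OF F[OF that]]] lg_0[OF F[OF that]] by simp
  show "is_cocone (order_cat (Restr lex (U \<times> UNIV))) C E L (\<lambda>(x, n). \<iota> (e x) \<cdot> lg x n)"
    unfolding is_cocone_order_iff Field_Restr_lex[OF U]
  proof (intro conjI ballI allI impI)
    show "L \<in> Ob C"
      using L by (simp add: is_colimit_def is_cocone_def)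
    show "(case p of (x, n) \<Rightarrow> \<iota> (e x) \<cdot> lg x n) \<in> Hom C (Fo E p) L" if "p \<in> U \<times> UNIV" for p
      using that leg by (auto intro: arrD)
    fix p q assume "(p, q) \<in> Restr lex (U \<times> UNIV)"
    then obtain x n y m where pq: "p = (x, n)" "q = (y, m)" "x \<in> U" "y \<in> U" "(x, y) \<in> r"
        "x = y \<Longrightarrow> n \<le> m"
      by (auto simp: lex_def)
    show "(case q of (x, n) \<Rightarrow> \<iota> (e x) \<cdot> lg x n) \<cdot> Fm E p q () =
        (case p of (x, n) \<Rightarrow> \<iota> (e x) \<cdot> lg x n)"
    proof (cases "x = y")
      case True
      have "\<iota> (e x) \<cdot> lg x m \<cdot> chain (Xs x) (fs x) n m = \<iota> (e x) \<cdot> (lg x m \<cdot> chain (Xs x) (fs x) n m)"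
        using assoc[OF chain_arr[OF pq(6)[OF True] seq] lg_arr \<iota>[OF eU]] pq(3) F by blast
      then show ?thesis
        using True pq seq_cocone_chain[OF lg_cocone pq(6)[OF True]] F by (simp add: Fm_E_same)
    next
      case False
      let ?c = "chain (Xs y) (fs y) 0 m"
      note a = jump_arr[OF pq(5) False, of n] chain_0_arr[OF F[OF pq(4)], of m]
        lg_arr[OF F[OF pq(4)], of m] \<iota>[OF eU[OF pq(4)]]
      have "\<iota> (e y) \<cdot> lg y m \<cdot> (?c \<cdot> jump x n y) = \<iota> (e y) \<cdot> lg y m \<cdot> ?c \<cdot> jump x n y"
        by (rule assoc[OF a(1,2) arr_comp[OF a(3,4)], symmetric])
      also have "\<iota> (e y) \<cdot> lg y m \<cdot> ?c = \<iota> (e y) \<cdot> (lg y m \<cdot> ?c)"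
        by (rule assoc[OF a(2,3,4)])
      also have "\<dots> = \<iota> y"
        using seq_cocone_chain[OF lg_cocone[OF F[OF pq(4)]] le0] leg_0[OF pq(4)] by simp
      also have "\<iota> y \<cdot> jump x n y = \<iota> (e x) \<cdot> lg x n"
        using assoc[OF lg_arr[OF F[OF pq(3)]] D_arr[OF e_least[OF pq(5) False]] \<iota>[OF pq(4)], of n]
          \<iota>_comp[OF eU[OF pq(3)] pq(4) e_least[OF pq(5) False]] by (simp add: jump_def)
      finally show ?thesis
        using pq False by (simp add: Fm_E_jump)
    qed
  qed
  fix T
  show "\<exists>h. arr h L T \<and> (\<forall>p\<in>Ob (order_cat (Restr lex (U \<times> UNIV))).
      h \<cdot> (case p of (x, n) \<Rightarrow> \<iota> (e x) \<cdot> lg x n) = \<tau> p)"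
    if T: "is_cocone (order_cat (Restr lex (U \<times> UNIV))) C E T \<tau>" for \<tau>
  proof -
    have \<tau>: "arr (\<tau> (x, n)) (Xs x n) T" if "x \<in> U" for x n
      using T that seq_Ob[OF seq[OF F[OF that]]]
      by (auto simp: is_cocone_order_iff Field_Restr_lex[OF U] arr_def)
    have \<tau>_comp: "\<tau> (y, m) \<cdot> Fm E (x, n) (y, m) () = \<tau> (x, n)"
      if "x \<in> U" "y \<in> U" "((x, n), (y, m)) \<in> lex" for x y n m
      using T that unfolding is_cocone_order_iff by blast
    have "is_cocone (order_cat (Restr r U)) C D T (\<lambda>x. \<tau> (x, 0))"
      unfolding is_cocone_order_iff Field_Restr_r[OF U]
    proof (intro conjI ballI allI impI)
      show "T \<in> Ob C"
        using T by (simp add: is_cocone_def)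
      show "\<tau> (x, 0) \<in> Hom C (Fo D x) T" if "x \<in> U" for x
        using \<tau>[OF that, of 0] Xs_0[OF F[OF that]] by (simp add: arr_def)
      fix x y assume xy: "(x, y) \<in> Restr r U"
      show "\<tau> (y, 0) \<cdot> Fm D x y () = \<tau> (x, 0)"
      proof (cases "x = y")
        case True
        then show ?thesis
          using xy comp_Id[OF \<tau>[of x 0]] D_Id F Xs_0 by simp
      next
        case False
        then show ?thesis
          using xy \<tau>_comp[of x y 0 0] Fm_E_0[of x y 0] jump_0[of x y] by (simp add: lex_iff)
      qed
    qed
    then obtain h where h: "arr h L T" "\<And>x. x \<in> U \<Longrightarrow> h \<cdot> \<iota> x = \<tau> (x, 0)"
      using is_colimit_factor[OF L] Field_Restr_r[OF U] by (metis Ob_order_cat)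
    have "h \<cdot> (\<iota> (e x) \<cdot> lg x n) = \<tau> (x, n)" if x: "x \<in> U" for x n
    proof -
      have eq: "h \<cdot> (\<iota> (e x) \<cdot> lg x n) = \<tau> (e x, 0) \<cdot> lg x n"
        using assoc[OF lg_arr[OF F[OF x]] \<iota>[OF eU[OF x]] h(1), of n] h(2)[OF eU[OF x]] by simp
      show ?thesis
      proof (cases "e x = x")
        case True
        \<comment> \<open>Here \<open>(x, 0)\<close> does not lie above \<open>(x, n)\<close> for
          positive \<open>n\<close>, and the cofinality argument fails; instead the block is
          constant.\<close>
        note c = stationary[OF F[OF x] True, of n]
        have "\<tau> (x, n) \<cdot> chain (Xs x) (fs x) 0 n = \<tau> (x, 0)"
          using \<tau>_comp[of x x 0 n] x refl_r[OF F[OF x]] by (simp add: lex_iff Fm_E_same)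
        then have "\<tau> (x, n) = \<tau> (x, 0)"
          using c comp_Id[OF \<tau>[OF x, of n]] by simp
        moreover have "\<tau> (x, 0) \<cdot> lg x n = \<tau> (x, 0)"
          using c comp_Id[OF \<tau>[OF x, of 0]] Xs_0[OF F[OF x]] by simp
        ultimately show ?thesis
          using eq True by simp
      next
        case False
        have "\<tau> (e x, 0) \<cdot> Fm E (x, n) (e x, 0) () = \<tau> (x, n)"
          using \<tau>_comp[OF x eU[OF x]] e_le[OF F[OF x]] False by (simp add: lex_iff)
        then show ?thesis
          using eq False Fm_E_0[OF e_le[OF F[OF x]]] jump_e[OF F[OF x]] by simp
      qed
    qed
    then show ?thesis
      using h(1) by (intro exI[of _ h]) (auto simp: Field_Restr_lex[OF U])
  qed
  fix h k assume hk: "arr h L T" "arr k L T"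
    and eq: "\<And>p. p \<in> Ob (order_cat (Restr lex (U \<times> UNIV))) \<Longrightarrow>
      h \<cdot> (case p of (x, n) \<Rightarrow> \<iota> (e x) \<cdot> lg x n) = k \<cdot> (case p of (x, n) \<Rightarrow> \<iota> (e x) \<cdot> lg x n)"
  show "h = k"
  proof (rule is_colimit_ext[OF is_functor_Restr[OF D U refl_on_r] L hk])
    show "h \<cdot> \<iota> x = k \<cdot> \<iota> x" if "x \<in> Ob (order_cat (Restr r U))" for x
      using eq[of "(x, 0)"] that leg_0[of x] by (simp add: Field_Restr_lex[OF U] Field_Restr_r[OF U])
  qed
qed

text \<open>A successor \<open>e x\<close> in \<open>r\<close> becomes a limit
  \<open>(e x, 0)\<close> in \<open>lex\<close>, because infinitely many stages of block
  \<open>x\<close> precede it. Those stages are cofinal below it, and their colimit is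
  \<open>Fo D (e x)\<close> by assumption.\<close>

lemma is_colimit_lex_successor:
  assumes x: "x \<in> Field r" and ex: "e x \<noteq> x"
  shows "is_colimit (order_cat (Restr lex (underS r (e x) \<times> UNIV))) C E (Fo D (e x))
    (\<lambda>p. Fm E p (e x, 0) ())"
proof (rule is_colimitI)
  let ?y = "e x"
  let ?U = "underS r ?y"
  have U: "?U \<subseteq> Field r"
    using Field_r by (auto simp: underS_def)
  have y: "?y \<in> Field r"
    using Field_r(2)[OF e_le[OF x]] .
  have xU: "x \<in> ?U"
    using e_le[OF x] ex by (simp add: underS_def)
  \<comment> \<open>No element lies strictly between \<open>x\<close> and \<open>e x\<close>, so
    \<open>x\<close> is the greatest index below and its block is the last one.\<close>
  have Ux: "(z, x) \<in> r" if "z \<in> ?U" for z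
  proof (rule ccontr)
    assume "(z, x) \<notin> r"
    moreover have "z \<in> Field r"
      using that U by blast
    ultimately have "(x, z) \<in> r" "x \<noteq> z"
      using total_r[OF x, of z] by auto
    then have "(e x, z) \<in> r"
      by (rule e_least)
    then show False
      using that antisym_r by (auto simp: underS_def)
  qed
  have Fm: "Fm E (z, n) (?y, 0) () = jump z n ?y" if "z \<in> ?U" for z n
    using Fm_E_0 that by (simp add: underS_def)
  show "is_cocone (order_cat (Restr lex (?U \<times> UNIV))) C E (Fo D ?y) (\<lambda>p. Fm E p (?y, 0) ())"
    unfolding is_cocone_order_iff Field_Restr_lex[OF U]
  proof (intro conjI ballI allI impI)
    show "Fo D ?y \<in> Ob C"
      using seq_Ob[OF seq[OF y], of 0] Xs_0[OF y] by simp
    have lex: "(p, (?y, 0)) \<in> lex" if "p \<in> ?U \<times> UNIV" for p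
      using that by (auto simp: underS_def lex_iff)
    show "Fm E p (?y, 0) () \<in> Hom C (Fo E p) (Fo D ?y)" if "p \<in> ?U \<times> UNIV" for p
      using lex[OF that] E_arr[of "fst p" "snd p" ?y 0] Xs_0[OF y]
      by (cases p) (simp add: arr_def)
    show "Fm E q (?y, 0) () \<cdot> Fm E p q () = Fm E p (?y, 0) ()"
      if "(p, q) \<in> Restr lex (?U \<times> UNIV)" for p q
      using E_comp[of "fst p" "snd p" "fst q" "snd q" ?y 0] that lex[of q] by auto
  qed
  fix T
  show "\<exists>h. arr h (Fo D ?y) T \<and> (\<forall>p\<in>Ob (order_cat (Restr lex (?U \<times> UNIV))).
      h \<cdot> Fm E p (?y, 0) () = \<tau> p)"
    if T: "is_cocone (order_cat (Restr lex (?U \<times> UNIV))) C E T \<tau>" for \<tau>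
  proof -
    have \<tau>: "arr (\<tau> (z, n)) (Xs z n) T" if "z \<in> ?U" for z n
      using T that seq_Ob[OF seq, of z n] U
      by (auto simp: is_cocone_order_iff Field_Restr_lex[OF U] arr_def)
    have \<tau>_comp: "\<tau> (w, m) \<cdot> Fm E (z, n) (w, m) () = \<tau> (z, n)"
      if "z \<in> ?U" "w \<in> ?U" "((z, n), (w, m)) \<in> lex" for z w n m
      using T that unfolding is_cocone_order_iff by blast
    have "is_cocone (order_cat natLeq) C (seq_diagram (Xs x) (fs x)) T (\<lambda>n. \<tau> (x, n))"
      unfolding is_cocone_seq_iff[OF seq[OF x]]
    proof (intro conjI allI)
      show "arr (\<tau> (x, n)) (Xs x n) T" for n
        using \<tau>[OF xU] .
      show "\<tau> (x, Suc n) \<cdot> fs x n = \<tau> (x, n)" for n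
        using \<tau>_comp[OF xU xU, of n "Suc n"] refl_r[OF x] chain_step[OF seq[OF x], of n]
        by (simp add: lex_iff Fm_E_same del: chain.simps)
    qed
    then obtain h where h: "arr h (Fo D ?y) T" "\<And>n. h \<cdot> lg x n = \<tau> (x, n)"
      using is_colimit_factor[OF colim[OF x]] by (metis Ob_order_cat Field_natLeq UNIV_I)
    have "h \<cdot> Fm E (z, n) (?y, 0) () = \<tau> (z, n)" if z: "z \<in> ?U" for z n
    proof (cases "z = x")
      case True
      then show ?thesis
        using h(2) Fm[OF z] jump_e[OF x] by simp
    next
      case False
      note zx = Ux[OF z] False
      have "\<tau> (z, n) = \<tau> (x, 0) \<cdot> jump z n x"
        using \<tau>_comp[OF z xU, of n 0] zx Fm_E_0[OF zx] by (simp add: lex_iff)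
      also have "\<dots> = h \<cdot> Fm D x ?y () \<cdot> jump z n x"
        using h(2)[of 0] lg_0[OF x] by simp
      also have "\<dots> = h \<cdot> (Fm D x ?y () \<cdot> jump z n x)"
        by (rule assoc[OF jump_arr[OF zx] D_arr[OF e_le[OF x]] h(1)])
      also have "Fm D x ?y () \<cdot> jump z n x = jump z n ?y"
        by (rule D_jump[OF zx e_le[OF x]])
      finally show ?thesis
        using Fm[OF z] by simp
    qed
    then show ?thesis
      using h(1) by (intro exI[of _ h]) (auto simp: Field_Restr_lex[OF U])
  qed
  fix h k assume hk: "arr h (Fo D ?y) T" "arr k (Fo D ?y) T"
    and eq: "\<And>p. p \<in> Ob (order_cat (Restr lex (?U \<times> UNIV))) \<Longrightarrow>
      h \<cdot> Fm E p (?y, 0) () = k \<cdot> Fm E p (?y, 0) ()"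
  show "h = k"
  proof (rule is_colimit_ext[OF is_functor_seq_diagram[OF seq[OF x]] colim[OF x] hk])
    show "h \<cdot> lg x n = k \<cdot> lg x n" for n
      using eq[of "(x, n)"] xU Fm[OF xU] jump_e[OF x] by (simp add: Field_Restr_lex[OF U])
  qed
qed

lemma is_limit_lex:
  assumes "is_limit lex q"
  obtains y where "q = (y, 0)" and "y \<in> Field r" and "\<not> is_bottom r y"
proof -
  obtain y m where q: "q = (y, m)" "y \<in> Field r"
    using assms by (auto simp: is_limit_def Field_lex)
  have "m = 0"
  proof (rule ccontr)
    assume "m \<noteq> 0"
    then obtain k where m: "m = Suc k"
      by (cases m) auto
    have "is_successor lex (y, k) (y, m)"
      unfolding is_successor_def m
      using refl_r[OF q(2)] antisym_r by (auto simp: lex_iff)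
    then show False
      using assms q by (auto simp: is_limit_def)
  qed
  moreover have "\<not> is_bottom r y"
  proof
    assume "is_bottom r y"
    then have "is_bottom lex (y, 0)"
      using q by (auto simp: is_bottom_def Field_lex lex_iff)
    then show False
      using assms q \<open>m = 0\<close> by (simp add: is_limit_def)
  qed
  ultimately show thesis
    using that q by blast
qed

text \<open>A limit of \<open>lex\<close> is the start of a block other than the first. Its index is
  either a successor in \<open>r\<close>, where the preceding block converges to it, or a limit in
  \<open>r\<close>, where continuity of \<open>D\<close> is used.\<close>

lemma is_colimit_lex_limit:
  assumes lim: "\<And>y. is_limit r y \<Longrightarrow>
      is_colimit (order_cat (Restr r (underS r y))) C D (Fo D y) (\<lambda>x. Fm D x y ())"
    and q: "is_limit lex q"
  shows "is_colimit (order_cat (Restr lex (underS lex q))) C E (Fo E q) (\<lambda>p. Fm E p q ())"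
proof -
  obtain y where y: "q = (y, 0)" "y \<in> Field r" "\<not> is_bottom r y"
    using is_limit_lex[OF q] by blast
  have under: "underS lex q = underS r y \<times> UNIV"
    using y refl_r by (auto simp: underS_def lex_iff)
  have Fo: "Fo E q = Fo D y"
    using y Xs_0 by simp
  show ?thesis
  proof (cases "\<exists>x. is_successor r x y")
    case True
    then obtain x where x: "is_successor r x y" ..
    then have "e x = y" "x \<in> Field r" "x \<noteq> y"
      using is_successor_eq Field_r by (auto simp: is_successor_def)
    then show ?thesis
      using is_colimit_lex_successor[of x] under y Fo by simp
  next
    case False
    then have "is_limit r y"
      using y by (simp add: is_limit_def)
    note L = lim[OF this]
    let ?U = "underS r y"
    have U: "?U \<subseteq> Field r"
      using Field_r by (auto simp: underS_def)
    \<comment> \<open>Otherwise \<open>y\<close> would be the successor of \<open>x\<close>, which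
      is excluded at a limit.\<close>
    have eU: "e x \<in> ?U" if "x \<in> ?U" for x
    proof -
      have xy: "(x, y) \<in> r" "x \<noteq> y"
        using that by (auto simp: underS_def)
      then have "e x \<noteq> y"
        using is_successor_e[of x] Field_r False by metis
      then show ?thesis
        using e_least[OF xy] by (simp add: underS_def)
    qed
    have "is_colimit (order_cat (Restr lex (?U \<times> UNIV))) C E (Fo D y)
        (\<lambda>(x, n). Fm D (e x) y () \<cdot> lg x n)"
      by (rule is_colimit_lex[OF U eU L])
    moreover have "(\<lambda>(x, n). Fm D (e x) y () \<cdot> lg x n) p = Fm E p q ()"
      if p_mem: "p \<in> Ob (order_cat (Restr lex (?U \<times> UNIV)))" for p
    proof -
      obtain x n where p: "p = (x, n)" "(x, y) \<in> r" "x \<noteq> y"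
        using p_mem unfolding Ob_order_cat Field_Restr_lex[OF U] by (auto simp: underS_def)
      then show ?thesis
        using Fm_E_0[OF p(2,3)] y by (simp add: jump_def)
    qed
    ultimately show ?thesis
      unfolding under Fo
      using is_colimit_cong[of "order_cat (Restr lex (?U \<times> UNIV))"
          "\<lambda>(x, n). Fm D (e x) y () \<cdot> lg x n" "\<lambda>p. Fm E p q ()" C E "Fo D y"] by blast
  qed
qed

end

section \<open>Short composites and the refinement theorem\<close>

locale small_card_category = small_card \<kappa> + category C
  for \<kappa> :: "'k rel" and C :: "('o, 'm) cat" (structure)
begin

text \<open>The index order has two elements, as length one yields only isomorphisms. It has no
  limits, and its greatest element carries the colimit.\<close>

lemma transfinite_composite_single:
  assumes f: "arr f X Y" and S: "S X Y f"
  shows "transfinite_composite \<kappa> C S X Y f"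
proof -
  let ?r = "natLeq_on 2"
  define D :: "(nat, unit, 'o, 'm) fctr" where
    "D = \<lparr>Fo = (\<lambda>n. if n = 0 then X else Y),
      Fm = (\<lambda>m n _. if m = n then Id C (if n = 0 then X else Y) else f)\<rparr>"
  define \<iota> where "\<iota> n = (if n = 0 then f else Id C Y)" for n :: nat
  have XY: "X \<in> Ob C" "Y \<in> Ob C" "f \<in> Hom C X Y"
    using f by (simp_all add: arr_def)
  have two: "n = 0 \<or> n = Suc 0" if "n < 2" for n :: nat
    using that by auto
  have r: "(m, n) \<in> ?r \<longleftrightarrow> m = 0 \<and> n = 0 \<or> m = 0 \<and> n = Suc 0 \<or> m = Suc 0 \<and> n = Suc 0" for m n
    using two[of m] two[of n] by auto
  have Field: "Field ?r = {0, Suc 0}"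
    using two by (auto simp: Field_natLeq_on)
  have D: "is_functor (order_cat ?r) C D"
    unfolding is_functor_order_iff Field r using XY f
    by (auto simp: D_def Id_in Comp_Id Id_Comp)
  have coc: "is_cocone (order_cat ?r) C D Y \<iota>"
    unfolding is_cocone_order_iff Field r using XY
    by (auto simp: D_def \<iota>_def Id_in Comp_Id Id_Comp)
  have colim: "is_colimit (order_cat ?r) C D Y \<iota>"
  proof (rule is_colimitI[OF coc])
    show "\<exists>h. arr h Y T \<and> (\<forall>n\<in>Ob (order_cat ?r). h \<cdot> \<iota> n = \<tau> n)"
      if T: "is_cocone (order_cat ?r) C D T \<tau>" for T \<tau>
    proof (intro exI conjI ballI)
      have \<tau>: "T \<in> Ob C" "\<tau> (Suc 0) \<in> Hom C Y T" "\<tau> (Suc 0) \<cdot> f = \<tau> 0"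
        using T unfolding is_cocone_order_iff Field r by (auto simp: D_def)
      show "arr (\<tau> (Suc 0)) Y T"
        using \<tau> XY by (simp add: arr_def)
      show "\<tau> (Suc 0) \<cdot> \<iota> n = \<tau> n" if "n \<in> Ob (order_cat ?r)" for n
        using that \<tau> XY unfolding Ob_order_cat Field by (auto simp: \<iota>_def Comp_Id)
    qed
    show "h = k" if "arr h Y T" "arr k Y T" "\<And>n. n \<in> Ob (order_cat ?r) \<Longrightarrow> h \<cdot> \<iota> n = k \<cdot> \<iota> n" for T h k
      using that(3)[of "Suc 0"] comp_Id[OF that(1)] comp_Id[OF that(2)]
      unfolding Ob_order_cat Field by (simp add: \<iota>_def)
  qed
  have bot: "is_bottom ?r 0"
    unfolding is_bottom_def Field r by auto
  have succ: "is_successor ?r 0 (Suc 0)"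
    unfolding is_successor_def r by auto
  have "\<not> is_limit ?r y" for y
    using bot succ Field unfolding is_limit_def by auto
  moreover have "S (Fo D x) (Fo D y) (Fm D x y ())" if "is_successor ?r x y" for x y
    using that S unfolding is_successor_def r by (auto simp: D_def)
  moreover have "small \<kappa> (Field ?r)"
    unfolding Field by (rule small_finite) simp
  ultimately have "transfinite_composite \<kappa> C S (Fo D 0) Y (\<iota> 0)"
    by (intro transfinite_compositeI[OF natLeq_on_Well_order _ bot D _ _ colim]) auto
  then show ?thesis
    by (simp add: D_def \<iota>_def)
qed

text \<open>Fills the block of a maximal index, where there is no step to refine.\<close>

lemma stationary_sequence:
  assumes "Z \<in> Ob C"
  shows "seq (\<lambda>_. Z) (\<lambda>_. Id C Z)" and "chain (\<lambda>_. Z) (\<lambda>_. Id C Z) m n = Id C Z"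
    and "is_colimit (order_cat natLeq) C (seq_diagram (\<lambda>_. Z) (\<lambda>_. Id C Z)) Z (\<lambda>_. Id C Z)"
proof -
  show seq: "seq (\<lambda>_. Z) (\<lambda>_. Id C Z)"
    using assms by (auto simp: seq_def)
  note Z = Comp_Id[OF assms assms Id_in[OF assms]]
  show "chain (\<lambda>_. Z) (\<lambda>_. Id C Z) m n = Id C Z"
    by (induction n) (auto simp: Z)
  show "is_colimit (order_cat natLeq) C (seq_diagram (\<lambda>_. Z) (\<lambda>_. Id C Z)) Z (\<lambda>_. Id C Z)"
  proof (rule is_colimitI)
    show "is_cocone (order_cat natLeq) C (seq_diagram (\<lambda>_. Z) (\<lambda>_. Id C Z)) Z (\<lambda>_. Id C Z)"
      unfolding is_cocone_seq_iff[OF seq] using Z assms by auto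
    show "\<exists>h. arr h Z T \<and> (\<forall>n\<in>Ob (order_cat natLeq). h \<cdot> Id C Z = \<tau> n)"
      if "is_cocone (order_cat natLeq) C (seq_diagram (\<lambda>_. Z) (\<lambda>_. Id C Z)) T \<tau>" for T \<tau>
    proof -
      have \<tau>: "arr (\<tau> n) Z T" "\<tau> (Suc n) \<cdot> Id C Z = \<tau> n" for n
        using that by (auto simp: is_cocone_seq_iff[OF seq])
      have "\<tau> 0 = \<tau> n" for n
        using \<tau>(2) comp_Id[OF \<tau>(1)] by (induction n) metis+
      then have "\<tau> 0 \<cdot> Id C Z = \<tau> n" for n
        using comp_Id[OF \<tau>(1)[of 0]] by simp
      then show ?thesis
        using \<tau>(1)[of 0] by blast
    qed
    show "h = k" if "arr h Z T" "arr k Z T" "\<And>n. n \<in> Ob (order_cat natLeq) \<Longrightarrow> h \<cdot> Id C Z = k \<cdot> Id C Z"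
      for T h k
      using that(3)[of 0] comp_Id[OF that(1)] comp_Id[OF that(2)] by (simp add: Field_natLeq)
  qed
qed

text \<open>Each step is replaced by its omega-sequence and the results are concatenated. Identities
  must be admissible steps because a last index, having no step of its own, still receives a block
  of length omega.\<close>

lemma transfinite_composite_of_sequential:
  assumes "transfinite_composite \<kappa> C (sequential_composite S) X Y f"
    and S_Id: "\<And>Z. Z \<in> Ob C \<Longrightarrow> S Z Z (Id C Z)"
  shows "transfinite_composite \<kappa> C S X Y f"
proof -
  obtain r :: "'k rel" and D m \<iota> where r: "Well_order r" and small: "small \<kappa> (Field r)"
    and m: "is_bottom r m" and D: "is_functor (order_cat r) C D"
    and succ: "\<And>x y. is_successor r x y \<Longrightarrow> sequential_composite S (Fo D x) (Fo D y) (Fm D x y ())"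
    and lim: "\<And>y. is_limit r y \<Longrightarrow>
      is_colimit (order_cat (Restr r (underS r y))) C D (Fo D y) (\<lambda>x. Fm D x y ())"
    and colim: "is_colimit (order_cat r) C D Y \<iota>" and X: "X = Fo D m" and f: "f = \<iota> m"
    using assms(1) unfolding transfinite_composite_def by blast
  define e where "e x = (if \<exists>y. is_successor r x y then SOME y. is_successor r x y else x)" for x
  have e_succ: "is_successor r x (e x)" if "is_successor r x y" for x y
    using that someI[of "is_successor r x"] by (auto simp: e_def)
  have e_eq: "e x = x" if "\<nexists>y. is_successor r x y" for x
    using that by (simp add: e_def)
  have refl: "(x, x) \<in> r" if "x \<in> Field r" for x
    using r that by (simp add: order_on_defs refl_on_def)
  have total: "(x, y) \<in> r \<or> (y, x) \<in> r" if "x \<in> Field r" "y \<in> Field r" for x y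
    using r refl that unfolding order_on_defs total_on_def by metis
  have e_le: "(x, e x) \<in> r" if "x \<in> Field r" for x
    using e_succ[of x] e_eq[of x] refl[OF that] unfolding is_successor_def by metis
  \<comment> \<open>The least element strictly above \<open>x\<close> is its successor, so only
    maximal elements lack one.\<close>
  have succ_ex: "\<exists>z. is_successor r x z" if xy: "(x, y) \<in> r" "x \<noteq> y" for x y
  proof -
    have "wf (r - Relation.Id)"
      using r by (simp add: order_on_defs)
    then obtain z where z: "z \<in> {z. (x, z) \<in> r \<and> x \<noteq> z}"
        "\<And>w. (w, z) \<in> r - Relation.Id \<Longrightarrow> w \<notin> {z. (x, z) \<in> r \<and> x \<noteq> z}"
      using xy wfE_min[of "r - Relation.Id" y "{z. (x, z) \<in> r \<and> x \<noteq> z}"] by blast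
    then have "is_successor r x z"
      unfolding is_successor_def by blast
    then show ?thesis ..
  qed
  have e_ne: "e x \<noteq> x" if "(x, y) \<in> r" "x \<noteq> y" for x y
    using succ_ex[OF that] e_succ[of x] unfolding is_successor_def by metis
  have e_least: "(e x, y) \<in> r" if xy: "(x, y) \<in> r" "x \<noteq> y" for x y
  proof -
    have s: "is_successor r x (e x)"
      using succ_ex[OF xy] e_succ by blast
    have F: "y \<in> Field r" "e x \<in> Field r"
      using xy s by (auto simp: is_successor_def intro: FieldI2)
    show ?thesis
    proof (rule ccontr)
      assume *: "(e x, y) \<notin> r"
      then have "(y, e x) \<in> r"
        using total[OF F] by blast
      then have "y = x \<or> y = e x"
        using s xy unfolding is_successor_def by blast
      then show False
        using * xy refl[OF F(1)] by auto
    qed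
  qed
  define P where "P x Xs fs lg \<longleftrightarrow> Xs 0 = Fo D x \<and> seq Xs fs \<and>
      (\<forall>n. S (Xs n) (Xs (Suc n)) (fs n)) \<and>
      is_colimit (order_cat natLeq) C (seq_diagram Xs fs) (Fo D (e x)) lg \<and>
      lg 0 = Fm D x (e x) () \<and>
      (e x = x \<longrightarrow> (\<forall>n. Xs n = Fo D x \<and> chain Xs fs 0 n = Id C (Fo D x) \<and> lg n = Id C (Fo D x)))"
    for x Xs fs lg
  have "\<exists>p. P x (fst p) (fst (snd p)) (snd (snd p))" if x: "x \<in> Field r" for x
  proof (cases "\<exists>y. is_successor r x y")
    case True
    then have s: "is_successor r x (e x)"
      using e_succ by blast
    then have "e x \<noteq> x"
      by (auto simp: is_successor_def)
    moreover obtain Xs fs lg where "Xs 0 = Fo D x" "seq Xs fs"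
        "\<forall>n. S (Xs n) (Xs (Suc n)) (fs n)"
        "is_colimit (order_cat natLeq) C (seq_diagram Xs fs) (Fo D (e x)) lg"
        "Fm D x (e x) () = lg 0"
      using succ[OF s] unfolding sequential_composite_def by blast
    ultimately have "P x Xs fs lg"
      by (simp add: P_def)
    then show ?thesis
      by (intro exI[of _ "(Xs, fs, lg)"]) simp
  next
    case False
    then have ex: "e x = x"
      by (rule e_eq)
    have Z: "Fo D x \<in> Ob C" and "Fm D x x () = Id C (Fo D x)"
      using D x by (simp_all add: is_functor_order_iff)
    then have "P x (\<lambda>_. Fo D x) (\<lambda>_. Id C (Fo D x)) (\<lambda>_. Id C (Fo D x))"
      using stationary_sequence[OF Z] S_Id[OF Z] ex by (simp add: P_def)
    then show ?thesis
      by (intro exI[of _ "(\<lambda>_. Fo D x, \<lambda>_. Id C (Fo D x), \<lambda>_. Id C (Fo D x))"]) simp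
  qed
  then obtain p where p: "\<And>x. x \<in> Field r \<Longrightarrow> P x (fst (p x)) (fst (snd (p x))) (snd (snd (p x)))"
    by metis
  define Xs where "Xs x = fst (p x)" for x
  define fs where "fs x = fst (snd (p x))" for x
  define lg where "lg x = snd (snd (p x))" for x
  have data: "P x (Xs x) (fs x) (lg x)" if "x \<in> Field r" for x
    using p[OF that] by (simp add: Xs_def fs_def lg_def)
  interpret L: lexicographic_refinement C r D e Xs fs lg
  proof
    fix x assume x: "x \<in> Field r"
    note d = data[OF x, unfolded P_def]
    show "(x, e x) \<in> r"
      by (rule e_le[OF x])
    show "seq (Xs x) (fs x)" "Xs x 0 = Fo D x" "lg x 0 = Fm D x (e x) ()"
      "is_colimit (order_cat natLeq) C (seq_diagram (Xs x) (fs x)) (Fo D (e x)) (lg x)"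
      using d by simp_all
    show "Xs x n = Fo D x \<and> chain (Xs x) (fs x) 0 n = Id C (Fo D x) \<and> lg x n = Id C (Fo D x)"
      if "e x = x" for n
      using d that by simp
  next
    show "Well_order r"
      by (rule r)
    show "is_functor (order_cat r) C D"
      by (rule D)
    show "(e x, y) \<in> r" if "(x, y) \<in> r" "x \<noteq> y" for x y
      by (rule e_least[OF that])
    show "e x \<noteq> x" if "(x, y) \<in> r" "x \<noteq> y" for x y
      by (rule e_ne[OF that])
  qed
  have m': "m \<in> Field r"
    using m by (simp add: is_bottom_def)
  have colim': "is_colimit (order_cat L.lex) C L.E Y (\<lambda>(x, n). \<iota> (e x) \<cdot> lg x n)"
  proof -
    have e_Field: "e x \<in> Field r" if "x \<in> Field r" for x
      using e_le[OF that] by (rule FieldI2)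
    have "Restr r (Field r) = r"
      by (rule Restr_Field)
    moreover have "Restr L.lex (Field r \<times> UNIV) = L.lex"
      unfolding L.Field_lex[symmetric] by (rule Restr_Field)
    ultimately show ?thesis
      using L.is_colimit_lex[OF order_refl e_Field, of Y \<iota>] colim by simp
  qed
  have "small \<kappa> (Field L.lex)"
    unfolding L.Field_lex by (intro small_Sigma small small_nat)
  moreover have "is_bottom L.lex (m, 0)"
    using m by (auto simp: is_bottom_def L.Field_lex L.lex_iff)
  moreover have "S (Fo L.E p) (Fo L.E q) (Fm L.E p q ())" if s: "is_successor L.lex p q" for p q
  proof -
    obtain x n where pq: "p = (x, n)" "q = (x, Suc n)"
      using L.is_successor_lex[of "fst p" "snd p" "fst q" "snd q"] s
      by (metis prod.collapse)
    then have x: "x \<in> Field r"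
      using s by (auto simp: is_successor_def L.lex_iff intro: FieldI1)
    have "S (Xs x n) (Xs x (Suc n)) (fs x n)"
      using data[OF x] by (simp add: P_def)
    then show ?thesis
      using pq chain_step[OF L.seq[OF x], of n] by (simp add: L.Fm_E_same del: chain.simps)
  qed
  moreover have "is_colimit (order_cat (Restr L.lex (underS L.lex q))) C L.E (Fo L.E q) (\<lambda>p. Fm L.E p q ())"
    if "is_limit L.lex q" for q
    by (rule L.is_colimit_lex_limit[OF lim that])
  ultimately have "transfinite_composite \<kappa> C S (Fo L.E (m, 0)) Y
      ((\<lambda>(x, n). \<iota> (e x) \<cdot> lg x n) (m, 0))"
    by (intro transfinite_compositeI[OF L.Well_order_lex _ _ L.is_functor_E _ _ colim'])
  moreover have "\<iota> (e m) \<cdot> lg m 0 = \<iota> m"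
    using colim e_le[OF m'] L.lg_0[OF m'] by (simp add: is_colimit_order_iff is_cocone_order_iff)
  ultimately show ?thesis
    using X f L.Xs_0[OF m'] by simp
qed

end

section \<open>Attaching cells\<close>

locale cocomplete_category = small_card_category \<kappa> C
  for \<kappa> :: "'k rel" and C :: "('o, 'm) cat" (structure) +
  assumes cocomplete: "cocomplete \<kappa> C"
begin

lemma coproduct_exists:
  fixes A :: "'s set"
  assumes "small \<kappa> A" and X: "\<And>s. s \<in> A \<Longrightarrow> X s \<in> Ob C"
  obtains P \<iota> where "is_coproduct C A X P \<iota>"
proof -
  define D :: "('s, unit, 'o, 'm) fctr" where "D = \<lparr>Fo = X, Fm = (\<lambda>s _ _. Id C (X s))\<rparr>"
  have F: "Field (Id_on A) = A"
    by (auto simp: Field_def)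
  have D: "is_functor (order_cat (Id_on A)) C D"
    unfolding is_functor_order_iff F using X Comp_Id[OF X X Id_in[OF X]]
    by (auto simp: D_def Id_in)
  have coc: "is_cocone (order_cat (Id_on A)) C D T \<tau> \<longleftrightarrow> T \<in> Ob C \<and> (\<forall>s\<in>A. \<tau> s \<in> Hom C (X s) T)"
    for T \<tau>
    unfolding is_cocone_order_iff F using X by (auto simp: D_def Comp_Id)
  obtain P \<iota> where P: "is_colimit (order_cat (Id_on A)) C D P \<iota>"
  proof (rule preorder_colimit[OF cocomplete _ _ _ D])
    show "small \<kappa> (Field (Id_on A))" "refl_on (Field (Id_on A)) (Id_on A)" "trans (Id_on A)"
      unfolding F using assms(1) by (auto simp: refl_on_def trans_def)
  qed
  have "is_coproduct C A X P \<iota>"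
    using P X unfolding is_coproduct_def is_colimit_order_iff coc F by simp
  then show thesis ..
qed

lemma pushout_exists:
  assumes g: "arr g P Q" and u: "arr u P X"
  obtains Y f v where "is_pushout C P Q X Y g u f v"
proof -
  define r :: "nat rel" where "r = {(0, 0), (1, 1), (2, 2), (0, 1), (0, 2)}"
  define D :: "(nat, unit, 'o, 'm) fctr" where
    "D = \<lparr>Fo = (\<lambda>n. if n = 0 then P else if n = 1 then Q else X),
      Fm = (\<lambda>m n _. if m = n then Id C (if n = 0 then P else if n = 1 then Q else X)
        else if n = 1 then g else u)\<rparr>"
  have F: "Field r = {0, 1, 2}"
    by (auto simp: r_def Field_def)
  have ob: "P \<in> Ob C" "Q \<in> Ob C" "X \<in> Ob C" "g \<in> Hom C P Q" "u \<in> Hom C P X"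
    using g u by (simp_all add: arr_def)
  have D: "is_functor (order_cat r) C D"
    unfolding is_functor_order_iff F using ob
    by (auto simp: D_def r_def Id_in Comp_Id Id_Comp)
  have coc: "is_cocone (order_cat r) C D T \<tau> \<longleftrightarrow> T \<in> Ob C \<and> \<tau> 0 \<in> Hom C P T \<and>
      \<tau> 1 \<in> Hom C Q T \<and> \<tau> 2 \<in> Hom C X T \<and> \<tau> 1 \<cdot> g = \<tau> 0 \<and> \<tau> 2 \<cdot> u = \<tau> 0" for T \<tau>
    unfolding is_cocone_order_iff F using ob by (auto simp: D_def r_def Comp_Id)
  obtain Y \<iota> where Y: "is_colimit (order_cat r) C D Y \<iota>"
  proof (rule preorder_colimit[OF cocomplete _ _ _ D])
    show "small \<kappa> (Field r)"
      unfolding F by (rule small_finite) simp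
    show "refl_on (Field r) r" "trans r"
      unfolding F by (auto simp: r_def refl_on_def trans_def)
  qed
  have \<iota>: "arr (\<iota> 1) Q Y" "arr (\<iota> 2) X Y" "\<iota> 1 \<cdot> g = \<iota> 0" "\<iota> 2 \<cdot> u = \<iota> 0"
    using Y ob unfolding is_colimit_def coc by (auto simp: arr_def)
  have "is_pushout C P Q X Y g u (\<iota> 2) (\<iota> 1)"
    unfolding is_pushout_def
  proof (intro conjI ballI impI)
    fix T a b assume T: "T \<in> Ob C" "a \<in> Hom C X T" "b \<in> Hom C Q T" "a \<cdot> u = b \<cdot> g"
    define \<tau> where "\<tau> n = (if n = 0 then b \<cdot> g else if n = 1 then b else a)" for n :: nat
    have "b \<cdot> g \<in> Hom C P T"
      using Comp_in[OF ob(1,2) T(1) ob(4) T(3)] .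
    then have "is_cocone (order_cat r) C D T \<tau>"
      unfolding coc using T by (simp add: \<tau>_def)
    then obtain h where h: "arr h Y T" "h \<cdot> \<iota> 1 = b" "h \<cdot> \<iota> 2 = a"
    proof (rule is_colimit_factor[OF Y])
      fix h assume "arr h Y T" and *: "\<And>n. n \<in> Ob (order_cat r) \<Longrightarrow> h \<cdot> \<iota> n = \<tau> n"
      then show thesis
        using that[of h] *[of 1] *[of 2] by (simp add: F \<tau>_def)
    qed
    show "\<exists>!h. h \<in> Hom C Y T \<and> h \<cdot> \<iota> 2 = a \<and> h \<cdot> \<iota> 1 = b"
    proof (rule ex1I[of _ h])
      show "h \<in> Hom C Y T \<and> h \<cdot> \<iota> 2 = a \<and> h \<cdot> \<iota> 1 = b"
        using h by (simp add: arr_def)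
      fix k assume k: "k \<in> Hom C Y T \<and> k \<cdot> \<iota> 2 = a \<and> k \<cdot> \<iota> 1 = b"
      then have karr: "arr k Y T"
        using h(1) by (simp add: arr_def)
      show "k = h"
      proof (rule is_colimit_ext[OF D Y karr h(1)])
        fix n assume "n \<in> Ob (order_cat r)"
        then consider "n = 0" | "n = 1" | "n = 2"
          unfolding Ob_order_cat F by blast
        then show "k \<cdot> \<iota> n = h \<cdot> \<iota> n"
        proof cases
          case 1
          have "k \<cdot> \<iota> 1 \<cdot> g = h \<cdot> \<iota> 1 \<cdot> g"
            using k h by simp
          then show ?thesis
            using 1 assoc[OF g \<iota>(1) karr] assoc[OF g \<iota>(1) h(1)] \<iota>(3) by simp
        qed (use k h in auto)
      qed
    qed
  qed (use \<iota> ob in \<open>auto simp: arr_def\<close>)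
  then show thesis ..
qed

lemma is_coproduct_ext:
  assumes P: "is_coproduct C A X P \<iota>" and h: "arr h P T" and k: "arr k P T"
    and eq: "\<And>s. s \<in> A \<Longrightarrow> h \<cdot> \<iota> s = k \<cdot> \<iota> s"
  shows "h = k"
proof -
  have "\<forall>s\<in>A. h \<cdot> \<iota> s \<in> Hom C (X s) T"
    using P h arr_comp[of "\<iota> _" "X _" P h T] unfolding is_coproduct_def arr_def by blast
  then have ex1: "\<exists>!g. g \<in> Hom C P T \<and> (\<forall>s\<in>A. g \<cdot> \<iota> s = h \<cdot> \<iota> s)"
    using P h unfolding is_coproduct_def arr_def by simp
  have "h \<in> Hom C P T \<and> (\<forall>s\<in>A. h \<cdot> \<iota> s = h \<cdot> \<iota> s)"
    "k \<in> Hom C P T \<and> (\<forall>s\<in>A. k \<cdot> \<iota> s = h \<cdot> \<iota> s)"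
    using h k eq by (simp_all add: arr_def)
  with ex1 show ?thesis
    by blast
qed

lemma is_coproduct_factor:
  assumes P: "is_coproduct C A X P \<iota>" and "T \<in> Ob C" and "\<And>s. s \<in> A \<Longrightarrow> \<tau> s \<in> Hom C (X s) T"
  obtains h where "arr h P T" and "\<And>s. s \<in> A \<Longrightarrow> h \<cdot> \<iota> s = \<tau> s"
proof -
  have "\<exists>!h. h \<in> Hom C P T \<and> (\<forall>s\<in>A. h \<cdot> \<iota> s = \<tau> s)"
    using assms unfolding is_coproduct_def by simp
  then obtain h where "h \<in> Hom C P T" "\<forall>s\<in>A. h \<cdot> \<iota> s = \<tau> s"
    by blast
  then show thesis
    using that[of h] assms(1,2) by (simp add: arr_def is_coproduct_def)
qed

lemma is_coproduct_arr: "is_coproduct C A X P \<iota> \<Longrightarrow> s \<in> A \<Longrightarrow> arr (\<iota> s) (X s) P"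
  by (simp add: is_coproduct_def arr_def)

text \<open>The empty coproduct of members is the identity of an initial object, and its pushout
  along the unique map to \<open>Z\<close> is the identity of \<open>Z\<close>. This provides the
  steps of stationary blocks.\<close>

lemma pushout_of_coproduct_Id:
  assumes Z: "Z \<in> Ob C"
  shows "pushout_of_coproduct \<kappa> C I Z Z (Id C Z)"
proof -
  have "small \<kappa> ({} :: 'k set)"
    by (rule small_finite) simp
  \<comment> \<open>With no cells, the function assigning members to cells is vacuous and
    \<open>undefined\<close> can stand for it.\<close>
  then obtain P \<iota> where P: "is_coproduct C ({} :: 'k set) (\<lambda>s. Src I (undefined s)) P \<iota>"
    by (rule coproduct_exists) auto
  then have PO: "P \<in> Ob C" and univ: "\<And>T. T \<in> Ob C \<Longrightarrow> \<exists>!h. h \<in> Hom C P T"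
    by (auto simp: is_coproduct_def)
  obtain u where u: "arr u P Z"
    using univ[OF Z] PO Z unfolding arr_def by blast
  have "is_coproduct C ({} :: 'k set) (\<lambda>s. Tgt I (undefined s)) P \<iota>"
    using PO univ by (simp add: is_coproduct_def)
  then have "coproduct_of_members \<kappa> C I P P (Id C P)"
    unfolding coproduct_of_members_def using P \<open>small \<kappa> ({} :: 'k set)\<close> Id_in[OF PO]
    by (intro exI[of _ "{} :: 'k set"] exI[of _ undefined] exI[of _ \<iota>]) simp
  moreover have "is_pushout C P P Z Z (Id C P) u (Id C Z) u"
    unfolding is_pushout_def
  proof (intro conjI ballI impI)
    show "Id C Z \<cdot> u = u \<cdot> Id C P"
      using Id_comp[OF u] comp_Id[OF u] by simp
    fix T a b assume T: "T \<in> Ob C" "a \<in> Hom C Z T" "b \<in> Hom C P T" "a \<cdot> u = b \<cdot> Id C P"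
    have b: "b \<cdot> Id C P = b"
      using Comp_Id[OF PO T(1,3)] .
    show "\<exists>!h. h \<in> Hom C Z T \<and> h \<cdot> Id C Z = a \<and> h \<cdot> u = b"
    proof (rule ex1I[of _ a])
      show "a \<in> Hom C Z T \<and> a \<cdot> Id C Z = a \<and> a \<cdot> u = b"
        using T b Comp_Id[OF Z T(1,2)] by simp
      show "k = a" if "k \<in> Hom C Z T \<and> k \<cdot> Id C Z = a \<and> k \<cdot> u = b" for k
        using that Comp_Id[OF Z T(1), of k] by simp
    qed
  qed (use PO Z u Id_in in \<open>auto simp: arr_def\<close>)
  ultimately show ?thesis
    unfolding pushout_of_coproduct_def by blast
qed

text \<open>Hides the two coproducts behind what maps into and out of \<open>Y\<close> see: a filler
  \<open>b s\<close> for each attaching map \<open>u s\<close>, and a universal property in terms of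
  fillers. The index type is free, so cells can be indexed directly by the probes they
  extend.\<close>

lemma attach_cells:
  fixes A :: "'s set"
  assumes I: "is_family \<kappa> C I" and X: "X \<in> Ob C" and A: "small \<kappa> A"
    and a: "\<And>s. s \<in> A \<Longrightarrow> a s \<in> Index I"
    and u: "\<And>s. s \<in> A \<Longrightarrow> arr (u s) (Src I (a s)) X"
  obtains Y j b where "pushout_of_coproduct \<kappa> C I X Y j" and "arr j X Y"
    and "\<And>s. s \<in> A \<Longrightarrow> arr (b s) (Tgt I (a s)) Y"
    and "\<And>s. s \<in> A \<Longrightarrow> b s \<cdot> Map I (a s) = j \<cdot> u s"
    and "\<And>T x c. arr x X T \<Longrightarrow> (\<And>s. s \<in> A \<Longrightarrow> arr (c s) (Tgt I (a s)) T) \<Longrightarrow>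
      (\<And>s. s \<in> A \<Longrightarrow> c s \<cdot> Map I (a s) = x \<cdot> u s) \<Longrightarrow>
      \<exists>h. arr h Y T \<and> h \<cdot> j = x \<and> (\<forall>s\<in>A. h \<cdot> b s = c s)"
    and "\<And>T h k. arr h Y T \<Longrightarrow> arr k Y T \<Longrightarrow> h \<cdot> j = k \<cdot> j \<Longrightarrow>
      (\<And>s. s \<in> A \<Longrightarrow> h \<cdot> b s = k \<cdot> b s) \<Longrightarrow> h = k"
proof -
  have fam: "arr (Map I i) (Src I i) (Tgt I i)" if "i \<in> Index I" for i
    using I that by (simp add: is_family_def arr_def)
  \<comment> \<open>\<open>coproduct_of_members\<close> admits only index sets in \<open>'k\<close>,
    so the cells are renamed.\<close>
  obtain e :: "'s \<Rightarrow> 'k" where e: "inj_on e A"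
    using small_embedding A by blast
  define i where "i = inv_into A e"
  have i [simp]: "i (e s) = s" if "s \<in> A" for s
    using e that by (simp add: i_def)
  define B where "B = e ` A"
  have i_in: "i k \<in> A" if "k \<in> B" for k
    using that by (auto simp: B_def)
  have B: "small \<kappa> B"
    unfolding B_def by (rule small_image[OF A])
  obtain P \<iota> where P: "is_coproduct C B (\<lambda>k. Src I (a (i k))) P \<iota>"
    using coproduct_exists[OF B, of "\<lambda>k. Src I (a (i k))"] arrD(1)[OF fam[OF a[OF i_in]]] by blast
  obtain Q \<iota>' where Q: "is_coproduct C B (\<lambda>k. Tgt I (a (i k))) Q \<iota>'"
    using coproduct_exists[OF B, of "\<lambda>k. Tgt I (a (i k))"] arrD(2)[OF fam[OF a[OF i_in]]] by blast
  note \<iota> = is_coproduct_arr[OF P] and \<iota>' = is_coproduct_arr[OF Q]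
  note mp = fam[OF a[OF i_in]]
  obtain g where g: "arr g P Q" "\<And>k. k \<in> B \<Longrightarrow> g \<cdot> \<iota> k = \<iota>' k \<cdot> Map I (a (i k))"
  proof (rule is_coproduct_factor[OF P])
    show "Q \<in> Ob C"
      using Q by (simp add: is_coproduct_def)
    show "\<iota>' k \<cdot> Map I (a (i k)) \<in> Hom C (Src I (a (i k))) Q" if "k \<in> B" for k
      using arr_comp[OF mp[OF that] \<iota>'[OF that]] by (rule arrD)
  qed blast
  obtain w where w: "arr w P X" "\<And>k. k \<in> B \<Longrightarrow> w \<cdot> \<iota> k = u (i k)"
    by (rule is_coproduct_factor[OF P X, of "\<lambda>k. u (i k)"]) (use arrD(3)[OF u[OF i_in]] in blast)+
  obtain Y j v where Y: "is_pushout C P Q X Y g w j v"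
    using pushout_exists[OF g(1) w(1)] by blast
  have j: "arr j X Y" and v: "arr v Q Y" and jw: "j \<cdot> w = v \<cdot> g"
    using Y by (simp_all add: is_pushout_def arr_def)
  define b where "b s = v \<cdot> \<iota>' (e s)" for s
  have eB: "e s \<in> B" if "s \<in> A" for s
    using that by (simp add: B_def)
  show thesis
  proof (rule that[of Y j b])
    have "coproduct_of_members \<kappa> C I P Q g"
      unfolding coproduct_of_members_def using B a i_in P Q g
      by (intro exI[of _ B] exI[of _ "a \<circ> i"] exI[of _ \<iota>] exI[of _ \<iota>']) (auto simp: arr_def)
    then show "pushout_of_coproduct \<kappa> C I X Y j"
      using Y unfolding pushout_of_coproduct_def by blast
    show "arr j X Y"
      by (rule j)
    show "arr (b s) (Tgt I (a s)) Y" if "s \<in> A" for s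
      using arr_comp[OF \<iota>'[OF eB[OF that]] v] that by (simp add: b_def)
    show "b s \<cdot> Map I (a s) = j \<cdot> u s" if s: "s \<in> A" for s
    proof -
      have "b s \<cdot> Map I (a s) = v \<cdot> (\<iota>' (e s) \<cdot> Map I (a s))"
        unfolding b_def using assoc[OF mp[OF eB[OF s]] \<iota>'[OF eB[OF s]] v] s by simp
      also have "\<dots> = v \<cdot> (g \<cdot> \<iota> (e s))"
        using g(2)[OF eB[OF s]] s by simp
      also have "\<dots> = j \<cdot> w \<cdot> \<iota> (e s)"
        using assoc[OF \<iota>[OF eB[OF s]] g(1) v] jw by simp
      also have "\<dots> = j \<cdot> u s"
        using assoc[OF \<iota>[OF eB[OF s]] w(1) j] w(2)[OF eB[OF s]] s by simp
      finally show ?thesis .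
    qed
  next
    fix T x c assume x: "arr x X T" and c: "\<And>s. s \<in> A \<Longrightarrow> arr (c s) (Tgt I (a s)) T"
      and eq: "\<And>s. s \<in> A \<Longrightarrow> c s \<cdot> Map I (a s) = x \<cdot> u s"
    have T: "T \<in> Ob C"
      using x by (rule arrD)
    obtain y where y: "arr y Q T" "\<And>k. k \<in> B \<Longrightarrow> y \<cdot> \<iota>' k = c (i k)"
      by (rule is_coproduct_factor[OF Q T, of "\<lambda>k. c (i k)"]) (use arrD(3)[OF c[OF i_in]] in blast)+
    have "x \<cdot> w = y \<cdot> g"
    proof (rule is_coproduct_ext[OF P arr_comp[OF w(1) x] arr_comp[OF g(1) y(1)]])
      fix k assume k: "k \<in> B"
      have "x \<cdot> w \<cdot> \<iota> k = x \<cdot> u (i k)"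
        using assoc[OF \<iota>[OF k] w(1) x] w(2)[OF k] by simp
      also have "\<dots> = y \<cdot> \<iota>' k \<cdot> Map I (a (i k))"
        using eq[OF i_in[OF k]] y(2)[OF k] by simp
      also have "\<dots> = y \<cdot> (g \<cdot> \<iota> k)"
        using assoc[OF mp[OF k] \<iota>'[OF k] y(1)] g(2)[OF k] by simp
      also have "\<dots> = y \<cdot> g \<cdot> \<iota> k"
        using assoc[OF \<iota>[OF k] g(1) y(1)] by simp
      finally show "x \<cdot> w \<cdot> \<iota> k = y \<cdot> g \<cdot> \<iota> k" .
    qed
    then have "\<exists>!h. h \<in> Hom C Y T \<and> h \<cdot> j = x \<and> h \<cdot> v = y"
      using Y T x y(1) unfolding is_pushout_def arr_def by blast
    then obtain h where h: "arr h Y T" "h \<cdot> j = x" "h \<cdot> v = y"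
      using T arrD(2)[OF j] unfolding arr_def by blast
    have "h \<cdot> b s = c s" if s: "s \<in> A" for s
      using assoc[OF \<iota>'[OF eB[OF s]] v h(1)] h(3) y(2)[OF eB[OF s]] s by (simp add: b_def)
    then show "\<exists>h. arr h Y T \<and> h \<cdot> j = x \<and> (\<forall>s\<in>A. h \<cdot> b s = c s)"
      using h by blast
  next
    fix T h k assume h: "arr h Y T" and k: "arr k Y T" and eq: "h \<cdot> j = k \<cdot> j"
      and eqb: "\<And>s. s \<in> A \<Longrightarrow> h \<cdot> b s = k \<cdot> b s"
    have "k \<cdot> v = h \<cdot> v"
    proof (rule is_coproduct_ext[OF Q arr_comp[OF v k] arr_comp[OF v h]])
      fix l assume l: "l \<in> B"
      then obtain s where s: "s \<in> A" "l = e s"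
        by (auto simp: B_def)
      show "k \<cdot> v \<cdot> \<iota>' l = h \<cdot> v \<cdot> \<iota>' l"
        using eqb[OF s(1)] assoc[OF \<iota>'[OF l] v h] assoc[OF \<iota>'[OF l] v k] s(2) by (simp add: b_def)
    qed
    moreover have "h \<cdot> j \<cdot> w = h \<cdot> v \<cdot> g"
      using assoc[OF w(1) j h] assoc[OF g(1) v h] jw by simp
    moreover have "T \<in> Ob C" "h \<cdot> j \<in> Hom C X T" "h \<cdot> v \<in> Hom C Q T"
      using arr_comp[OF j h] arr_comp[OF v h] by (auto simp: arr_def)
    ultimately have "\<exists>!l. l \<in> Hom C Y T \<and> l \<cdot> j = h \<cdot> j \<and> l \<cdot> v = h \<cdot> v" "k \<cdot> v = h \<cdot> v"
      using Y unfolding is_pushout_def by blast+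
    then show "h = k"
      using h k eq unfolding arr_def by metis
  qed
qed

end

section \<open>Partial algebras\<close>

locale finitary_family = cocomplete_category \<kappa> C
  for \<kappa> :: "'k rel" and C :: "('o, 'm) cat" (structure) +
  fixes I :: "('i, 'o, 'm) family"
  assumes family: "is_family \<kappa> C I"
    and presentable: "i \<in> Index I \<Longrightarrow> finitely_presentable \<kappa> C (Src I i)"
begin

lemma Map_arr: "i \<in> Index I \<Longrightarrow> arr (Map I i) (Src I i) (Tgt I i)"
  using family by (simp add: is_family_def arr_def)

definition probes :: "'o \<Rightarrow> ('i \<times> 'm) set" where
  "probes X = (SIGMA i : Index I. Hom C (Src I i) X)"

lemma probes_iff: "X \<in> Ob C \<Longrightarrow> (i, f) \<in> probes X \<longleftrightarrow> i \<in> Index I \<and> arr f (Src I i) X"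
  using Map_arr by (auto simp: probes_def arr_def)

text \<open>Finite presentability of the domains includes smallness of their hom-sets; thus all
  missing extensions can be attached by one small coproduct.\<close>

lemma small_probes: "X \<in> Ob C \<Longrightarrow> small \<kappa> (probes X)"
  unfolding probes_def using family presentable
  by (intro small_Sigma) (auto simp: is_family_def finitely_presentable_def)

definition partial_algebra :: "'o \<Rightarrow> ('i \<times> 'm) set \<Rightarrow> ('i \<times> 'm \<Rightarrow> 'm) \<Rightarrow> bool" where
  "partial_algebra X P c \<longleftrightarrow> X \<in> Ob C \<and> P \<subseteq> probes X \<and>
     (\<forall>i f. (i, f) \<in> P \<longrightarrow> arr (c (i, f)) (Tgt I i) X \<and> c (i, f) \<cdot> Map I i = f)"

text \<open>Interpolates between plain morphisms, for \<open>P\<close> empty, and morphisms of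
  algebraic injectives, for \<open>P = probes X\<close>. The extensions on the target side are not
  restricted to a subset.\<close>

definition partial_hom ::
  "'o \<Rightarrow> ('i \<times> 'm) set \<Rightarrow> ('i \<times> 'm \<Rightarrow> 'm) \<Rightarrow> 'o \<Rightarrow> ('i \<times> 'm \<Rightarrow> 'm) \<Rightarrow> 'm \<Rightarrow> bool" where
  "partial_hom X P c T t a \<longleftrightarrow>
     arr a X T \<and> (\<forall>i f. (i, f) \<in> P \<longrightarrow> a \<cdot> c (i, f) = t (i, a \<cdot> f))"

lemma partial_algebraD:
  assumes "partial_algebra X P c"
  shows "X \<in> Ob C"
    and "(i, f) \<in> P \<Longrightarrow> i \<in> Index I" and "(i, f) \<in> P \<Longrightarrow> arr f (Src I i) X"
    and "(i, f) \<in> P \<Longrightarrow> arr (c (i, f)) (Tgt I i) X"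
    and "(i, f) \<in> P \<Longrightarrow> c (i, f) \<cdot> Map I i = f"
  using assms Map_arr unfolding partial_algebra_def probes_def arr_def by blast+

lemma partial_homD:
  assumes "partial_hom X P c T t a"
  shows "arr a X T" and "(i, f) \<in> P \<Longrightarrow> a \<cdot> c (i, f) = t (i, a \<cdot> f)"
  using assms by (simp_all add: partial_hom_def)

lemma InjD:
  assumes "(T, t) \<in> Ob (Inj C I)"
  shows "T \<in> Ob C" and "partial_algebra T (probes T) t"
  using assms Map_arr by (auto simp: Inj_def partial_algebra_def probes_def PiE_iff arr_def)

lemma InjI:
  assumes "partial_algebra T (probes T) t" and "\<And>p. p \<notin> probes T \<Longrightarrow> t p = undefined"
  shows "(T, t) \<in> Ob (Inj C I)"
proof -
  have "T \<in> Ob C"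
    using assms(1) by (simp add: partial_algebra_def)
  moreover have "t \<in> (\<Pi>\<^sub>E (i, f) \<in> (SIGMA i : Index I. Hom C (Src I i) T). Hom C (Tgt I i) T)"
    using assms unfolding partial_algebra_def probes_def[symmetric]
    by (auto simp: PiE_iff extensional_def arr_def)
  moreover have "\<forall>i\<in>Index I. \<forall>f\<in>Hom C (Src I i) T. t (i, f) \<cdot> Map I i = f"
    using assms(1) unfolding partial_algebra_def probes_def by blast
  ultimately show ?thesis
    by (simp add: Inj_def)
qed

lemma Inj_Hom_iff:
  assumes "(T, t) \<in> Ob (Inj C I)" and "(T', t') \<in> Ob (Inj C I)"
  shows "h \<in> Hom (Inj C I) (T, t) (T', t') \<longleftrightarrow> partial_hom T (probes T) t T' t' h"
  using InjD(1)[OF assms(1)] InjD(1)[OF assms(2)]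
  by (auto simp: Inj_def partial_hom_def probes_def arr_def)

lemma partial_hom_comp:
  assumes X: "partial_algebra X P c" and T: "(T, t) \<in> Ob (Inj C I)" and T': "(T', t') \<in> Ob (Inj C I)"
    and a: "partial_hom X P c T t a" and h: "h \<in> Hom (Inj C I) (T, t) (T', t')"
  shows "partial_hom X P c T' t' (h \<cdot> a)"
  unfolding partial_hom_def
proof (intro conjI allI impI)
  have h: "partial_hom T (probes T) t T' t' h"
    using h by (simp add: Inj_Hom_iff[OF T T'])
  note ar = partial_homD(1)[OF a] and hr = partial_homD(1)[OF h]
  show "arr (h \<cdot> a) X T'"
    using arr_comp[OF ar hr] .
  fix i f assume P: "(i, f) \<in> P"
  note X = partial_algebraD[OF X]
  have "(i, a \<cdot> f) \<in> probes T"
    using arr_comp[OF X(3)[OF P] ar] X(2)[OF P] InjD(1)[OF T] by (simp add: probes_iff)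
  then have "h \<cdot> t (i, a \<cdot> f) = t' (i, h \<cdot> (a \<cdot> f))"
    by (rule partial_homD(2)[OF h])
  then show "h \<cdot> a \<cdot> c (i, f) = t' (i, h \<cdot> a \<cdot> f)"
    using assoc[OF X(4)[OF P] ar hr] assoc[OF X(3)[OF P] ar hr] partial_homD(2)[OF a P] by simp
qed

section \<open>Directed colimits of partial algebras\<close>

text \<open>A probe of \<open>L\<close> factors through a stage, and its image at a later stage has
  a chosen extension, which is pushed forward along the leg. The result is independent of choices,
  since two factorizations agree at some later stage and transitions preserve chosen extensions.
  Allowing proper subsets \<open>P x\<close> covers the free construction; taking all probes covers
  diagrams of algebras.\<close>

lemma directed_colimit_algebra:
  fixes r :: "'a rel"
  assumes small: "small \<kappa> (Field r)" and refl: "refl_on (Field r) r" and trans: "trans r"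
    and ne: "Field r \<noteq> {}"
    and dir: "\<And>x y. x \<in> Field r \<Longrightarrow> y \<in> Field r \<Longrightarrow> \<exists>z. (x, z) \<in> r \<and> (y, z) \<in> r"
    and D: "is_functor (order_cat r) C D" and L: "is_colimit (order_cat r) C D L \<iota>"
    and alg: "\<And>x. x \<in> Field r \<Longrightarrow> partial_algebra (Fo D x) (P x) (c x)"
    and hom: "\<And>x y i f. (x, y) \<in> r \<Longrightarrow> (i, f) \<in> P x \<Longrightarrow>
      (i, Fm D x y () \<cdot> f) \<in> P y \<and> c y (i, Fm D x y () \<cdot> f) = Fm D x y () \<cdot> c x (i, f)"
    and total: "\<And>x i f. (i, f) \<in> probes (Fo D x) \<Longrightarrow> x \<in> Field r \<Longrightarrow>
      \<exists>y. (x, y) \<in> r \<and> (i, Fm D x y () \<cdot> f) \<in> P y"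
  obtains d where "(L, d) \<in> Ob (Inj C I)"
    and "\<And>x. x \<in> Field r \<Longrightarrow> partial_hom (Fo D x) (P x) (c x) L d (\<iota> x)"
    and "\<And>T t h. (T, t) \<in> Ob (Inj C I) \<Longrightarrow> arr h L T \<Longrightarrow>
      (\<And>x. x \<in> Field r \<Longrightarrow> partial_hom (Fo D x) (P x) (c x) T t (h \<cdot> \<iota> x)) \<Longrightarrow>
      h \<in> Hom (Inj C I) (L, d) (T, t)"
proof -
  have coc: "is_cocone (order_cat r) C D L \<iota>"
    using L by (simp add: is_colimit_def)
  have L_Ob: "L \<in> Ob C"
    using coc by (simp add: is_cocone_def)
  have \<iota>: "arr (\<iota> x) (Fo D x) L" if "x \<in> Field r" for x
    using is_cocone_arr[OF D coc] that by simp
  have F: "x \<in> Field r" "y \<in> Field r" if "(x, y) \<in> r" for x y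
    using that by (auto intro: FieldI1 FieldI2)
  have Fm: "arr (Fm D x y ()) (Fo D x) (Fo D y)" if "(x, y) \<in> r" for x y
    using D F[OF that] that by (simp add: is_functor_order_iff arr_def)
  have \<iota>_Fm: "\<iota> y \<cdot> Fm D x y () = \<iota> x" if "(x, y) \<in> r" for x y
    using coc that by (simp add: is_cocone_order_iff)
  \<comment> \<open>A representative of a probe of \<open>L\<close> is required to have an extension
    chosen at its own stage, so that \<open>c x\<close> can be applied to it.\<close>
  define v where "v p x g = (x \<in> Field r \<and> (fst p, g) \<in> P x \<and> \<iota> x \<cdot> g = snd p)" for p x g
  have v_ex: "\<exists>x g. v p x g" if p: "p \<in> probes L" for p
  proof -
    obtain i f where if': "p = (i, f)" "i \<in> Index I" "arr f (Src I i) L"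
      using p probes_iff[OF L_Ob] by (cases p) auto
    obtain x g where x: "x \<in> Field r" "g \<in> Hom C (Src I i) (Fo D x)" "\<iota> x \<cdot> g = f"
      using finitely_presentable_factors[OF presentable[OF if'(2)] small refl trans ne dir D L
          category_axioms arrD(3)[OF if'(3)]] by blast
    then have "(i, g) \<in> probes (Fo D x)"
      using if' by (simp add: probes_def)
    then obtain y where y: "(x, y) \<in> r" "(i, Fm D x y () \<cdot> g) \<in> P y"
      using total x(1) by blast
    have g: "arr g (Src I i) (Fo D x)"
      using x(2) arrD(1)[OF if'(3)] arrD(1)[OF \<iota>[OF x(1)]] by (simp add: arr_def)
    have "\<iota> y \<cdot> (Fm D x y () \<cdot> g) = f"
      using assoc[OF g Fm[OF y(1)] \<iota>[OF F(2)[OF y(1)]]] \<iota>_Fm[OF y(1)] x(3) by simp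
    then have "v p y (Fm D x y () \<cdot> g)"
      using y F if' by (simp add: v_def)
    then show ?thesis
      by blast
  qed
  have v_unique: "\<iota> x \<cdot> c x (i, g) = \<iota> y \<cdot> c y (i, g')" if v: "v (i, f) x g" "v (i, f) y g'" for i f x y g g'
  proof -
    have x: "x \<in> Field r" "(i, g) \<in> P x" and y: "y \<in> Field r" "(i, g') \<in> P y"
      and eq: "\<iota> x \<cdot> g = \<iota> y \<cdot> g'"
      using v by (simp_all add: v_def)
    note ax = partial_algebraD[OF alg[OF x(1)]] and ay = partial_algebraD[OF alg[OF y(1)]]
    obtain z where z: "(x, z) \<in> r" "(y, z) \<in> r" "Fm D x z () \<cdot> g = Fm D y z () \<cdot> g'"
      using finitely_presentable_equal[OF presentable[OF ax(2)[OF x(2)]] small refl trans ne dir D L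
          category_axioms x(1) y(1) arrD(3)[OF ax(3)[OF x(2)]] arrD(3)[OF ay(3)[OF y(2)]] eq] by blast
    have "\<iota> x \<cdot> c x (i, g) = \<iota> z \<cdot> (Fm D x z () \<cdot> c x (i, g))"
      using assoc[OF ax(4)[OF x(2)] Fm[OF z(1)] \<iota>[OF F(2)[OF z(1)]]] \<iota>_Fm[OF z(1)] by simp
    also have "Fm D x z () \<cdot> c x (i, g) = Fm D y z () \<cdot> c y (i, g')"
      using hom[OF z(1) x(2)] hom[OF z(2) y(2)] z(3) by simp
    also have "\<iota> z \<cdot> \<dots> = \<iota> y \<cdot> c y (i, g')"
      using assoc[OF ay(4)[OF y(2)] Fm[OF z(2)] \<iota>[OF F(2)[OF z(2)]]] \<iota>_Fm[OF z(2)] by simp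
    finally show ?thesis .
  qed
  define w where "w p = (SOME q. v p (fst q) (snd q))" for p
  have w: "v p (fst (w p)) (snd (w p))" if p: "p \<in> probes L" for p
  proof -
    obtain x g where "v p x g"
      using v_ex[OF p] by blast
    then show ?thesis
      unfolding w_def by (intro someI[of "\<lambda>q. v p (fst q) (snd q)" "(x, g)"]) simp
  qed
  \<comment> \<open>The value \<open>undefined\<close> off the probes makes \<open>d\<close>
    extensional, as objects of \<open>Inj C I\<close> demand.\<close>
  define d where "d p = (if p \<in> probes L then \<iota> (fst (w p)) \<cdot> c (fst (w p)) (fst p, snd (w p)) else undefined)" for p
  have d: "d (i, \<iota> x \<cdot> g) = \<iota> x \<cdot> c x (i, g)" if x: "x \<in> Field r" "(i, g) \<in> P x" for x i g
  proof -
    note ax = partial_algebraD[OF alg[OF x(1)]]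
    have p: "(i, \<iota> x \<cdot> g) \<in> probes L"
      using arr_comp[OF ax(3)[OF x(2)] \<iota>[OF x(1)]] ax(2)[OF x(2)] by (simp add: probes_iff[OF L_Ob])
    have "v (i, \<iota> x \<cdot> g) x g"
      using x by (simp add: v_def)
    then show ?thesis
      using v_unique[OF w[OF p]] p by (simp add: d_def)
  qed
  have algL: "partial_algebra L (probes L) d"
    unfolding partial_algebra_def
  proof (intro conjI allI impI)
    fix i f assume p: "(i, f) \<in> probes L"
    obtain x g where "v (i, f) x g"
      using v_ex[OF p] by blast
    then have x: "x \<in> Field r" "(i, g) \<in> P x" and f: "\<iota> x \<cdot> g = f"
      by (simp_all add: v_def)
    note ax = partial_algebraD[OF alg[OF x(1)]]
    have eq: "d (i, f) = \<iota> x \<cdot> c x (i, g)"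
      using d[OF x] f by simp
    show "arr (d (i, f)) (Tgt I i) L"
      unfolding eq by (rule arr_comp[OF ax(4)[OF x(2)] \<iota>[OF x(1)]])
    show "d (i, f) \<cdot> Map I i = f"
      unfolding eq
      using assoc[OF Map_arr[OF ax(2)[OF x(2)]] ax(4)[OF x(2)] \<iota>[OF x(1)]] ax(5)[OF x(2)] f by simp
  qed (simp_all add: L_Ob)
  have InjL: "(L, d) \<in> Ob (Inj C I)"
    by (rule InjI[OF algL]) (simp add: d_def)
  show thesis
  proof (rule that[OF InjL])
    show "partial_hom (Fo D x) (P x) (c x) L d (\<iota> x)" if "x \<in> Field r" for x
      unfolding partial_hom_def using d[OF that] \<iota>[OF that] by simp
    fix T t h assume T: "(T, t) \<in> Ob (Inj C I)" and h: "arr h L T"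
      and hx: "\<And>x. x \<in> Field r \<Longrightarrow> partial_hom (Fo D x) (P x) (c x) T t (h \<cdot> \<iota> x)"
    show "h \<in> Hom (Inj C I) (L, d) (T, t)"
      unfolding Inj_Hom_iff[OF InjL T] partial_hom_def
    proof (intro conjI allI impI)
      show "arr h L T"
        by (rule h)
      fix i f assume p: "(i, f) \<in> probes L"
      obtain x g where "v (i, f) x g"
        using v_ex[OF p] by blast
      then have x: "x \<in> Field r" "(i, g) \<in> P x" and f: "\<iota> x \<cdot> g = f"
        by (simp_all add: v_def)
      note ax = partial_algebraD[OF alg[OF x(1)]]
      have "h \<cdot> d (i, f) = h \<cdot> \<iota> x \<cdot> c x (i, g)"
        using d[OF x] f assoc[OF ax(4)[OF x(2)] \<iota>[OF x(1)] h] by simp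
      also have "\<dots> = t (i, h \<cdot> \<iota> x \<cdot> g)"
        by (rule partial_homD(2)[OF hx[OF x(1)] x(2)])
      also have "h \<cdot> \<iota> x \<cdot> g = h \<cdot> f"
        using assoc[OF ax(3)[OF x(2)] \<iota>[OF x(1)] h] f by simp
      finally show "h \<cdot> d (i, f) = t (i, h \<cdot> f)" .
    qed
  qed
qed

section \<open>The universal property of free algebras\<close>

text \<open>States that \<open>(N, n)\<close> is the free algebraic injective on the partial
  algebra, with \<open>\<psi>\<close> as its unit: a reflection of the partial algebra into
  algebras.\<close>

definition universal_hom ::
  "'o \<Rightarrow> ('i \<times> 'm) set \<Rightarrow> ('i \<times> 'm \<Rightarrow> 'm) \<Rightarrow> 'o \<Rightarrow> ('i \<times> 'm \<Rightarrow> 'm) \<Rightarrow> 'm \<Rightarrow> bool" where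
  "universal_hom X P c N n \<psi> \<longleftrightarrow> (N, n) \<in> Ob (Inj C I) \<and> partial_hom X P c N n \<psi> \<and>
     (\<forall>T t a. (T, t) \<in> Ob (Inj C I) \<longrightarrow> partial_hom X P c T t a \<longrightarrow>
        (\<exists>!h. h \<in> Hom (Inj C I) (N, n) (T, t) \<and> h \<cdot> \<psi> = a))"

lemma Inj_Comp: "g \<cdot>\<^bsub>Inj C I\<^esub> f = g \<cdot> f"
  by (simp add: Inj_def)

lemma Inj_Id: "(N, n) \<in> Ob (Inj C I) \<Longrightarrow> Id C N \<in> Hom (Inj C I) (N, n) (N, n)"
  using category.Id_in[OF category_Inj[OF category_axioms family], of "(N, n)"] by (simp add: Inj_def)

lemma Inj_comp:
  assumes "X \<in> Ob (Inj C I)" "Y \<in> Ob (Inj C I)" "Z \<in> Ob (Inj C I)"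
    and "f \<in> Hom (Inj C I) X Y" and "g \<in> Hom (Inj C I) Y Z"
  shows "g \<cdot> f \<in> Hom (Inj C I) X Z"
  using category.Comp_in[OF category_Inj[OF category_axioms family] assms] by (simp add: Inj_Comp)

lemma Inj_arr:
  "(N, n) \<in> Ob (Inj C I) \<Longrightarrow> (T, t) \<in> Ob (Inj C I) \<Longrightarrow> h \<in> Hom (Inj C I) (N, n) (T, t) \<Longrightarrow> arr h N T"
  by (simp add: Inj_Hom_iff partial_hom_def)

lemma universal_hom_unique:
  assumes N: "universal_hom X P c N n \<psi>" and L: "universal_hom X P c L d \<phi>"
  obtains h k where "arr h N L" and "arr k L N" and "h \<cdot> k = Id C L" and "k \<cdot> h = Id C N"
    and "h \<cdot> \<psi> = \<phi>"
proof -
  have NO: "(N, n) \<in> Ob (Inj C I)" and LO: "(L, d) \<in> Ob (Inj C I)"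
    and \<psi>: "partial_hom X P c N n \<psi>" and \<phi>: "partial_hom X P c L d \<phi>"
    using N L by (simp_all add: universal_hom_def)
  have N_ex: "\<exists>!h. h \<in> Hom (Inj C I) (N, n) (T, t) \<and> h \<cdot> \<psi> = a"
    if "(T, t) \<in> Ob (Inj C I)" "partial_hom X P c T t a" for T t a
    using N that by (simp add: universal_hom_def)
  have L_ex: "\<exists>!h. h \<in> Hom (Inj C I) (L, d) (T, t) \<and> h \<cdot> \<phi> = a"
    if "(T, t) \<in> Ob (Inj C I)" "partial_hom X P c T t a" for T t a
    using L that by (simp add: universal_hom_def)
  obtain h where h: "h \<in> Hom (Inj C I) (N, n) (L, d)" "h \<cdot> \<psi> = \<phi>"
    using N_ex[OF LO \<phi>] by blast
  obtain k where k: "k \<in> Hom (Inj C I) (L, d) (N, n)" "k \<cdot> \<phi> = \<psi>"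
    using L_ex[OF NO \<psi>] by blast
  note ha = Inj_arr[OF NO LO h(1)] and ka = Inj_arr[OF LO NO k(1)]
  note \<psi>a = partial_homD(1)[OF \<psi>] and \<phi>a = partial_homD(1)[OF \<phi>]
  have "h \<cdot> k \<in> Hom (Inj C I) (L, d) (L, d) \<and> h \<cdot> k \<cdot> \<phi> = \<phi>"
    using Inj_comp[OF LO NO LO k(1) h(1)] assoc[OF \<phi>a ka ha] h k by simp
  moreover have "Id C L \<in> Hom (Inj C I) (L, d) (L, d) \<and> Id C L \<cdot> \<phi> = \<phi>"
    using Inj_Id[OF LO] Id_comp[OF \<phi>a] by simp
  ultimately have hk: "h \<cdot> k = Id C L"
    using L_ex[OF LO \<phi>] by blast
  have "k \<cdot> h \<in> Hom (Inj C I) (N, n) (N, n) \<and> k \<cdot> h \<cdot> \<psi> = \<psi>"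
    using Inj_comp[OF NO LO NO h(1) k(1)] assoc[OF \<psi>a ha ka] h k by simp
  moreover have "Id C N \<in> Hom (Inj C I) (N, n) (N, n) \<and> Id C N \<cdot> \<psi> = \<psi>"
    using Inj_Id[OF NO] Id_comp[OF \<psi>a] by simp
  ultimately have "k \<cdot> h = Id C N"
    using N_ex[OF NO \<psi>] by blast
  then show thesis
    using that ha ka hk h(2) by blast
qed

end

section \<open>Construction of free algebras by monic cell attachments\<close>

locale monic_cells = finitary_family \<kappa> C I
  for \<kappa> :: "'k rel" and C :: "('o, 'm) cat" (structure) and I :: "('i, 'o, 'm) family" +
  assumes cellular_mono: "cellular \<kappa> C I X Y f \<Longrightarrow> is_mono C X Y f"
begin

abbreviation cell_step :: "'o \<Rightarrow> 'o \<Rightarrow> 'm \<Rightarrow> bool" where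
  "cell_step \<equiv> pushout_of_coproduct \<kappa> C I"

lemma cell_step_mono:
  assumes "cell_step X Y j" and "arr j X Y" and "arr f W X" and "arr g W X" and "j \<cdot> f = j \<cdot> g"
  shows "f = g"
proof -
  have "cellular \<kappa> C I X Y j"
    unfolding cellular_def by (rule transfinite_composite_single[where S = cell_step, OF assms(2,1)])
  then have "is_mono C X Y j"
    by (rule cellular_mono)
  then show ?thesis
    using assms(3-5) unfolding is_mono_def arr_def by blast
qed

text \<open>One omega-composite is a transfinite composite of omega-composites, so the refinement
  theorem turns it into a transfinite composite of pushouts.\<close>

lemma sequential_composite_cellular:
  assumes "sequential_composite cell_step X Y f" and "arr f X Y"
  shows "cellular \<kappa> C I X Y f"
  unfolding cellular_def
  by (rule transfinite_composite_of_sequential[OF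
        transfinite_composite_single[where S = "sequential_composite cell_step", OF assms(2,1)]
        pushout_of_coproduct_Id])

text \<open>Extensions in \<open>Y\<close> of the probes in \<open>X\<close> form a partial algebra because \<open>j\<close> is monic.\<close>

lemma image_partial_algebra:
  assumes j: "cell_step X Y j" "arr j X Y"
    and c: "\<And>i f. (i, f) \<in> probes X \<Longrightarrow> arr (c (i, f)) (Tgt I i) Y"
    and ext: "\<And>i f. (i, f) \<in> probes X \<Longrightarrow> c (i, f) \<cdot> Map I i = j \<cdot> f"
  obtains Q d where "partial_algebra Y Q d"
    and "\<And>i f. (i, f) \<in> probes X \<Longrightarrow> (i, j \<cdot> f) \<in> Q"
    and "\<And>T t a. partial_hom Y Q d T t a \<longleftrightarrow>
      arr a Y T \<and> (\<forall>i f. (i, f) \<in> probes X \<longrightarrow> a \<cdot> c (i, f) = t (i, a \<cdot> (j \<cdot> f)))"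
    and "\<And>i f. (i, f) \<in> probes X \<Longrightarrow> d (i, j \<cdot> f) = c (i, f)"
proof -
  have X: "X \<in> Ob C" and Y: "Y \<in> Ob C"
    using j(2) by (auto dest: arrD)
  define Q where "Q = {(i, j \<cdot> f) | i f. (i, f) \<in> probes X}"
  define d where "d p = c (fst p, THE f. (fst p, f) \<in> probes X \<and> j \<cdot> f = snd p)" for p
  have d: "d (i, j \<cdot> f) = c (i, f)" if p: "(i, f) \<in> probes X" for i f
  proof -
    have "(THE g. (i, g) \<in> probes X \<and> j \<cdot> g = j \<cdot> f) = f"
    proof (rule the_equality)
      show "g = f" if "(i, g) \<in> probes X \<and> j \<cdot> g = j \<cdot> f" for g
        using that p cell_step_mono[OF j, of g "Src I i" f] by (simp add: probes_iff[OF X])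
    qed (use p in simp)
    then show ?thesis
      by (simp add: d_def)
  qed
  show thesis
  proof (rule that[of Q d])
    show "partial_algebra Y Q d"
      unfolding partial_algebra_def
    proof (intro conjI allI impI)
      show "Q \<subseteq> probes Y"
        using arr_comp[OF _ j(2)] by (auto simp: Q_def probes_iff[OF X] probes_iff[OF Y])
      fix i g assume "(i, g) \<in> Q"
      then obtain f where f: "(i, f) \<in> probes X" "g = j \<cdot> f"
        by (auto simp: Q_def)
      show "arr (d (i, g)) (Tgt I i) Y" "d (i, g) \<cdot> Map I i = g"
        using c[OF f(1)] ext[OF f(1)] d[OF f(1)] f(2) by simp_all
    qed (rule Y)
    show "(i, j \<cdot> f) \<in> Q" if "(i, f) \<in> probes X" for i f
      using that by (auto simp: Q_def)
    show "partial_hom Y Q d T t a \<longleftrightarrow>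
      arr a Y T \<and> (\<forall>i f. (i, f) \<in> probes X \<longrightarrow> a \<cdot> c (i, f) = t (i, a \<cdot> (j \<cdot> f)))" for T t a
    proof -
      have "(\<forall>i g. (i, g) \<in> Q \<longrightarrow> a \<cdot> d (i, g) = t (i, a \<cdot> g)) \<longleftrightarrow>
          (\<forall>i f. (i, f) \<in> probes X \<longrightarrow> a \<cdot> d (i, j \<cdot> f) = t (i, a \<cdot> (j \<cdot> f)))"
        unfolding Q_def by blast
      then show ?thesis
        unfolding partial_hom_def using d by simp
    qed
  qed (rule d)
qed

text \<open>Exactly what the iteration consumes. The clause on \<open>probes X\<close> makes the
  colimit total, the clause on \<open>P\<close> makes inherited extensions compatible with the
  transitions, and the last two clauses give existence and uniqueness of induced maps stage by
  stage.\<close>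

definition extension_step ::
  "'o \<times> ('i \<times> 'm) set \<times> ('i \<times> 'm \<Rightarrow> 'm) \<Rightarrow> 'o \<times> ('i \<times> 'm) set \<times> ('i \<times> 'm \<Rightarrow> 'm) \<Rightarrow> 'm \<Rightarrow> bool" where
  "extension_step = (\<lambda>(X, P, c) (Y, Q, d) j.
     cell_step X Y j \<and> arr j X Y \<and> partial_algebra Y Q d \<and>
     (\<forall>i f. (i, f) \<in> probes X \<longrightarrow> (i, j \<cdot> f) \<in> Q) \<and>
     (\<forall>i f. (i, f) \<in> P \<longrightarrow> d (i, j \<cdot> f) = j \<cdot> c (i, f)) \<and>
     (\<forall>T t a. (T, t) \<in> Ob (Inj C I) \<longrightarrow> partial_hom X P c T t a \<longrightarrow>
        (\<exists>b. partial_hom Y Q d T t b \<and> b \<cdot> j = a)) \<and>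
     (\<forall>T t a b. partial_hom Y Q d T t a \<longrightarrow> partial_hom Y Q d T t b \<longrightarrow> a \<cdot> j = b \<cdot> j \<longrightarrow> a = b))"

text \<open>A homomorphism into \<open>(T, t)\<close> has no freedom on a new cell: it must send the
  filler of a probe to the extension that \<open>t\<close> selects for the image of that probe.
  Prescribing these values gives existence, and their being forced gives uniqueness.\<close>

lemma extension_step_exists:
  assumes X: "partial_algebra X P c"
  shows "\<exists>s j. extension_step (X, P, c) s j"
proof -
  note X_Ob = partial_algebraD(1)[OF X] and XD = partial_algebraD[OF X]
  have P_sub: "(i, f) \<in> probes X" if "(i, f) \<in> P" for i f
    using X that unfolding partial_algebra_def by blast
  define A where "A = probes X - P"
  have A: "small \<kappa> A"
    unfolding A_def using small_mono[OF Diff_subset small_probes[OF X_Ob]] .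
  have A_iff: "(i, f) \<in> A \<longleftrightarrow> i \<in> Index I \<and> arr f (Src I i) X \<and> (i, f) \<notin> P" for i f
    by (simp add: A_def probes_iff[OF X_Ob])
  have a: "fst s \<in> Index I" and u: "arr (snd s) (Src I (fst s)) X" if "s \<in> A" for s
    using that A_iff[of "fst s" "snd s"] by simp_all
  obtain Y j b where j: "cell_step X Y j" "arr j X Y"
    and b: "\<And>s. s \<in> A \<Longrightarrow> arr (b s) (Tgt I (fst s)) Y"
      "\<And>s. s \<in> A \<Longrightarrow> b s \<cdot> Map I (fst s) = j \<cdot> snd s"
    and ex: "\<And>T x c. arr x X T \<Longrightarrow> (\<And>s. s \<in> A \<Longrightarrow> arr (c s) (Tgt I (fst s)) T) \<Longrightarrow>
      (\<And>s. s \<in> A \<Longrightarrow> c s \<cdot> Map I (fst s) = x \<cdot> snd s) \<Longrightarrow>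
      \<exists>h. arr h Y T \<and> h \<cdot> j = x \<and> (\<forall>s\<in>A. h \<cdot> b s = c s)"
    and un: "\<And>T h k. arr h Y T \<Longrightarrow> arr k Y T \<Longrightarrow> h \<cdot> j = k \<cdot> j \<Longrightarrow>
      (\<And>s. s \<in> A \<Longrightarrow> h \<cdot> b s = k \<cdot> b s) \<Longrightarrow> h = k"
    by (rule attach_cells[OF family X_Ob A a u]) blast+
  \<comment> \<open>Old extensions are carried along \<open>j\<close> and new ones are the fillers;
    together they serve every probe of \<open>X\<close>. Probes of \<open>Y\<close> not coming from
    \<open>X\<close> are left for the next stage.\<close>
  define e where "e p = (if p \<in> P then j \<cdot> c p else b p)" for p
  have e: "arr (e (i, f)) (Tgt I i) Y" "e (i, f) \<cdot> Map I i = j \<cdot> f" if p: "(i, f) \<in> probes X" for i f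
  proof -
    have "arr (e (i, f)) (Tgt I i) Y \<and> e (i, f) \<cdot> Map I i = j \<cdot> f"
    proof (cases "(i, f) \<in> P")
      case True
      then show ?thesis
        using arr_comp[OF XD(4)[OF True] j(2)] assoc[OF Map_arr[OF XD(2)[OF True]] XD(4)[OF True] j(2)]
          XD(5)[OF True] by (simp add: e_def)
    next
      case False
      then have "(i, f) \<in> A"
        using p by (simp add: A_def)
      then show ?thesis
        using b[of "(i, f)"] False by (simp add: e_def)
    qed
    then show "arr (e (i, f)) (Tgt I i) Y" "e (i, f) \<cdot> Map I i = j \<cdot> f"
      by simp_all
  qed
  obtain Q d where Q: "partial_algebra Y Q d" "\<And>i f. (i, f) \<in> probes X \<Longrightarrow> (i, j \<cdot> f) \<in> Q"
    and hom_iff: "\<And>T t a. partial_hom Y Q d T t a \<longleftrightarrow>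
      arr a Y T \<and> (\<forall>i f. (i, f) \<in> probes X \<longrightarrow> a \<cdot> e (i, f) = t (i, a \<cdot> (j \<cdot> f)))"
    and d: "\<And>i f. (i, f) \<in> probes X \<Longrightarrow> d (i, j \<cdot> f) = e (i, f)"
    by (rule image_partial_algebra[OF j e]) blast+
  have "\<exists>x. partial_hom Y Q d T t x \<and> x \<cdot> j = a"
    if T: "(T, t) \<in> Ob (Inj C I)" and a: "partial_hom X P c T t a" for T t a
  proof -
    note aa = partial_homD(1)[OF a]
    note TD = partial_algebraD[OF InjD(2)[OF T]]
    define z where "z s = t (fst s, a \<cdot> snd s)" for s
    have pr: "(fst s, a \<cdot> snd s) \<in> probes T" if "s \<in> A" for s
      using arr_comp[OF u[OF that] aa] \<open>s \<in> A\<close> A_iff[of "fst s" "snd s"]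
      by (simp add: probes_iff[OF TD(1)])
    have "\<exists>h. arr h Y T \<and> h \<cdot> j = a \<and> (\<forall>s\<in>A. h \<cdot> b s = z s)"
      using TD(4,5)[OF pr] by (intro ex[OF aa]) (simp_all add: z_def)
    then obtain h where h: "arr h Y T" "h \<cdot> j = a" "\<And>s. s \<in> A \<Longrightarrow> h \<cdot> b s = z s"
      by blast
    have "h \<cdot> e (i, f) = t (i, h \<cdot> (j \<cdot> f))" if p: "(i, f) \<in> probes X" for i f
    proof -
      have f: "arr f (Src I i) X"
        using p by (simp add: probes_iff[OF X_Ob])
      have hjf: "h \<cdot> (j \<cdot> f) = a \<cdot> f"
        using assoc[OF f j(2) h(1)] h(2) by simp
      show ?thesis
      proof (cases "(i, f) \<in> P")
        case True
        then show ?thesis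
          using hjf assoc[OF XD(4)[OF True] j(2) h(1)] h(2) partial_homD(2)[OF a True] by (simp add: e_def)
      next
        case False
        then have "(i, f) \<in> A"
          using p by (simp add: A_def)
        then show ?thesis
          using h(3)[of "(i, f)"] False hjf by (simp add: e_def z_def)
      qed
    qed
    then have "partial_hom Y Q d T t h"
      unfolding hom_iff using h(1) by simp
    then show ?thesis
      using h(2) by blast
  qed
  moreover have "x = y" if x: "partial_hom Y Q d T t x" and y: "partial_hom Y Q d T t y"
    and eq: "x \<cdot> j = y \<cdot> j" for T t x y
  proof (rule un[OF _ _ eq])
    show xa: "arr x Y T" and ya: "arr y Y T"
      using x y by (simp_all add: partial_hom_def)
    fix s assume s: "s \<in> A"
    then obtain i f where if': "s = (i, f)" "(i, f) \<in> probes X" "(i, f) \<notin> P"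
      by (cases s) (auto simp: A_def)
    have "x \<cdot> (j \<cdot> f) = y \<cdot> (j \<cdot> f)"
      using assoc[OF u[OF s] j(2) xa] assoc[OF u[OF s] j(2) ya] eq if' by simp
    then have "x \<cdot> e (i, f) = y \<cdot> e (i, f)"
      using x y if'(2) unfolding hom_iff by simp
    then show "x \<cdot> b s = y \<cdot> b s"
      using if' by (simp add: e_def)
  qed
  moreover have "d (i, j \<cdot> f) = j \<cdot> c (i, f)" if "(i, f) \<in> P" for i f
    using d[OF P_sub[OF that]] that by (simp add: e_def)
  ultimately have "extension_step (X, P, c) (Y, Q, d) j"
    unfolding extension_step_def using j Q by simp
  then show ?thesis
    by blast
qed

text \<open>Each stage answers the probes of the one before, so nothing is left unanswered in the
  colimit. Its universal property is assembled from those of the single steps.\<close>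

lemma universal_hom_exists:
  assumes X: "partial_algebra X P c"
  obtains N n \<psi> where "universal_hom X P c N n \<psi>" and "sequential_composite cell_step X N \<psi>"
proof -
  \<comment> \<open>The clause for \<open>k = 0\<close> puts the starting point into the invariant,
    since dependent choice by itself would only yield some first stage.\<close>
  define good where "good k s \<longleftrightarrow> (case s of (X', P', c') \<Rightarrow> partial_algebra X' P' c') \<and>
      (k = 0 \<longrightarrow> s = (X, P, c))" for k :: nat and s
  have "\<exists>s. \<forall>k. good k (s k) \<and> (\<exists>j. extension_step (s k) (s (Suc k)) j)"
  proof (rule dependent_nat_choice)
    show "\<exists>s. good 0 s"
      using X by (intro exI[of _ "(X, P, c)"]) (simp add: good_def)
    fix s k assume s: "good k s"
    obtain X' P' c' where eq: "s = (X', P', c')"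
      by (cases s)
    have "partial_algebra X' P' c'"
      using s by (simp add: good_def eq)
    then obtain s' j where j: "extension_step s s' j"
      using extension_step_exists unfolding eq by blast
    have "good (Suc k) s'"
      using j unfolding good_def extension_step_def eq by (auto split: prod.splits)
    then show "\<exists>s'. good (Suc k) s' \<and> (\<exists>j. extension_step s s' j)"
      using j by blast
  qed
  then obtain s where s: "\<And>k. good k (s k)" "\<And>k. \<exists>j. extension_step (s k) (s (Suc k)) j"
    by blast
  from s(2) obtain j where j: "\<And>k. extension_step (s k) (s (Suc k)) (j k)"
    by metis
  define Xs where "Xs k = fst (s k)" for k
  define Ps where "Ps k = fst (snd (s k))" for k
  define cs where "cs k = snd (snd (s k))" for k
  have s_eq: "s k = (Xs k, Ps k, cs k)" for k
    by (simp add: Xs_def Ps_def cs_def)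
  have s_0: "Xs 0 = X" "Ps 0 = P" "cs 0 = c"
    using s(1)[of 0] s_eq[of 0] by (simp_all add: good_def)
  have alg: "partial_algebra (Xs k) (Ps k) (cs k)" for k
    using s(1)[of k] s_eq[of k] by (simp add: good_def)
  have ext_step: "extension_step (Xs k, Ps k, cs k) (Xs (Suc k), Ps (Suc k), cs (Suc k)) (j k)" for k
    using j[of k] s_eq[of k] s_eq[of "Suc k"] by simp
  have step: "cell_step (Xs k) (Xs (Suc k)) (j k)" "arr (j k) (Xs k) (Xs (Suc k))"
    and probes_step: "\<And>i f. (i, f) \<in> probes (Xs k) \<Longrightarrow> (i, j k \<cdot> f) \<in> Ps (Suc k)"
    and cs_step: "\<And>i f. (i, f) \<in> Ps k \<Longrightarrow> cs (Suc k) (i, j k \<cdot> f) = j k \<cdot> cs k (i, f)"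
    and hom_ex: "\<And>T t a. (T, t) \<in> Ob (Inj C I) \<Longrightarrow> partial_hom (Xs k) (Ps k) (cs k) T t a \<Longrightarrow>
      \<exists>b. partial_hom (Xs (Suc k)) (Ps (Suc k)) (cs (Suc k)) T t b \<and> b \<cdot> j k = a"
    and hom_eq: "\<And>T t a b. partial_hom (Xs (Suc k)) (Ps (Suc k)) (cs (Suc k)) T t a \<Longrightarrow>
      partial_hom (Xs (Suc k)) (Ps (Suc k)) (cs (Suc k)) T t b \<Longrightarrow> a \<cdot> j k = b \<cdot> j k \<Longrightarrow> a = b"
    for k
    using ext_step[of k] unfolding extension_step_def prod.case by blast+
  have seq: "seq Xs j"
    using step(2) by (simp add: seq_def)
  have Ps_probes: "(i, f) \<in> probes (Xs k)" if "(i, f) \<in> Ps k" for k i f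
    using alg[of k] that unfolding partial_algebra_def by blast
  let ?D = "seq_diagram Xs j"
  have D: "is_functor (order_cat natLeq) C ?D"
    by (rule is_functor_seq_diagram[OF seq])
  have nat: "small \<kappa> (Field natLeq)" "refl_on (Field natLeq) natLeq" "trans natLeq" "Field natLeq \<noteq> {}"
    using small_nat natLeq_Refl natLeq_trans by (simp_all add: Field_natLeq)
  obtain L \<iota> where L: "is_colimit (order_cat natLeq) C ?D L \<iota>"
    using preorder_colimit[OF cocomplete nat(1-3) D] by blast
  have chain_P: "(i, chain Xs j k l \<cdot> f) \<in> Ps l \<and> cs l (i, chain Xs j k l \<cdot> f) = chain Xs j k l \<cdot> cs k (i, f)"
    if "k \<le> l" "(i, f) \<in> Ps k" for k l i f
    using that
  proof (induction l rule: nat_induct_at_least)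
    case base
    then show ?case
      using Id_comp[OF partial_algebraD(3)[OF alg]] Id_comp[OF partial_algebraD(4)[OF alg]] by simp
  next
    case (Suc l)
    note P = Suc.prems
    note ch = chain_arr[OF Suc.hyps seq]
    have f: "chain Xs j k (Suc l) \<cdot> f = j l \<cdot> (chain Xs j k l \<cdot> f)"
      using assoc[OF partial_algebraD(3)[OF alg P] ch step(2)] Suc.hyps by simp
    have cc: "chain Xs j k (Suc l) \<cdot> cs k (i, f) = j l \<cdot> (chain Xs j k l \<cdot> cs k (i, f))"
      using assoc[OF partial_algebraD(4)[OF alg P] ch step(2)] Suc.hyps by simp
    show ?case
      unfolding f cc using Suc.IH[OF P] probes_step[OF Ps_probes] cs_step by simp
  qed
  obtain d where LO: "(L, d) \<in> Ob (Inj C I)"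
    and \<iota>_hom: "\<And>k. partial_hom (Xs k) (Ps k) (cs k) L d (\<iota> k)"
    and to_hom: "\<And>T t h. (T, t) \<in> Ob (Inj C I) \<Longrightarrow> arr h L T \<Longrightarrow>
      (\<And>k. partial_hom (Xs k) (Ps k) (cs k) T t (h \<cdot> \<iota> k)) \<Longrightarrow> h \<in> Hom (Inj C I) (L, d) (T, t)"
  proof (rule directed_colimit_algebra[OF nat _ D L, of Ps cs])
    show "\<exists>z. (x, z) \<in> natLeq \<and> (y, z) \<in> natLeq" for x y
      by (intro exI[of _ "max x y"]) (simp add: natLeq_def)
    show "partial_algebra (Fo ?D k) (Ps k) (cs k)" for k
      using alg by (simp add: seq_diagram_def)
    show "(i, Fm ?D k l () \<cdot> f) \<in> Ps l \<and> cs l (i, Fm ?D k l () \<cdot> f) = Fm ?D k l () \<cdot> cs k (i, f)"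
      if "(k, l) \<in> natLeq" "(i, f) \<in> Ps k" for k l i f
      using chain_P that by (simp add: seq_diagram_def natLeq_def)
    \<comment> \<open>One stage is enough: a probe of stage \<open>k\<close> has its extension at
      stage \<open>Suc k\<close>.\<close>
    show "\<exists>l. (k, l) \<in> natLeq \<and> (i, Fm ?D k l () \<cdot> f) \<in> Ps l" if "(i, f) \<in> probes (Fo ?D k)" for k i f
      using probes_step[of i f k] that chain_step[OF seq, of k]
      by (intro exI[of _ "Suc k"]) (simp add: seq_diagram_def natLeq_def del: chain.simps)
  qed (simp_all add: seq_diagram_def Field_natLeq)
  have \<iota>: "arr (\<iota> k) (Xs k) L" "\<iota> (Suc k) \<cdot> j k = \<iota> k" for k
    using L is_cocone_seq_iff[OF seq, of L \<iota>] by (auto simp: is_colimit_def)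
  have "universal_hom X P c L d (\<iota> 0)"
    unfolding universal_hom_def
  proof (intro conjI allI impI)
    show "(L, d) \<in> Ob (Inj C I)"
      by (rule LO)
    show "partial_hom X P c L d (\<iota> 0)"
      using \<iota>_hom[of 0] s_0 by simp
    fix T t a assume T: "(T, t) \<in> Ob (Inj C I)" and a: "partial_hom X P c T t a"
    \<comment> \<open>The map on stage \<open>Suc k\<close> must restrict to the one already
      selected on stage \<open>k\<close>, so the cone is again built by dependent choice, starting
      from \<open>a\<close>.\<close>
    have "\<exists>b. \<forall>k. (partial_hom (Xs k) (Ps k) (cs k) T t (b k) \<and> (k = 0 \<longrightarrow> b k = a)) \<and>
        b (Suc k) \<cdot> j k = b k"
    proof (rule dependent_nat_choice)
      show "\<exists>x. partial_hom (Xs 0) (Ps 0) (cs 0) T t x \<and> (0 = 0 \<longrightarrow> x = a)"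
        using a s_0 by simp
      show "\<exists>y. (partial_hom (Xs (Suc k)) (Ps (Suc k)) (cs (Suc k)) T t y \<and> (Suc k = 0 \<longrightarrow> y = a)) \<and>
          y \<cdot> j k = x" if "partial_hom (Xs k) (Ps k) (cs k) T t x \<and> (k = 0 \<longrightarrow> x = a)" for x k
        using hom_ex[OF T, of k x] that by simp
    qed
    then obtain b where b: "\<And>k. partial_hom (Xs k) (Ps k) (cs k) T t (b k)" "b 0 = a"
        "\<And>k. b (Suc k) \<cdot> j k = b k"
      by blast
    have "is_cocone (order_cat natLeq) C ?D T b"
      unfolding is_cocone_seq_iff[OF seq] using partial_homD(1)[OF b(1)] b(3) by simp
    then obtain h where h: "arr h L T" "\<And>k. h \<cdot> \<iota> k = b k"
      using is_colimit_factor[OF L] by (metis Ob_order_cat Field_natLeq UNIV_I)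
    have h_hom: "h \<in> Hom (Inj C I) (L, d) (T, t)"
      by (rule to_hom[OF T h(1)]) (simp add: h(2) b(1))
    show "\<exists>!h. h \<in> Hom (Inj C I) (L, d) (T, t) \<and> h \<cdot> \<iota> 0 = a"
    proof (rule ex1I[of _ h])
      show "h \<in> Hom (Inj C I) (L, d) (T, t) \<and> h \<cdot> \<iota> 0 = a"
        using h_hom h(2) b(2) by simp
      fix g assume g: "g \<in> Hom (Inj C I) (L, d) (T, t) \<and> g \<cdot> \<iota> 0 = a"
      then have ga: "arr g L T"
        using Inj_arr[OF LO T] by blast
      \<comment> \<open>\<open>hom_eq\<close> permits cancelling \<open>j k\<close> only between
        partial homomorphisms; therefore both composites are first shown to be such.\<close>
      have "g \<cdot> \<iota> k = h \<cdot> \<iota> k" for k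
      proof (induction k)
        case 0
        show ?case
          using g h(2) b(2) by simp
      next
        case (Suc k)
        show ?case
        proof (rule hom_eq)
          show "partial_hom (Xs (Suc k)) (Ps (Suc k)) (cs (Suc k)) T t (g \<cdot> \<iota> (Suc k))"
            using partial_hom_comp[OF alg LO T \<iota>_hom] g by blast
          show "partial_hom (Xs (Suc k)) (Ps (Suc k)) (cs (Suc k)) T t (h \<cdot> \<iota> (Suc k))"
            using partial_hom_comp[OF alg LO T \<iota>_hom h_hom] .
          show "g \<cdot> \<iota> (Suc k) \<cdot> j k = h \<cdot> \<iota> (Suc k) \<cdot> j k"
            using assoc[OF step(2) \<iota>(1) ga] assoc[OF step(2) \<iota>(1) h(1)] \<iota>(2) Suc by simp
        qed
      qed
      then show "g = h"
        using is_colimit_ext[OF D L ga h(1)] by blast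
    qed
  qed
  moreover have "sequential_composite cell_step X L (\<iota> 0)"
    unfolding sequential_composite_def using s_0 seq step(1) L by blast
  ultimately show thesis
    by (rule that)
qed

text \<open>Free algebras are unique up to isomorphism, and omega-composites are stable under
  isomorphisms of the codomain. An algebra given only by its universal property is thereby known to
  be reached by cells.\<close>

lemma universal_hom_sequential:
  assumes "partial_algebra X P c" and N: "universal_hom X P c N n \<psi>"
  shows "sequential_composite cell_step X N \<psi>"
proof -
  obtain L d \<phi> where L: "universal_hom X P c L d \<phi>" "sequential_composite cell_step X L \<phi>"
    using universal_hom_exists[OF assms(1)] by blast
  obtain h k where "arr h L N" "arr k N L" "h \<cdot> k = Id C N" "k \<cdot> h = Id C L" "h \<cdot> \<phi> = \<psi>"
    using universal_hom_unique[OF L(1) N] by blast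
  then show ?thesis
    using sequential_composite_iso[OF L(2)] by blast
qed

end

section \<open>The forgetful functor\<close>

context monic_cells
begin

lemma Inj_Hom_arr:
  "X \<in> Ob (Inj C I) \<Longrightarrow> Y \<in> Ob (Inj C I) \<Longrightarrow> h \<in> Hom (Inj C I) X Y \<Longrightarrow> arr h (fst X) (fst Y)"
  using Inj_arr[of "fst X" "snd X" "fst Y" "snd Y" h] by simp

lemma Inj_Hom_partial_hom:
  "X \<in> Ob (Inj C I) \<Longrightarrow> Y \<in> Ob (Inj C I) \<Longrightarrow>
    h \<in> Hom (Inj C I) X Y \<longleftrightarrow> partial_hom (fst X) (probes (fst X)) (snd X) (fst Y) (snd Y) h"
  using Inj_Hom_iff[of "fst X" "snd X" "fst Y" "snd Y" h] by simp

text \<open>The colimit \<open>L\<close> formed in \<open>C\<close> carries an algebra structure for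
  which its legs are homomorphisms, and maps out of it are homomorphisms as soon as they are so on
  the legs. Comparing it with the given colimit \<open>N\<close> in both directions shows
  \<open>V\<close> to preserve \<open>N\<close>. \<open>D'\<close> is the composite of
  \<open>D\<close> with \<open>V\<close>, fixed only where it matters.\<close>

lemma forget_directed_colimit:
  fixes r :: "'a rel"
  assumes small: "small \<kappa> (Field r)" and refl: "refl_on (Field r) r" and trans: "trans r"
    and ne: "Field r \<noteq> {}"
    and dir: "\<And>x y. x \<in> Field r \<Longrightarrow> y \<in> Field r \<Longrightarrow> \<exists>z. (x, z) \<in> r \<and> (y, z) \<in> r"
    and D: "is_functor (order_cat r) (Inj C I) D"
    and N: "is_colimit (order_cat r) (Inj C I) D N \<iota>"
    and Fo: "\<And>x. x \<in> Field r \<Longrightarrow> Fo D' x = fst (Fo D x)"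
    and Fm: "\<And>x y. (x, y) \<in> r \<Longrightarrow> Fm D' x y () = Fm D x y ()"
  shows "is_functor (order_cat r) C D'" and "is_colimit (order_cat r) C D' (fst N) \<iota>"
proof -
  interpret J: category "Inj C I"
    by (rule category_Inj[OF category_axioms family])
  have F: "x \<in> Field r" "y \<in> Field r" if "(x, y) \<in> r" for x y
    using that by (auto intro: FieldI1 FieldI2)
  have DO: "Fo D x \<in> Ob (Inj C I)" if "x \<in> Field r" for x
    using D that by (simp add: is_functor_order_iff)
  have DH: "Fm D x y () \<in> Hom (Inj C I) (Fo D x) (Fo D y)" if "(x, y) \<in> r" for x y
    using D that by (simp add: is_functor_order_iff)
  have NO: "N \<in> Ob (Inj C I)" and \<iota>H: "\<And>x. x \<in> Field r \<Longrightarrow> \<iota> x \<in> Hom (Inj C I) (Fo D x) N"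
    and \<iota>_comp: "\<And>x y. (x, y) \<in> r \<Longrightarrow> \<iota> y \<cdot> Fm D x y () = \<iota> x"
    using N by (simp_all add: is_colimit_order_iff is_cocone_order_iff Inj_Comp)
  show D': "is_functor (order_cat r) C D'"
    unfolding is_functor_order_iff
  proof (intro conjI ballI allI impI)
    show "Fo D' x \<in> Ob C" if "x \<in> Field r" for x
      using InjD(1)[of "fst (Fo D x)" "snd (Fo D x)"] DO[OF that] Fo[OF that] by simp
    show "Fm D' x y () \<in> Hom C (Fo D' x) (Fo D' y)" if "(x, y) \<in> r" for x y
      using Inj_Hom_arr[OF DO DO DH[OF that]] F[OF that] Fo Fm[OF that] by (simp add: arr_def)
    show "Fm D' x x () = Id C (Fo D' x)" if x: "x \<in> Field r" for x
    proof -
      have "(x, x) \<in> r"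
        using refl x by (simp add: refl_on_def)
      moreover have "Fm D x x () = Id (Inj C I) (Fo D x)"
        using D x by (simp add: is_functor_order_iff)
      ultimately show ?thesis
        using Fm Fo[OF x] by (simp add: Inj_def split_beta)
    qed
    show "Fm D' x z () = Fm D' y z () \<cdot> Fm D' x y ()" if "(x, y) \<in> r" "(y, z) \<in> r" for x y z
      using D that Fm transD[OF trans that] by (simp add: is_functor_order_iff Inj_Comp)
  qed
  obtain L \<rho> where L: "is_colimit (order_cat r) C D' L \<rho>"
    using preorder_colimit[OF cocomplete small refl trans D'] by blast
  have \<rho>_comp: "\<rho> y \<cdot> Fm D x y () = \<rho> x" if "(x, y) \<in> r" for x y
    using L that Fm[OF that] unfolding is_colimit_order_iff is_cocone_order_iff by metis
  have \<rho>: "arr (\<rho> x) (fst (Fo D x)) L" if "x \<in> Field r" for x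
    using is_cocone_arr[OF D', of L \<rho> x] L that Fo[OF that] by (simp add: is_colimit_def)
  obtain d where LO: "(L, d) \<in> Ob (Inj C I)"
    and \<rho>_hom: "\<And>x. x \<in> Field r \<Longrightarrow>
      partial_hom (Fo D' x) (probes (fst (Fo D x))) (snd (Fo D x)) L d (\<rho> x)"
    and to_hom: "\<And>T t h. (T, t) \<in> Ob (Inj C I) \<Longrightarrow> arr h L T \<Longrightarrow>
      (\<And>x. x \<in> Field r \<Longrightarrow>
        partial_hom (Fo D' x) (probes (fst (Fo D x))) (snd (Fo D x)) T t (h \<cdot> \<rho> x)) \<Longrightarrow>
      h \<in> Hom (Inj C I) (L, d) (T, t)"
  proof (rule directed_colimit_algebra[OF small refl trans ne _ D' L,
        of "\<lambda>x. probes (fst (Fo D x))" "\<lambda>x. snd (Fo D x)"])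
    show "\<exists>z. (x, z) \<in> r \<and> (y, z) \<in> r" if "x \<in> Field r" "y \<in> Field r" for x y
      by (rule dir[OF that])
    show "partial_algebra (Fo D' x) (probes (fst (Fo D x))) (snd (Fo D x))" if "x \<in> Field r" for x
      using InjD(2)[of "fst (Fo D x)" "snd (Fo D x)"] DO[OF that] Fo[OF that] by simp
    show "(i, Fm D' x y () \<cdot> f) \<in> probes (fst (Fo D y)) \<and>
        snd (Fo D y) (i, Fm D' x y () \<cdot> f) = Fm D' x y () \<cdot> snd (Fo D x) (i, f)"
      if xy: "(x, y) \<in> r" and f: "(i, f) \<in> probes (fst (Fo D x))" for x y i f
    proof -
      have "partial_hom (fst (Fo D x)) (probes (fst (Fo D x))) (snd (Fo D x))
          (fst (Fo D y)) (snd (Fo D y)) (Fm D x y ())"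
        using DH[OF xy] Inj_Hom_partial_hom[OF DO DO] F[OF xy] by simp
      note h = partial_homD(1)[OF this] partial_homD(2)[OF this f]
      have "(i, Fm D x y () \<cdot> f) \<in> probes (fst (Fo D y))"
        using arr_comp[OF _ h(1)] f by (simp add: probes_iff[OF arrD(1)[OF h(1)]] probes_iff[OF arrD(2)[OF h(1)]])
      then show ?thesis
        using h(2) Fm[OF xy] by simp
    qed
    show "\<exists>y. (x, y) \<in> r \<and> (i, Fm D' x y () \<cdot> f) \<in> probes (fst (Fo D y))"
      if x: "(i, f) \<in> probes (Fo D' x)" "x \<in> Field r" for x i f
    proof -
      have xx: "(x, x) \<in> r"
        using refl x by (simp add: refl_on_def)
      have ob: "fst (Fo D x) \<in> Ob C"
        using InjD(1)[of "fst (Fo D x)" "snd (Fo D x)"] DO[OF x(2)] by simp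
      have "(i, f) \<in> probes (fst (Fo D x))"
        using x Fo by simp
      moreover have "Fm D' x x () = Id C (fst (Fo D x))"
        using D' x Fo by (simp add: is_functor_order_iff)
      ultimately have "(i, Fm D' x x () \<cdot> f) \<in> probes (fst (Fo D x))"
        using Id_comp[of f "Src I i" "fst (Fo D x)"] by (simp add: probes_iff[OF ob])
      then show ?thesis
        using xx by blast
    qed
    fix d assume d: "(L, d) \<in> Ob (Inj C I)"
      "\<And>x. x \<in> Field r \<Longrightarrow>
        partial_hom (Fo D' x) (probes (fst (Fo D x))) (snd (Fo D x)) L d (\<rho> x)"
      "\<And>T t h. (T, t) \<in> Ob (Inj C I) \<Longrightarrow> arr h L T \<Longrightarrow>
        (\<And>x. x \<in> Field r \<Longrightarrow>
          partial_hom (Fo D' x) (probes (fst (Fo D x))) (snd (Fo D x)) T t (h \<cdot> \<rho> x)) \<Longrightarrow>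
        h \<in> Hom (Inj C I) (L, d) (T, t)"
    show thesis
      by (rule that[OF d])
  qed
  have \<rho>H: "\<rho> x \<in> Hom (Inj C I) (Fo D x) (L, d)" if "x \<in> Field r" for x
    using \<rho>_hom[OF that] Inj_Hom_partial_hom[OF DO[OF that] LO] Fo[OF that] by simp
  have "is_cocone (order_cat r) C D' (fst N) \<iota>"
    unfolding is_cocone_order_iff
    using InjD(1)[of "fst N" "snd N"] NO Inj_Hom_arr[OF DO NO \<iota>H] Fo Fm \<iota>_comp
    by (simp add: arr_def)
  then obtain h where h: "arr h L (fst N)" "\<And>x. x \<in> Field r \<Longrightarrow> h \<cdot> \<rho> x = \<iota> x"
    using is_colimit_factor[OF L] by (metis Ob_order_cat)
  have "h \<in> Hom (Inj C I) (L, d) (fst N, snd N)"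
  proof (rule to_hom[OF _ h(1)])
    show "(fst N, snd N) \<in> Ob (Inj C I)"
      using NO by simp
    show "partial_hom (Fo D' x) (probes (fst (Fo D x))) (snd (Fo D x)) (fst N) (snd N) (h \<cdot> \<rho> x)"
      if "x \<in> Field r" for x
      using \<iota>H[OF that] Inj_Hom_partial_hom[OF DO[OF that] NO] Fo[OF that] h(2)[OF that] by simp
  qed
  then have hH: "h \<in> Hom (Inj C I) (L, d) N"
    by simp
  have "is_cocone (order_cat r) (Inj C I) D (L, d) \<rho>"
    unfolding is_cocone_order_iff using LO \<rho>H \<rho>_comp by (simp add: Inj_Comp)
  then obtain k where k: "J.arr k N (L, d)" "\<And>x. x \<in> Field r \<Longrightarrow> k \<cdot> \<iota> x = \<rho> x"
    using J.is_colimit_factor[OF N] by (metis Ob_order_cat Inj_Comp)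
  have ka: "arr k (fst N) L"
    using Inj_Hom_arr[OF NO LO J.arrD(3)[OF k(1)]] by simp
  \<comment> \<open>Each composite is tested by its own colimit: \<open>k \<cdot> h\<close> on the
    legs of \<open>L\<close> in \<open>C\<close>, and \<open>h \<cdot> k\<close> below on the legs
    of \<open>N\<close> in \<open>Inj C I\<close>.\<close>
  have kh: "k \<cdot> h = Id C L"
  proof (rule is_colimit_ext[OF D' L arr_comp[OF h(1) ka] arr_Id[OF InjD(1)[OF LO]]])
    fix x assume "x \<in> Ob (order_cat r)"
    then have x: "x \<in> Field r"
      by simp
    show "k \<cdot> h \<cdot> \<rho> x = Id C L \<cdot> \<rho> x"
      using assoc[OF \<rho>[OF x] h(1) ka] h(2)[OF x] k(2)[OF x] Id_comp[OF \<rho>[OF x]] by simp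
  qed
  have hk: "h \<cdot> k = Id C (fst N)"
  proof -
    have "h \<cdot>\<^bsub>Inj C I\<^esub> k = Id (Inj C I) N"
    proof (rule J.is_colimit_ext[OF D N])
      show "J.arr (h \<cdot>\<^bsub>Inj C I\<^esub> k) N N" "J.arr (Id (Inj C I) N) N N"
        using J.arr_comp[OF k(1), of h N] J.arr_Id[OF NO] hH LO NO by (simp_all add: J.arr_def)
      fix x assume "x \<in> Ob (order_cat r)"
      then have x: "x \<in> Field r"
        by simp
      have \<iota>a: "J.arr (\<iota> x) (Fo D x) N"
        using \<iota>H[OF x] DO[OF x] NO by (simp add: J.arr_def)
      have "h \<cdot> k \<cdot> \<iota> x = \<iota> x"
        using assoc[OF Inj_Hom_arr[OF DO[OF x] NO \<iota>H[OF x]] ka h(1)] h(2)[OF x] k(2)[OF x] by simp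
      then show "h \<cdot>\<^bsub>Inj C I\<^esub> k \<cdot>\<^bsub>Inj C I\<^esub> \<iota> x = Id (Inj C I) N \<cdot>\<^bsub>Inj C I\<^esub> \<iota> x"
        using J.Id_comp[OF \<iota>a] by (simp add: Inj_Comp)
    qed
    then show ?thesis
      by (simp add: Inj_def split_beta)
  qed
  have "is_colimit (order_cat r) C D' (fst N) (\<lambda>x. h \<cdot> \<rho> x)"
    by (rule is_colimit_iso[OF D' L h(1) ka hk kh])
  then show "is_colimit (order_cat r) C D' (fst N) \<iota>"
    using is_colimit_cong[of "order_cat r" "\<lambda>x. h \<cdot> \<rho> x" \<iota> C D' "fst N"] h(2) by simp
qed

text \<open>All colimits occurring in a transfinite composite, at the limit stages and at the end,
  run over nonempty chains, and those are preserved by \<open>V\<close>.\<close>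

lemma forget_transfinite_composite:
  assumes tc: "transfinite_composite \<kappa> (Inj C I) S M N h"
    and S: "\<And>X Y g. S X Y g \<Longrightarrow> S' (fst X) (fst Y) g"
  shows "transfinite_composite \<kappa> C S' (fst M) (fst N) h"
proof -
  obtain r :: "'k rel" and D m \<iota> where r: "Well_order r" and small: "small \<kappa> (Field r)"
    and m: "is_bottom r m" and D: "is_functor (order_cat r) (Inj C I) D"
    and succ: "\<And>x y. is_successor r x y \<Longrightarrow> S (Fo D x) (Fo D y) (Fm D x y ())"
    and lim: "\<And>y. is_limit r y \<Longrightarrow>
      is_colimit (order_cat (Restr r (underS r y))) (Inj C I) D (Fo D y) (\<lambda>x. Fm D x y ())"
    and colim: "is_colimit (order_cat r) (Inj C I) D N \<iota>" and M: "M = Fo D m" and h: "h = \<iota> m"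
    using tc unfolding transfinite_composite_def by blast
  define D' :: "('k, unit, 'o, 'm) fctr" where "D' = \<lparr>Fo = (\<lambda>x. fst (Fo D x)), Fm = Fm D\<rparr>"
  have D'_simps: "Fo D' x = fst (Fo D x)" "Fm D' = Fm D" for x
    by (simp_all add: D'_def)
  have directed: "refl_on (Field s) s" "trans s"
      "x \<in> Field s \<Longrightarrow> y \<in> Field s \<Longrightarrow> \<exists>z. (x, z) \<in> s \<and> (y, z) \<in> s"
    if s: "Well_order s" for s :: "'k rel" and x y
  proof -
    show refl: "refl_on (Field s) s" and "trans s"
      using s by (simp_all add: order_on_defs)
    show "\<exists>z. (x, z) \<in> s \<and> (y, z) \<in> s" if "x \<in> Field s" "y \<in> Field s"
      using s that refl unfolding order_on_defs total_on_def refl_on_def by metis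
  qed
  have ne: "Field r \<noteq> {}"
    using m by (auto simp: is_bottom_def)
  note forget_D = forget_directed_colimit[OF small directed(1,2)[OF r] ne directed(3)[OF r] D colim
      D'_simps(1)]
  have functor': "is_functor (order_cat r) C D'"
    by (rule forget_D(1)) (simp_all add: D'_simps)
  have colim': "is_colimit (order_cat r) C D' (fst N) \<iota>"
    by (rule forget_D(2)) (simp_all add: D'_simps)
  have lim': "is_colimit (order_cat (Restr r (underS r y))) C D' (Fo D' y) (\<lambda>x. Fm D' x y ())"
    if y: "is_limit r y" for y
  proof -
    let ?s = "Restr r (underS r y)"
    have wo: "Well_order ?s"
      using r Well_order_Restr by blast
    have F: "Field ?s \<subseteq> Field r"
      by (auto simp: Field_def)
    \<comment> \<open>Nonemptiness of the segment has to be checked, as \<open>V\<close> need not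
      preserve an initial object; a limit differs from the bottom \<open>m\<close>, so
      \<open>m\<close> lies below it.\<close>
    have "m \<noteq> y" "(m, y) \<in> r" "m \<in> Field r"
      using y m by (auto simp: is_limit_def is_bottom_def)
    then have "(m, m) \<in> ?s"
      using directed(1)[OF r] by (auto simp: refl_on_def underS_def)
    then have ne: "Field ?s \<noteq> {}"
      by (auto simp: Field_def)
    have D_s: "is_functor (order_cat ?s) (Inj C I) D"
      using D F unfolding is_functor_order_iff by blast
    show ?thesis
      unfolding D'_simps
      by (rule forget_directed_colimit(2)[OF small_mono[OF F small] directed(1,2)[OF wo] ne
            directed(3)[OF wo] D_s lim[OF y]]) (simp_all add: D'_simps)
  qed
  have "transfinite_composite \<kappa> C S' (Fo D' m) (fst N) (\<iota> m)"
  proof (rule transfinite_compositeI[OF r small m functor' _ lim' colim'])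
    show "S' (Fo D' x) (Fo D' y) (Fm D' x y ())" if "is_successor r x y" for x y
      using S[OF succ[OF that]] by (simp add: D'_simps)
  qed
  then show ?thesis
    using M h by (simp add: D'_simps)
qed

end

section \<open>Free algebras\<close>

locale free_algebras = monic_cells \<kappa> C I
  for \<kappa> :: "'k rel" and C :: "('o, 'm) cat" (structure) and I :: "('i, 'o, 'm) family" +
  fixes F :: "('o, 'm, 'o \<times> ('i \<times> 'm \<Rightarrow> 'm), 'm) fctr" and \<eta> :: "'o \<Rightarrow> 'm"
  assumes adjunction: "left_adjoint_with_unit C (Inj C I) forget F \<eta>"
begin

lemma F_Ob: "X \<in> Ob C \<Longrightarrow> Fo F X \<in> Ob (Inj C I)"
  using adjunction by (simp add: left_adjoint_with_unit_def is_functor_def)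

lemma F_Hom: "arr f X Y \<Longrightarrow> Fm F X Y f \<in> Hom (Inj C I) (Fo F X) (Fo F Y)"
  using adjunction by (simp add: left_adjoint_with_unit_def is_functor_def arr_def)

lemma F_arr: "arr f X Y \<Longrightarrow> arr (Fm F X Y f) (fst (Fo F X)) (fst (Fo F Y))"
  by (rule Inj_Hom_arr[OF F_Ob F_Ob F_Hom]) (auto dest: arrD)

lemma unit_arr: "X \<in> Ob C \<Longrightarrow> arr (\<eta> X) X (fst (Fo F X))"
  using adjunction InjD(1)[of "fst (Fo F X)" "snd (Fo F X)"] F_Ob[of X]
  by (simp add: left_adjoint_with_unit_def forget_def arr_def)

lemma unit_natural: "arr f X Y \<Longrightarrow> Fm F X Y f \<cdot> \<eta> X = \<eta> Y \<cdot> f"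
  using adjunction by (simp add: left_adjoint_with_unit_def forget_def arr_def)

lemma unit_bij:
  "X \<in> Ob C \<Longrightarrow> Z \<in> Ob (Inj C I) \<Longrightarrow>
    bij_betw (\<lambda>g. g \<cdot> \<eta> X) (Hom (Inj C I) (Fo F X) Z) (Hom C X (fst Z))"
  using adjunction by (simp add: left_adjoint_with_unit_def forget_def)

lemma unit_factor:
  assumes "arr f X (fst Z)" and "Z \<in> Ob (Inj C I)"
  obtains g where "g \<in> Hom (Inj C I) (Fo F X) Z" and "g \<cdot> \<eta> X = f"
proof -
  have "f \<in> (\<lambda>g. g \<cdot> \<eta> X) ` Hom (Inj C I) (Fo F X) Z"
    using bij_betw_imp_surj_on[OF unit_bij[OF arrD(1)[OF assms(1)] assms(2)]] arrD(3)[OF assms(1)]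
    by simp
  then show thesis
    using that by blast
qed

lemma unit_eq:
  assumes "X \<in> Ob C" and "Z \<in> Ob (Inj C I)"
    and "g \<in> Hom (Inj C I) (Fo F X) Z" and "g' \<in> Hom (Inj C I) (Fo F X) Z" and "g \<cdot> \<eta> X = g' \<cdot> \<eta> X"
  shows "g = g'"
  using inj_onD[OF bij_betw_imp_inj_on[OF unit_bij[OF assms(1,2)]] assms(5,3,4)] .

text \<open>With no probes chosen, a partial homomorphism is any morphism, and the bijection of the
  adjunction is the required universal property; \<open>c\<close> is never evaluated.\<close>

lemma unit_universal_hom:
  assumes X: "X \<in> Ob C"
  shows "universal_hom X {} c (fst (Fo F X)) (snd (Fo F X)) (\<eta> X)"
  unfolding universal_hom_def
proof (intro conjI allI impI)
  show "(fst (Fo F X), snd (Fo F X)) \<in> Ob (Inj C I)"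
    using F_Ob[OF X] by simp
  show "partial_hom X {} c (fst (Fo F X)) (snd (Fo F X)) (\<eta> X)"
    using unit_arr[OF X] by (simp add: partial_hom_def)
  fix T t a assume T: "(T, t) \<in> Ob (Inj C I)" and "partial_hom X {} c T t a"
  then have "arr a X (fst (T, t))"
    by (simp add: partial_hom_def)
  then obtain g where g: "g \<in> Hom (Inj C I) (Fo F X) (T, t)" "g \<cdot> \<eta> X = a"
    using unit_factor T by blast
  show "\<exists>!h. h \<in> Hom (Inj C I) (fst (Fo F X), snd (Fo F X)) (T, t) \<and> h \<cdot> \<eta> X = a"
  proof (rule ex1I[of _ g])
    show "g \<in> Hom (Inj C I) (fst (Fo F X), snd (Fo F X)) (T, t) \<and> g \<cdot> \<eta> X = a"
      using g by simp
    show "h = g" if "h \<in> Hom (Inj C I) (fst (Fo F X), snd (Fo F X)) (T, t) \<and> h \<cdot> \<eta> X = a" for h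
      using unit_eq[OF X T, of h g] that g by simp
  qed
qed

lemma unit_cellular: "X \<in> Ob C \<Longrightarrow> cellular \<kappa> C I X (fst (Fo F X)) (\<eta> X)"
  using universal_hom_sequential[OF _ unit_universal_hom[of X undefined]] unit_arr
  by (intro sequential_composite_cellular) (simp_all add: partial_algebra_def)

lemma faithful_F: "faithful C F"
  unfolding faithful_def
proof (intro ballI inj_onI)
  fix X Y f g assume XY: "X \<in> Ob C" "Y \<in> Ob C" and fg: "f \<in> Hom C X Y" "g \<in> Hom C X Y"
    and eq: "Fm F X Y f = Fm F X Y g"
  have "arr f X Y" "arr g X Y"
    using XY fg by (simp_all add: arr_def)
  then have "\<eta> Y \<cdot> f = \<eta> Y \<cdot> g"
    using unit_natural eq by metis
  moreover have "is_mono C Y (fst (Fo F Y)) (\<eta> Y)"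
    using cellular_mono[OF unit_cellular[OF XY(2)]] .
  ultimately show "f = g"
    using XY fg unfolding is_mono_def by blast
qed

section \<open>Pushouts of free maps, seen in the base category\<close>

text \<open>By pushout, coproduct and adjunction, a morphism from \<open>N\<close> to an algebra
  \<open>Z\<close> amounts to a homomorphism from \<open>M\<close> to \<open>Z\<close> together with
  a filler in \<open>V Z\<close> for every cell. A partial homomorphism out of the pushout
  \<open>Y\<close> formed in \<open>C\<close> consists of the same data, so \<open>N\<close> is free
  on \<open>Y\<close>.\<close>

lemma forget_pushout:
  assumes "pushout_of_coproduct \<kappa> (Inj C I) (image_family F I) M N f"
  shows "sequential_composite cell_step (fst M) (fst N) f"
proof -
  obtain P Q g u v where "coproduct_of_members \<kappa> (Inj C I) (image_family F I) P Q g"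
    and push: "is_pushout (Inj C I) P Q M N g u f v"
    using assms unfolding pushout_of_coproduct_def by blast
  then obtain A :: "'k set" and a \<iota> \<iota>' where small: "small \<kappa> A" and aI: "a ` A \<subseteq> Index I"
    and cP: "is_coproduct (Inj C I) A (\<lambda>s. Fo F (Src I (a s))) P \<iota>"
    and cQ: "is_coproduct (Inj C I) A (\<lambda>s. Fo F (Tgt I (a s))) Q \<iota>'"
    and g_comp: "\<And>s. s \<in> A \<Longrightarrow> g \<cdot> \<iota> s = \<iota>' s \<cdot> Fm F (Src I (a s)) (Tgt I (a s)) (Map I (a s))"
    unfolding coproduct_of_members_def image_family_def by (auto simp: Inj_Comp)
  have O: "P \<in> Ob (Inj C I)" "Q \<in> Ob (Inj C I)" "M \<in> Ob (Inj C I)" "N \<in> Ob (Inj C I)"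
    and H: "g \<in> Hom (Inj C I) P Q" "u \<in> Hom (Inj C I) P M" "f \<in> Hom (Inj C I) M N" "v \<in> Hom (Inj C I) Q N"
    and square: "f \<cdot> u = v \<cdot> g"
    and push_univ: "\<And>T x y. T \<in> Ob (Inj C I) \<Longrightarrow> x \<in> Hom (Inj C I) M T \<Longrightarrow> y \<in> Hom (Inj C I) Q T \<Longrightarrow>
      x \<cdot> u = y \<cdot> g \<Longrightarrow> \<exists>!h. h \<in> Hom (Inj C I) N T \<and> h \<cdot> f = x \<and> h \<cdot> v = y"
    using push by (simp_all add: is_pushout_def Inj_Comp)
  note ga = Inj_Hom_arr[OF O(1,2) H(1)] and ua = Inj_Hom_arr[OF O(1,3) H(2)]
    and fa = Inj_Hom_arr[OF O(3,4) H(3)] and va = Inj_Hom_arr[OF O(2,4) H(4)]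
  define S where "S s = Src I (a s)" for s
  define T where "T s = Tgt I (a s)" for s
  define \<alpha> where "\<alpha> s = Map I (a s)" for s
  have \<alpha>: "arr (\<alpha> s) (S s) (T s)" if "s \<in> A" for s
    using Map_arr[of "a s"] aI that by (auto simp: S_def T_def \<alpha>_def)
  have SO: "S s \<in> Ob C" and TO: "T s \<in> Ob C" if "s \<in> A" for s
    using \<alpha>[OF that] by (auto dest: arrD)
  have \<iota>H: "\<iota> s \<in> Hom (Inj C I) (Fo F (S s)) P" and \<iota>'H: "\<iota>' s \<in> Hom (Inj C I) (Fo F (T s)) Q"
    if "s \<in> A" for s
    using cP cQ that by (simp_all add: is_coproduct_def S_def T_def)
  note \<iota>a = Inj_Hom_arr[OF F_Ob[OF SO] O(1) \<iota>H] and \<iota>'a = Inj_Hom_arr[OF F_Ob[OF TO] O(2) \<iota>'H]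
  have cP_univ: "\<exists>!h. h \<in> Hom (Inj C I) P Z \<and> (\<forall>s\<in>A. h \<cdot> \<iota> s = \<tau> s)"
    if "Z \<in> Ob (Inj C I)" "\<And>s. s \<in> A \<Longrightarrow> \<tau> s \<in> Hom (Inj C I) (Fo F (S s)) Z" for Z \<tau>
    using cP that by (simp add: is_coproduct_def S_def Inj_Comp)
  have cQ_univ: "\<exists>!h. h \<in> Hom (Inj C I) Q Z \<and> (\<forall>s\<in>A. h \<cdot> \<iota>' s = \<tau> s)"
    if "Z \<in> Ob (Inj C I)" "\<And>s. s \<in> A \<Longrightarrow> \<tau> s \<in> Hom (Inj C I) (Fo F (T s)) Z" for Z \<tau>
    using cQ that by (simp add: is_coproduct_def T_def Inj_Comp)
  have g_comp: "g \<cdot> \<iota> s = \<iota>' s \<cdot> Fm F (S s) (T s) (\<alpha> s)" if "s \<in> A" for s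
    using g_comp[OF that] by (simp add: S_def T_def \<alpha>_def)
  \<comment> \<open>Naturality of the unit exchanges \<open>F \<alpha>\<close> for
    \<open>\<alpha>\<close>, which translates the condition defining \<open>g\<close> on free
    summands into one on morphisms of \<open>C\<close>.\<close>
  have transpose: "y \<cdot> g \<cdot> \<iota> s \<cdot> \<eta> (S s) = y \<cdot> \<iota>' s \<cdot> \<eta> (T s) \<cdot> \<alpha> s"
    if s: "s \<in> A" and y: "arr y (fst Q) Z" for s y Z
  proof -
    note F\<alpha> = F_arr[OF \<alpha>[OF s]] and \<eta>S = unit_arr[OF SO[OF s]] and \<eta>T = unit_arr[OF TO[OF s]]
    have "y \<cdot> g \<cdot> \<iota> s = y \<cdot> \<iota>' s \<cdot> Fm F (S s) (T s) (\<alpha> s)"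
      using assoc[OF \<iota>a[OF s s] ga y] assoc[OF F\<alpha> \<iota>'a[OF s s] y] g_comp[OF s] by simp
    then have "y \<cdot> g \<cdot> \<iota> s \<cdot> \<eta> (S s) = y \<cdot> \<iota>' s \<cdot> (Fm F (S s) (T s) (\<alpha> s) \<cdot> \<eta> (S s))"
      using assoc[OF \<eta>S F\<alpha> arr_comp[OF \<iota>'a[OF s s] y]] by simp
    also have "\<dots> = y \<cdot> \<iota>' s \<cdot> \<eta> (T s) \<cdot> \<alpha> s"
      using unit_natural[OF \<alpha>[OF s]] assoc[OF \<alpha>[OF s] \<eta>T arr_comp[OF \<iota>'a[OF s s] y]] by simp
    finally show ?thesis .
  qed
  \<comment> \<open>Adjoint transposes: \<open>w s\<close> is the map along which cell
    \<open>s\<close> is attached to \<open>V M\<close>, and \<open>z s\<close> is the filler that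
    \<open>N\<close> provides.\<close>
  define w where "w s = u \<cdot> \<iota> s \<cdot> \<eta> (S s)" for s
  define z where "z s = v \<cdot> \<iota>' s \<cdot> \<eta> (T s)" for s
  have w: "arr (w s) (S s) (fst M)" and z: "arr (z s) (T s) (fst N)" if s: "s \<in> A" for s
    using arr_comp[OF unit_arr[OF SO[OF s]] arr_comp[OF \<iota>a[OF s s] ua]]
      arr_comp[OF unit_arr[OF TO[OF s]] arr_comp[OF \<iota>'a[OF s s] va]] by (simp_all add: w_def z_def)
  have w_comp: "x \<cdot> w s = x \<cdot> u \<cdot> \<iota> s \<cdot> \<eta> (S s)" if s: "s \<in> A" and x: "arr x (fst M) Z" for s x Z
    using assoc[OF unit_arr[OF SO[OF s]] arr_comp[OF \<iota>a[OF s s] ua] x] assoc[OF \<iota>a[OF s s] ua x]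
    by (simp add: w_def)
  have z_comp: "x \<cdot> z s = x \<cdot> v \<cdot> \<iota>' s \<cdot> \<eta> (T s)" if s: "s \<in> A" and x: "arr x (fst N) Z" for s x Z
    using assoc[OF unit_arr[OF TO[OF s]] arr_comp[OF \<iota>'a[OF s s] va] x] assoc[OF \<iota>'a[OF s s] va x]
    by (simp add: z_def)
  have MO: "fst M \<in> Ob C"
    using fa by (rule arrD)
  have aI': "a s \<in> Index I" if "s \<in> A" for s
    using aI that by blast
  obtain Y j b where j: "cell_step (fst M) Y j" "arr j (fst M) Y"
    and b: "\<And>s. s \<in> A \<Longrightarrow> arr (b s) (T s) Y" "\<And>s. s \<in> A \<Longrightarrow> b s \<cdot> \<alpha> s = j \<cdot> w s"
    and b_ex: "\<And>Z x c. arr x (fst M) Z \<Longrightarrow> (\<And>s. s \<in> A \<Longrightarrow> arr (c s) (T s) Z) \<Longrightarrow>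
      (\<And>s. s \<in> A \<Longrightarrow> c s \<cdot> \<alpha> s = x \<cdot> w s) \<Longrightarrow>
      \<exists>h. arr h Y Z \<and> h \<cdot> j = x \<and> (\<forall>s\<in>A. h \<cdot> b s = c s)"
    and b_eq: "\<And>Z h k. arr h Y Z \<Longrightarrow> arr k Y Z \<Longrightarrow> h \<cdot> j = k \<cdot> j \<Longrightarrow>
      (\<And>s. s \<in> A \<Longrightarrow> h \<cdot> b s = k \<cdot> b s) \<Longrightarrow> h = k"
    by (rule attach_cells[OF family MO small aI' w[unfolded S_def], folded T_def \<alpha>_def]) blast+
  have M_alg: "partial_algebra (fst M) (probes (fst M)) (snd M)"
    using InjD(2)[of "fst M" "snd M"] O(3) by simp
  note MD = partial_algebraD[OF M_alg]
  have c: "arr (j \<cdot> snd M (i, k)) (Tgt I i) Y" "j \<cdot> snd M (i, k) \<cdot> Map I i = j \<cdot> k"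
    if "(i, k) \<in> probes (fst M)" for i k
    using arr_comp[OF MD(4)[OF that] j(2)] assoc[OF Map_arr[OF MD(2)[OF that]] MD(4)[OF that] j(2)]
      MD(5)[OF that] by simp_all
  obtain R d where R: "partial_algebra Y R d"
    and R_iff: "\<And>Z t x. partial_hom Y R d Z t x \<longleftrightarrow> arr x Y Z \<and>
      (\<forall>i k. (i, k) \<in> probes (fst M) \<longrightarrow> x \<cdot> (j \<cdot> snd M (i, k)) = t (i, x \<cdot> (j \<cdot> k)))"
    by (rule image_partial_algebra[OF j, of "\<lambda>p. j \<cdot> snd M p"]) (use c in blast)+
  \<comment> \<open>All retained probes factor through \<open>j\<close>, so compatibility on
    \<open>Y\<close> is a condition on the restriction to \<open>M\<close> alone and says that it is
    a homomorphism.\<close>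
  have hom_iff: "partial_hom Y R d (fst Z) (snd Z) x \<longleftrightarrow>
      arr x Y (fst Z) \<and> x \<cdot> j \<in> Hom (Inj C I) M Z" if Z: "Z \<in> Ob (Inj C I)" for Z x
  proof (cases "arr x Y (fst Z)")
    case True
    have "x \<cdot> (j \<cdot> snd M (i, k)) = x \<cdot> j \<cdot> snd M (i, k)" "x \<cdot> (j \<cdot> k) = x \<cdot> j \<cdot> k"
      if "(i, k) \<in> probes (fst M)" for i k
      using assoc[OF MD(4)[OF that] j(2) True] assoc[OF MD(3)[OF that] j(2) True] by simp_all
    then show ?thesis
      unfolding R_iff Inj_Hom_partial_hom[OF O(3) Z]
      using True arr_comp[OF j(2) True] by (simp add: partial_hom_def)
  next
    case False
    then show ?thesis
      by (simp add: R_iff)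
  qed
  have "z s \<cdot> \<alpha> s = f \<cdot> w s" if s: "s \<in> A" for s
    using transpose[OF s va] w_comp[OF s fa] square by (simp add: z_def)
  then obtain x where x: "arr x Y (fst N)" "x \<cdot> j = f" "\<And>s. s \<in> A \<Longrightarrow> x \<cdot> b s = z s"
    using b_ex[OF fa, of z] z by blast
  have "universal_hom Y R d (fst N) (snd N) x"
    unfolding universal_hom_def
  proof (intro conjI allI impI)
    show "(fst N, snd N) \<in> Ob (Inj C I)"
      using O by simp
    show "partial_hom Y R d (fst N) (snd N) x"
      using hom_iff[OF O(4)] x H(3) by simp
    fix Z t y assume Z: "(Z, t) \<in> Ob (Inj C I)" and y: "partial_hom Y R d Z t y"
    have ya: "arr y Y Z" and yj: "y \<cdot> j \<in> Hom (Inj C I) M (Z, t)"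
      using hom_iff[OF Z, of y] y by simp_all
    note yja = arr_comp[OF j(2) ya]
    \<comment> \<open>The fillers \<open>y \<cdot> b s\<close> transpose to homomorphisms on the
      free summands, which assemble to a map \<open>q\<close> on \<open>Q\<close>.\<close>
    have "\<exists>\<beta>. \<beta> \<in> Hom (Inj C I) (Fo F (T s)) (Z, t) \<and> \<beta> \<cdot> \<eta> (T s) = y \<cdot> b s" if s: "s \<in> A" for s
      using unit_factor[of "y \<cdot> b s" "T s" "(Z, t)"] arr_comp[OF b(1)[OF s] ya] Z by auto
    then obtain \<beta> where \<beta>: "\<And>s. s \<in> A \<Longrightarrow> \<beta> s \<in> Hom (Inj C I) (Fo F (T s)) (Z, t)"
        "\<And>s. s \<in> A \<Longrightarrow> \<beta> s \<cdot> \<eta> (T s) = y \<cdot> b s"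
      by metis
    obtain q where q: "q \<in> Hom (Inj C I) Q (Z, t)" "\<And>s. s \<in> A \<Longrightarrow> q \<cdot> \<iota>' s = \<beta> s"
      using cQ_univ[OF Z \<beta>(1)] by blast
    have qa: "arr q (fst Q) Z"
      using Inj_Hom_arr[OF O(2) Z q(1)] by simp
    have yju: "y \<cdot> j \<cdot> u \<in> Hom (Inj C I) P (Z, t)"
      by (rule Inj_comp[OF O(1,3) Z H(2) yj])
    have qg: "q \<cdot> g \<in> Hom (Inj C I) P (Z, t)"
      by (rule Inj_comp[OF O(1,2) Z H(1) q(1)])
    \<comment> \<open>Both sides start at a free object and may be compared after the unit; there
      the equation reduces to the attaching condition
      \<open>b s \<cdot> \<alpha> s = j \<cdot> w s\<close>.\<close>
    have "y \<cdot> j \<cdot> u \<cdot> \<iota> s = q \<cdot> g \<cdot> \<iota> s" if s: "s \<in> A" for s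
    proof (rule unit_eq[OF SO[OF s] Z])
      show "y \<cdot> j \<cdot> u \<cdot> \<iota> s \<in> Hom (Inj C I) (Fo F (S s)) (Z, t)"
        by (rule Inj_comp[OF F_Ob[OF SO[OF s]] O(1) Z \<iota>H[OF s] yju])
      show "q \<cdot> g \<cdot> \<iota> s \<in> Hom (Inj C I) (Fo F (S s)) (Z, t)"
        by (rule Inj_comp[OF F_Ob[OF SO[OF s]] O(1) Z \<iota>H[OF s] qg])
      have "y \<cdot> j \<cdot> u \<cdot> \<iota> s \<cdot> \<eta> (S s) = y \<cdot> j \<cdot> w s"
        using w_comp[OF s yja] by simp
      also have "\<dots> = y \<cdot> (b s \<cdot> \<alpha> s)"
        using assoc[OF w[OF s] j(2) ya] b(2)[OF s] by simp
      also have "\<dots> = q \<cdot> \<iota>' s \<cdot> \<eta> (T s) \<cdot> \<alpha> s"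
        using assoc[OF \<alpha>[OF s] b(1)[OF s] ya] \<beta>(2)[OF s] q(2)[OF s] by simp
      also have "\<dots> = q \<cdot> g \<cdot> \<iota> s \<cdot> \<eta> (S s)"
        using transpose[OF s qa] by simp
      finally show "y \<cdot> j \<cdot> u \<cdot> \<iota> s \<cdot> \<eta> (S s) = q \<cdot> g \<cdot> \<iota> s \<cdot> \<eta> (S s)" .
    qed
    moreover have "\<exists>!h. h \<in> Hom (Inj C I) P (Z, t) \<and> (\<forall>s\<in>A. h \<cdot> \<iota> s = q \<cdot> g \<cdot> \<iota> s)"
      using Inj_comp[OF F_Ob[OF SO] O(1) Z \<iota>H qg] by (intro cP_univ[OF Z]) blast
    ultimately have "y \<cdot> j \<cdot> u = q \<cdot> g"
      using yju qg by blast
    then have ex1: "\<exists>!h. h \<in> Hom (Inj C I) N (Z, t) \<and> h \<cdot> f = y \<cdot> j \<and> h \<cdot> v = q"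
      by (rule push_univ[OF Z yj q(1)])
    then obtain h where h: "h \<in> Hom (Inj C I) N (Z, t)" "h \<cdot> f = y \<cdot> j" "h \<cdot> v = q"
      by blast
    have ha: "arr h (fst N) Z"
      using Inj_Hom_arr[OF O(4) Z h(1)] by simp
    show "\<exists>!h. h \<in> Hom (Inj C I) (fst N, snd N) (Z, t) \<and> h \<cdot> x = y"
    proof (rule ex1I[of _ h])
      have "h \<cdot> x = y"
      proof (rule b_eq[OF arr_comp[OF x(1) ha] ya])
        show "h \<cdot> x \<cdot> j = y \<cdot> j"
          using assoc[OF j(2) x(1) ha] x(2) h(2) by simp
        show "h \<cdot> x \<cdot> b s = y \<cdot> b s" if s: "s \<in> A" for s
          using assoc[OF b(1)[OF s] x(1) ha] x(3)[OF s] z_comp[OF s ha] h(3) q(2)[OF s] \<beta>(2)[OF s]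
          by simp
      qed
      then show "h \<in> Hom (Inj C I) (fst N, snd N) (Z, t) \<and> h \<cdot> x = y"
        using h(1) by simp
      fix k assume k: "k \<in> Hom (Inj C I) (fst N, snd N) (Z, t) \<and> k \<cdot> x = y"
      then have kH: "k \<in> Hom (Inj C I) N (Z, t)"
        by simp
      have ka: "arr k (fst N) Z"
        using Inj_Hom_arr[OF O(4) Z kH] by simp
      have kf: "k \<cdot> f = y \<cdot> j"
        using assoc[OF j(2) x(1) ka] x(2) k by simp
      have kv: "k \<cdot> v \<in> Hom (Inj C I) Q (Z, t)"
        by (rule Inj_comp[OF O(2,4) Z H(4) kH])
      \<comment> \<open>Uniqueness transposes in the same way: \<open>k \<cdot> x = y\<close> fixes
        \<open>k\<close> on the fillers \<open>z s\<close>, hence \<open>k \<cdot> v\<close> on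
        every free summand of \<open>Q\<close>.\<close>
      have "k \<cdot> v \<cdot> \<iota>' s = \<beta> s" if s: "s \<in> A" for s
      proof (rule unit_eq[OF TO[OF s] Z _ \<beta>(1)[OF s]])
        show "k \<cdot> v \<cdot> \<iota>' s \<in> Hom (Inj C I) (Fo F (T s)) (Z, t)"
          by (rule Inj_comp[OF F_Ob[OF TO[OF s]] O(2) Z \<iota>'H[OF s] kv])
        show "k \<cdot> v \<cdot> \<iota>' s \<cdot> \<eta> (T s) = \<beta> s \<cdot> \<eta> (T s)"
          using z_comp[OF s ka] x(3)[OF s] assoc[OF b(1)[OF s] x(1) ka] k \<beta>(2)[OF s] by simp
      qed
      then have "k \<cdot> v = q"
        using cQ_univ[OF Z \<beta>(1)] kv q by blast
      then show "k = h"
        using ex1 kH kf h by blast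
    qed
  qed
  then have "sequential_composite cell_step Y (fst N) x"
    by (rule universal_hom_sequential[OF R])
  then have "sequential_composite cell_step (fst M) (fst N) (x \<cdot> j)"
    by (rule sequential_composite_Cons[where S = cell_step, OF j(2,1)])
  then show ?thesis
    using x(2) by simp
qed

lemma forget_cellular:
  assumes "cellular \<kappa> (Inj C I) (image_family F I) M N h"
  shows "cellular \<kappa> C I (fst M) (fst N) h"
  unfolding cellular_def
  by (rule transfinite_composite_of_sequential[OF
        forget_transfinite_composite[where S = "pushout_of_coproduct \<kappa> (Inj C I) (image_family F I)"
          and S' = "sequential_composite cell_step", OF assms[unfolded cellular_def] forget_pushout]
        pushout_of_coproduct_Id])

end

theorem theorem4p3:
  fixes \<kappa> :: "'k rel"
    and C :: "('o, 'm) cat"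
    and I :: "('i, 'o, 'm) family"
    and F :: "('o, 'm, 'o \<times> ('i \<times> 'm \<Rightarrow> 'm), 'm) fctr"
    and \<eta> :: "'o \<Rightarrow> 'm"
  assumes "Card_order \<kappa>" and "regularCard \<kappa>" and "natLeq <o \<kappa>"
    and "category C" and "cocomplete \<kappa> C"
    and "is_family \<kappa> C I"
    and "\<forall>i\<in>Index I. finitely_presentable \<kappa> C (Src I i)"
    and "\<forall>X Y f. cellular \<kappa> C I X Y f \<longrightarrow> is_mono C X Y f"
    and "left_adjoint_with_unit C (Inj C I) forget F \<eta>"
  shows "(\<forall>X\<in>Ob C. cellular \<kappa> C I X (Fo forget (Fo F X)) (\<eta> X)) \<and>
    (\<forall>M N h. cellular \<kappa> (Inj C I) (image_family F I) M N h \<longrightarrow>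
       cellular \<kappa> C I (Fo forget M) (Fo forget N) (Fm forget M N h)) \<and>
    faithful C F"
proof -
  interpret category C
    by fact
  interpret free_algebras \<kappa> C I F \<eta>
    by unfold_locales (use assms in auto)
  show ?thesis
    using unit_cellular forget_cellular faithful_F by (simp add: forget_def)
qed

end
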